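(* Let $\mathcal M'$ be an effective dual $t$-motive which is free of rank $r$ over $\overline K[t]$ with basis $m_1,\dots,m_r$ and free of rank $d$ over $\overline K[\sigma]$ with basis $w_1,\dots,w_d$, let $\Phi'\in\mathrm{Mat}_r(\overline K[t])$ be given by $\sigma m_i=\sum_j\Phi'_{ij}m_j$, and let $E'$ be the Anderson $t$-module associated to $\mathcal M'$. Let $\mathbf f=(f_1,\dots,f_r)\in\mathrm{Mat}_{1\times r}(\overline K[t])$, $\Phi=\begin{pmatrix}\Phi'&0\\ \mathbf f&1\end{pmatrix}$, and let $\Psi\in\mathrm{GL}_{r+1}(\mathbb L)$ with $\Psi^{(-1)}=\Phi\Psi$ and $\Upsilon:=\Psi^{-1}=\begin{pmatrix}\Upsilon'&0\\ \Upsilon_{r+1}&1\end{pmatrix}\in\mathrm{Mat}_{r+1}(\mathbb T)$, $\Upsilon_{r+1}\in\mathrm{Mat}_{1\times r}(\mathbb T)$. Put $\mathbf v_{\mathcal M}=\delta_1(f_1m_1+\dots+f_rm_r)$. Then $\delta_0(\mathbf f^\top-\Upsilon_{r+1}^\top)$ is a unit for $E'$, and $$\mathrm{Exp}_{E'}\big(\delta_0(\mathbf f^\top-\Upsilon_{r+1}^\top)\big)=\mathbf v_{\mathcal M}.$$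
   Context: Notation: $\mathbb F_q$ finite field, $A=\mathbb F_q[\theta]$, $K=\mathbb F_q(\theta)$, $\mathbb C_\infty$ the completion of an algebraic closure of $\mathbb F_q((1/\theta))$ (with $|\theta|_\infty=q$), $\overline K$ the algebraic closure of $K$ in $\mathbb C_\infty$. $\mathbb T$ is the Tate algebra of power series $\sum b_it^i$ over $\mathbb C_\infty$ with $|b_i|_\infty\to0$, $\mathbb L$ its fraction field. Twisting: $(\sum c_jt^j)^{(i)}=\sum c_j^{q^i}t^j$, $i\in\mathbb Z$, entrywise on matrices. $\overline K[t,\sigma]$: $t$ central, $\sigma c=c^{1/q}\sigma$. An effective dual $t$-motive is a left $\overline K[t,\sigma]$-module, free finitely generated over $\overline K[t]$, with $(t-\theta)^\ell(\mathcal M'/\sigma\mathcal M')=0$ for $\ell\gg0$. Identify $(g_1,\dots,g_r)^\top\in\overline K[t]^r$ with $\sum g_im_i$. Each $m\in\mathcal M'$ is uniquely $\sum_{i\ge0}\sum_jc_{i,j}\sigma^iw_j$ ($c_{i,j}\in\overline K$); $\delta_0(m)=(c_{0,1},\dots,c_{0,d})^\top$, $\delta_1(m)=\sum_i(c_{i,1}^{q^i},\dots,c_{i,d}^{q^i})^\top$. $\delta_0$ factors through $\mathcal M'/(t-\theta)^N\mathcal M'$ for $N$ large and is extended in the natural way to $\mathcal M'\otimes_{\overline K[t]}\mathbb T\cong\mathbb T^r$. The Anderson $t$-module $E':A\to\mathrm{Mat}_d(\overline K)[\tau]$ ($\tau c=c^q\tau$, $E'_a=d[a]+\sum_{k\ge1}E'_{a,k}\tau^k$)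 associated to $\mathcal M'$ is defined by $E'_a(\delta_1(m))=\delta_1(a(t)m)$, $a(t)$ being $a$ with $\theta$ replaced by $t$. $\mathrm{Exp}_{E'}=\sum_iQ_i\tau^i$, $Q_0=I_d$, is the unique such series with $\mathrm{Exp}_{E'}d[a]=E'_a\mathrm{Exp}_{E'}$, viewed as an entire function on $\mathbb C_\infty^d$ ($\tau$ raising entries to the $q$-th power). A point $\mathbf z\in\mathbb C_\infty^d$ is a unit for $E'$ if $\mathrm{Exp}_{E'}(\mathbf z)\in\overline K^d$. *)

theory Defs
  imports
    "HOL-Analysis.Elementary_Topology"
    "HOL-Computational_Algebra.Formal_Laurent_Series"
    "HOL-Computational_Algebra.Polynomial_FPS"
    "Jordan_Normal_Form.Matrix"
begin

section \<open>The field \<open>\<complex>\<^sub>\<infinity>\<close>\<close>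

text \<open>The library constant \<open>norm\<close> is restricted to real vector spaces.\<close>
class nonarch_valued_field = field + metric_space +
  fixes vabs :: "'a \<Rightarrow> real"
  assumes dist_vabs: "dist x y = vabs (x - y)"
    and vabs_mult: "vabs (x * y) = vabs x * vabs y"
    and vabs_ultrametric: "vabs (x + y) \<le> max (vabs x) (vabs y)"

definition is_subfield :: "'c::field set \<Rightarrow> bool" where
  "is_subfield S \<longleftrightarrow> 0 \<in> S \<and> 1 \<in> S \<and>
     (\<forall>x\<in>S. \<forall>y\<in>S. x + y \<in> S \<and> x * y \<in> S) \<and> (\<forall>x\<in>S. - x \<in> S \<and> inverse x \<in> S)"

definition polys_over :: "'c::zero set \<Rightarrow> 'c poly set" where
  "polys_over S = {p. \<forall>i. coeff p i \<in> S}"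

definition algebraic_closure_in :: "'c::field set \<Rightarrow> 'c set" where
  "algebraic_closure_in S = {x. \<exists>p\<in>polys_over S. p \<noteq> 0 \<and> poly p x = 0}"

definition rational_subfield :: "'c::field set \<Rightarrow> 'c \<Rightarrow> 'c set" where
  "rational_subfield F \<theta> =
     {poly a \<theta> / poly b \<theta> |a b. a \<in> polys_over F \<and> b \<in> polys_over F \<and> poly b \<theta> \<noteq> 0}"

definition K_bar :: "'c::field set \<Rightarrow> 'c \<Rightarrow> 'c set" where
  "K_bar F \<theta> = algebraic_closure_in (rational_subfield F \<theta>)"

text \<open>
  The topological closure of \<open>\<bbbF>\<^sub>q(\<theta>)\<close> is \<open>\<bbbF>\<^sub>q((1/\<theta>))\<close>, because \<open>|\<theta>| = q > 1\<close> and the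
  absolute value is trivial on a finite subfield.
\<close>
definition K_infinity :: "'c::nonarch_valued_field set \<Rightarrow> 'c \<Rightarrow> 'c set" where
  "K_infinity F \<theta> = closure (rational_subfield F \<theta>)"

text \<open>
  The type is the completion of an algebraic closure of \<open>K_infinity F \<theta>\<close>: it is complete (by
  its sort), and the elements algebraic over \<open>K_infinity F \<theta>\<close> form an algebraically closed, dense
  subset.
\<close>
locale C_infinity =
  fixes q :: nat and F :: "'c::{nonarch_valued_field, complete_space} set" and \<theta> :: 'c
  assumes subfield: "is_subfield F"
    and finite: "finite F"
    and card: "card F = q"
    and vabs_theta: "vabs \<theta> = real q"
    and alg_closed: "\<And>p. p \<in> polys_over (algebraic_closure_in (K_infinity F \<theta>)) \<Longrightarrow> degree p > 0 \<Longrightarrow>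
          \<exists>x\<in>algebraic_closure_in (K_infinity F \<theta>). poly p x = 0"
    and dense: "closure (algebraic_closure_in (K_infinity F \<theta>)) = UNIV"

section \<open>Tate algebras and twisting\<close>

text \<open>Power series converging on the closed disc \<open>|t| \<le> \<rho>\<close>; \<open>Tate 1\<close> is \<open>\<bbbT>\<close>.\<close>
definition Tate :: "real \<Rightarrow> 'c::nonarch_valued_field fps set" where
  "Tate \<rho> = {g. (\<lambda>i. vabs (fps_nth g i) * \<rho> ^ i) \<longlonglongrightarrow> 0}"

text \<open>The fraction field \<open>\<bbbL>\<close> of \<open>\<bbbT>\<close>, inside the fraction field of the ring of all power series.\<close>
definition Tate_fractions :: "'c::nonarch_valued_field fls set" where
  "Tate_fractions = {fps_to_fls g / fps_to_fls h |g h. g \<in> Tate 1 \<and> h \<in> Tate 1 \<and> h \<noteq> 0}"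

definition twist :: "nat \<Rightarrow> int \<Rightarrow> 'c::field \<Rightarrow> 'c" where
  "twist q i c = (if i \<ge> 0 then c ^ (q ^ nat i) else (THE b. b ^ (q ^ nat (- i)) = c))"

text \<open>
  Coefficientwise twisting is a field automorphism of the Laurent series, so on \<open>Tate_fractions\<close> it
  is the extension of the twist of \<open>\<bbbT>\<close> to fractions.
\<close>
definition twist_fls :: "nat \<Rightarrow> int \<Rightarrow> 'c::field fls \<Rightarrow> 'c fls" where
  "twist_fls q i g = Abs_fls (\<lambda>n. twist q i (fls_nth g n))"

abbreviation poly_to_fls :: "'c::field poly \<Rightarrow> 'c fls" where
  "poly_to_fls p \<equiv> fps_to_fls (fps_of_poly p)"

section \<open>Effective dual \<open>t\<close>-motives\<close>

definition Kt_basis ::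
  "'c::field set \<Rightarrow> 'c \<Rightarrow> ('c poly \<Rightarrow> 'm::ab_group_add \<Rightarrow> 'm) \<Rightarrow> nat \<Rightarrow> (nat \<Rightarrow> 'm) \<Rightarrow> bool" where
  "Kt_basis F \<theta> act r m \<longleftrightarrow>
     (\<forall>x. \<exists>!g. g \<in> carrier_vec r \<and> (\<forall>j<r. g $ j \<in> polys_over (K_bar F \<theta>)) \<and>
        x = (\<Sum>j<r. act (g $ j) (m j)))"

text \<open>
  A left module over \<open>K\<^bsup>-\<^esup>[t,\<sigma>]\<close> is a module over \<open>K\<^bsup>-\<^esup>[t]\<close> with an additive \<open>\<sigma>\<close> that commutes with
  \<open>t\<close> and satisfies \<open>\<sigma> c = c\<^bsup>1/q\<^esup> \<sigma>\<close>. Only the values of \<open>act\<close> on \<open>K\<^bsup>-\<^esup>[t]\<close> are meaningful.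
\<close>
locale effective_dual_t_motive = C_infinity q F \<theta>
  for q :: nat and F :: "'c::{nonarch_valued_field, complete_space} set" and \<theta> :: 'c +
  fixes act :: "'c poly \<Rightarrow> 'm::ab_group_add \<Rightarrow> 'm" and \<sigma> :: "'m \<Rightarrow> 'm"
  assumes scale_add_right: "\<And>a x y. a \<in> polys_over (K_bar F \<theta>) \<Longrightarrow> act a (x + y) = act a x + act a y"
    and scale_add_left: "\<And>a b x. a \<in> polys_over (K_bar F \<theta>) \<Longrightarrow> b \<in> polys_over (K_bar F \<theta>) \<Longrightarrow>
          act (a + b) x = act a x + act b x"
    and scale_mult: "\<And>a b x. a \<in> polys_over (K_bar F \<theta>) \<Longrightarrow> b \<in> polys_over (K_bar F \<theta>) \<Longrightarrow>
          act (a * b) x = act a (act b x)"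
    and scale_one: "\<And>x. act 1 x = x"
    and sigma_add: "\<And>x y. \<sigma> (x + y) = \<sigma> x + \<sigma> y"
    and sigma_scale: "\<And>a x. a \<in> polys_over (K_bar F \<theta>) \<Longrightarrow>
          \<sigma> (act a x) = act (map_poly (twist q (- 1)) a) (\<sigma> x)"
    and free: "\<exists>r m. Kt_basis F \<theta> act r m"
    and effective: "\<exists>l0. \<forall>l\<ge>l0. \<forall>x. \<exists>y. act ([:- \<theta>, 1:] ^ l) x = \<sigma> y"

text \<open>
  An element \<open>\<Sum>\<^sub>i c\<^sub>i \<sigma>\<^sup>i\<close> of \<open>K\<^bsup>-\<^esup>[\<sigma>]\<close> is represented by the ordinary polynomial with
  coefficients \<open>c\<^sub>i\<close> (the product of polynomials is not that of \<open>K\<^bsup>-\<^esup>[\<sigma>]\<close> and is not used).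
\<close>
definition sigma_combination ::
  "('c::field poly \<Rightarrow> 'm::ab_group_add \<Rightarrow> 'm) \<Rightarrow> ('m \<Rightarrow> 'm) \<Rightarrow> nat \<Rightarrow> (nat \<Rightarrow> 'm) \<Rightarrow> 'c poly vec \<Rightarrow> 'm" where
  "sigma_combination act \<sigma> d w c =
     (\<Sum>j<d. \<Sum>i\<le>degree (c $ j). act [:coeff (c $ j) i:] ((\<sigma> ^^ i) (w j)))"

definition sigma_coords ::
  "'c::field set \<Rightarrow> 'c \<Rightarrow> ('c poly \<Rightarrow> 'm::ab_group_add \<Rightarrow> 'm) \<Rightarrow> ('m \<Rightarrow> 'm) \<Rightarrow> nat \<Rightarrow> (nat \<Rightarrow> 'm) \<Rightarrow>
   'm \<Rightarrow> 'c poly vec \<Rightarrow> bool" where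
  "sigma_coords F \<theta> act \<sigma> d w x c \<longleftrightarrow>
     c \<in> carrier_vec d \<and> (\<forall>j<d. c $ j \<in> polys_over (K_bar F \<theta>)) \<and> x = sigma_combination act \<sigma> d w c"

definition Ksigma_basis ::
  "'c::field set \<Rightarrow> 'c \<Rightarrow> ('c poly \<Rightarrow> 'm::ab_group_add \<Rightarrow> 'm) \<Rightarrow> ('m \<Rightarrow> 'm) \<Rightarrow> nat \<Rightarrow> (nat \<Rightarrow> 'm) \<Rightarrow> bool" where
  "Ksigma_basis F \<theta> act \<sigma> d w \<longleftrightarrow> (\<forall>x. \<exists>!c. sigma_coords F \<theta> act \<sigma> d w x c)"

definition delta0 ::
  "'c::field set \<Rightarrow> 'c \<Rightarrow> ('c poly \<Rightarrow> 'm::ab_group_add \<Rightarrow> 'm) \<Rightarrow> ('m \<Rightarrow> 'm) \<Rightarrow> nat \<Rightarrow> (nat \<Rightarrow> 'm) \<Rightarrow>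
   'm \<Rightarrow> 'c vec" where
  "delta0 F \<theta> act \<sigma> d w x =
     (let c = (THE c. sigma_coords F \<theta> act \<sigma> d w x c) in vec d (\<lambda>j. coeff (c $ j) 0))"

definition delta1 ::
  "nat \<Rightarrow> 'c::field set \<Rightarrow> 'c \<Rightarrow> ('c poly \<Rightarrow> 'm::ab_group_add \<Rightarrow> 'm) \<Rightarrow> ('m \<Rightarrow> 'm) \<Rightarrow> nat \<Rightarrow> (nat \<Rightarrow> 'm) \<Rightarrow>
   'm \<Rightarrow> 'c vec" where
  "delta1 q F \<theta> act \<sigma> d w x =
     (let c = (THE c. sigma_coords F \<theta> act \<sigma> d w x c)
      in vec d (\<lambda>j. \<Sum>i\<le>degree (c $ j). coeff (c $ j) i ^ (q ^ i)))"

text \<open>The \<open>\<complex>\<^sub>\<infinity>\<close>-linear extension of \<open>delta0\<close> to \<open>\<complex>\<^sub>\<infinity>[t]\<^sup>r\<close>, where \<open>h\<close> stands for \<open>\<Sum>\<^sub>j h\<^sub>j m\<^sub>j\<close>.\<close>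
definition delta0_poly ::
  "'c::field set \<Rightarrow> 'c \<Rightarrow> ('c poly \<Rightarrow> 'm::ab_group_add \<Rightarrow> 'm) \<Rightarrow> ('m \<Rightarrow> 'm) \<Rightarrow> nat \<Rightarrow> (nat \<Rightarrow> 'm) \<Rightarrow>
   nat \<Rightarrow> (nat \<Rightarrow> 'm) \<Rightarrow> 'c poly vec \<Rightarrow> 'c vec" where
  "delta0_poly F \<theta> act \<sigma> r m d w h =
     vec d (\<lambda>l. \<Sum>j<r. \<Sum>i\<le>degree (h $ j).
       coeff (h $ j) i * (delta0 F \<theta> act \<sigma> d w (act (monom 1 i) (m j)) $ l))"

text \<open>
  Since \<open>\<complex>\<^sub>\<infinity>[t]/(t - \<theta>)\<^sup>N\<close> is also the quotient by \<open>(t - \<theta>)\<^sup>N\<close> of the ring of series converging on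
  \<open>|t| \<le> |\<theta>|\<close>, a map that factors through reduction modulo \<open>(t - \<theta>)\<^sup>N\<close> extends to vectors of such
  series: replace the vector \<open>g\<close> by a polynomial vector \<open>h\<close> congruent to it. Convergence at \<open>\<theta>\<close> is
  essential: in \<open>Tate 1\<close> the element \<open>t - \<theta>\<close> is a unit.
\<close>
definition delta0_ext ::
  "'c::nonarch_valued_field set \<Rightarrow> 'c \<Rightarrow> ('c poly \<Rightarrow> 'm::ab_group_add \<Rightarrow> 'm) \<Rightarrow> ('m \<Rightarrow> 'm) \<Rightarrow>
   nat \<Rightarrow> (nat \<Rightarrow> 'm) \<Rightarrow> nat \<Rightarrow> (nat \<Rightarrow> 'm) \<Rightarrow> 'c fps vec \<Rightarrow> 'c vec" where
  "delta0_ext F \<theta> act \<sigma> r m d w g =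
     (THE v. \<exists>N h u.
        (\<forall>x. delta0 F \<theta> act \<sigma> d w (act ([:- \<theta>, 1:] ^ N) x) = 0\<^sub>v d) \<and>
        h \<in> carrier_vec r \<and> u \<in> carrier_vec r \<and>
        (\<forall>j<r. u $ j \<in> Tate (vabs \<theta>) \<and>
           g $ j = fps_of_poly (h $ j) + fps_of_poly ([:- \<theta>, 1:] ^ N) * u $ j) \<and>
        v = delta0_poly F \<theta> act \<sigma> r m d w h)"

section \<open>Anderson \<open>t\<close>-modules and their exponentials\<close>

definition tau_poly_apply :: "nat \<Rightarrow> nat \<Rightarrow> (nat \<Rightarrow> 'c::field mat) \<Rightarrow> 'c vec \<Rightarrow> 'c vec" where
  "tau_poly_apply q d B z =
     vec d (\<lambda>i. \<Sum>k | B k \<noteq> 0\<^sub>m d d. (B k *\<^sub>v map_vec (twist q (int k)) z) $ i)"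

text \<open>
  \<open>E a k\<close> is the coefficient of \<open>\<tau>\<^sup>k\<close> in \<open>E\<^sub>a\<close>. The polynomial \<open>p\<close> over \<open>F\<close> is \<open>a(t)\<close>, where
  \<open>a = poly p \<theta>\<close>.
\<close>
definition associated_t_module ::
  "nat \<Rightarrow> 'c::field set \<Rightarrow> 'c \<Rightarrow> ('c poly \<Rightarrow> 'm::ab_group_add \<Rightarrow> 'm) \<Rightarrow> ('m \<Rightarrow> 'm) \<Rightarrow> nat \<Rightarrow> (nat \<Rightarrow> 'm) \<Rightarrow>
   ('c \<Rightarrow> nat \<Rightarrow> 'c mat) \<Rightarrow> bool" where
  "associated_t_module q F \<theta> act \<sigma> d w E \<longleftrightarrow>
     (\<forall>p\<in>polys_over F.
        (\<forall>k. E (poly p \<theta>) k \<in> carrier_mat d d \<and> elements_mat (E (poly p \<theta>) k) \<subseteq> K_bar F \<theta>) \<and>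
        finite {k. E (poly p \<theta>) k \<noteq> 0\<^sub>m d d} \<and>
        (\<forall>x. tau_poly_apply q d (E (poly p \<theta>)) (delta1 q F \<theta> act \<sigma> d w x) =
             delta1 q F \<theta> act \<sigma> d w (act p x)))"

text \<open>
  The coefficients \<open>Q\<^sub>n\<close> of \<open>Exp\<^sub>E\<close>; the last condition compares the coefficients of \<open>\<tau>\<^sup>n\<close> in
  \<open>Exp\<^sub>E d[a] = E\<^sub>a Exp\<^sub>E\<close>, with \<open>\<tau> c = c\<^sup>q \<tau>\<close> and \<open>d[a] = E a 0\<close>.
\<close>
definition exponential_series ::
  "nat \<Rightarrow> 'c::field set \<Rightarrow> 'c \<Rightarrow> nat \<Rightarrow> ('c \<Rightarrow> nat \<Rightarrow> 'c mat) \<Rightarrow> (nat \<Rightarrow> 'c mat) \<Rightarrow> bool" where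
  "exponential_series q F \<theta> d E Q \<longleftrightarrow>
     (\<forall>n. Q n \<in> carrier_mat d d) \<and> Q 0 = 1\<^sub>m d \<and>
     (\<forall>p\<in>polys_over F. \<forall>n. \<forall>i<d. \<forall>j<d.
        (Q n * map_mat (twist q (int n)) (E (poly p \<theta>) 0)) $$ (i, j) =
        (\<Sum>k\<le>n. (E (poly p \<theta>) k * map_mat (twist q (int k)) (Q (n - k))) $$ (i, j)))"

definition Exp_value :: "nat \<Rightarrow> nat \<Rightarrow> (nat \<Rightarrow> 'c::nonarch_valued_field mat) \<Rightarrow> 'c vec \<Rightarrow> 'c vec" where
  "Exp_value q d Q z = vec d (\<lambda>i. \<Sum>n. (Q n *\<^sub>v map_vec (twist q (int n)) z) $ i)"

text \<open>\<open>z\<close> is a unit for the \<open>t\<close>-module whose exponential series is \<open>Q\<close>.\<close>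
definition is_unit_point ::
  "nat \<Rightarrow> 'c::nonarch_valued_field set \<Rightarrow> 'c \<Rightarrow> nat \<Rightarrow> (nat \<Rightarrow> 'c mat) \<Rightarrow> 'c vec \<Rightarrow> bool" where
  "is_unit_point q F \<theta> d Q z \<longleftrightarrow>
     z \<in> carrier_vec d \<and> (\<forall>i<d. Exp_value q d Q z $ i \<in> K_bar F \<theta>)"

end

theory Submission
  imports
    Defs
    "HOL-Algebra.Finite_Extensions"
    "HOL-Algebra.Sylow"
    "Jordan_Normal_Form.Determinant"
begin

text \<open>
  The last row \<open>g\<close> of \<open>\<Upsilon>\<close> satisfies \<open>g = \<sigma> g + f\<close>. Effectivity inverts \<open>\<Phi>'\<close> up to a power of \<open>t - \<theta>\<close>, and
  the equation then forces the coefficients of \<open>G = - g\<close> to be \<open>O(q\<^bsup>-qn\<^esup>)\<close>; in particular \<open>g\<close> converges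
  at \<open>\<theta>\<close>. Let \<open>G\<^sub>n\<close> be what remains of \<open>G\<close> after removing the first \<open>n\<close> coefficients and dividing by
  \<open>t\<^sup>n\<close>. The \<open>h\<^sub>n = \<sigma> G\<^sub>n - G\<^sub>n\<close> are polynomials of bounded degree, \<open>h\<^sub>0 = f\<close>, and \<open>h\<^sub>n\<close> and \<open>t h\<^sub>n\<^sub>+\<^sub>1\<close>
  differ by an element of the form \<open>\<sigma> b - b\<close>, which \<open>\<delta>\<^sub>1\<close> kills. Hence \<open>y\<^sub>n = \<delta>\<^sub>1(h\<^sub>n)\<close> satisfies
  \<open>E'\<^sub>\<theta>(y\<^sub>n\<^sub>+\<^sub>1) = y\<^sub>n\<close>, and \<open>z\<^sub>n = \<delta>\<^sub>0(h\<^sub>n + G\<^sub>n) = \<delta>\<^sub>0(\<sigma> G\<^sub>n)\<close> satisfies \<open>d[\<theta>] z\<^sub>n\<^sub>+\<^sub>1 = z\<^sub>n\<close>. The errors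
  \<open>e\<^sub>n = y\<^sub>n - Exp(z\<^sub>n)\<close> therefore satisfy \<open>E'\<^sub>\<theta>(e\<^sub>n\<^sub>+\<^sub>1) = e\<^sub>n\<close> and are \<open>O(q\<^bsup>-2n\<^esup>)\<close>. In a norm adapted to
  the nilpotent part of \<open>d[\<theta>]\<close>, the map \<open>E'\<^sub>\<theta>\<close> stretches small vectors by at most \<open>q\<close>, so all \<open>e\<^sub>n\<close>
  vanish, and \<open>e\<^sub>0 = 0\<close> is the assertion.
\<close>

text \<open>The argument is a comparison of rates. The q-th roots of the coefficients of G are
  O(q^-n), and the coefficients of h_n inherit that rate. Both \<delta>_1 - \<delta>_0 and Exp(z) -
  z consist of terms of degree q^i with i \<ge> 1, so they are quadratically small, and because q
  \<ge> 2 the tails G_n contribute O(q^-2n) as well. This is where the exponent 2 in e_n = O(q^-2n)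
  comes from, and it is set against a loss of q^n for n steps of E'_\<theta>. In the sup norm every
  step could cost a further constant factor, and n steps would turn it into a power that the spare
  factor q^-n need not absorb; a norm in which d[\<theta>] stretches by exactly |\<theta>| removes
  this obstacle. The same norm gives the growth of \<delta>_0(t^i x) that matches convergence on |t|
  \<le> q, and it serves to prove that Exp converges everywhere.\<close>

hide_const (open) Polynomials.degree Polynomials.lead_coeff Divisibility.prime up_ring.monom up_ring.coeff

section \<open>Non-archimedean fields\<close>

lemma vabs_eq_dist: "vabs (x::'c::nonarch_valued_field) = dist x 0"
  by (simp add: dist_vabs)

lemma vabs_nonneg [simp]: "0 \<le> vabs (x::'c::nonarch_valued_field)"
  by (simp add: vabs_eq_dist)

lemma vabs_eq_0_iff [simp]: "vabs (x::'c::nonarch_valued_field) = 0 \<longleftrightarrow> x = 0"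
  by (simp add: vabs_eq_dist)

lemma vabs_zero [simp]: "vabs (0::'c::nonarch_valued_field) = 0"
  by simp

lemma vabs_one [simp]: "vabs (1::'c::nonarch_valued_field) = 1"
  using vabs_mult[of "1::'c" 1] by simp

lemma vabs_minus [simp]: "vabs (- x) = vabs (x::'c::nonarch_valued_field)"
  using dist_commute[of 0 x] by (simp add: dist_vabs)

lemma vabs_minus_commute: "vabs (x - y) = vabs (y - x::'c::nonarch_valued_field)"
  using vabs_minus[of "x - y"] by simp

lemma vabs_diff_le: "vabs (x - y) \<le> max (vabs x) (vabs (y::'c::nonarch_valued_field))"
  using vabs_ultrametric[of x "- y"] by simp

lemma vabs_add_leI: "vabs x \<le> B \<Longrightarrow> vabs y \<le> B \<Longrightarrow> vabs (x + y::'c::nonarch_valued_field) \<le> B"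
  using vabs_ultrametric[of x y] by simp

lemma vabs_diff_leI: "vabs x \<le> B \<Longrightarrow> vabs y \<le> B \<Longrightarrow> vabs (x - y::'c::nonarch_valued_field) \<le> B"
  using vabs_diff_le[of x y] by simp

lemma vabs_power: "vabs (x ^ n) = vabs (x::'c::nonarch_valued_field) ^ n"
  by (induction n) (simp_all add: vabs_mult)

lemma vabs_inverse: "vabs (inverse x) = inverse (vabs (x::'c::nonarch_valued_field))"
proof (cases "x = 0")
  case False
  then have "vabs x * vabs (inverse x) = 1"
    using vabs_mult[of x "inverse x"] by simp
  then show ?thesis
    by (metis inverse_unique)
qed simp

lemma vabs_sum_le:
  fixes f :: "'b \<Rightarrow> 'c::nonarch_valued_field"
  assumes "\<And>i. i \<in> A \<Longrightarrow> vabs (f i) \<le> B" "0 \<le> B"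
  shows "vabs (sum f A) \<le> B"
  using assms
  by (induction A rule: infinite_finite_induct) (auto intro!: vabs_add_leI)

text \<open>Makes the general rules for \<open>sums\<close> and limits (addition, negation, dropping
  the first term) available for series over the field.\<close>

instance nonarch_valued_field \<subseteq> topological_ab_group_add
proof
  fix a b :: 'a
  show "filterlim (\<lambda>x. fst x + snd x) (nhds (a + b)) (nhds a \<times>\<^sub>F nhds b)"
  proof (rule tendstoI)
    fix e :: real
    assume "0 < e"
    then have "\<forall>\<^sub>F x in nhds a \<times>\<^sub>F nhds b. dist (fst x) a < e \<and> dist (snd x) b < e"
      by (intro eventually_prodI[where P = "\<lambda>x. dist x a < e" and Q = "\<lambda>x. dist x b < e", THEN eventually_mono])
        (auto simp: eventually_nhds_metric)
    then show "\<forall>\<^sub>F x in nhds a \<times>\<^sub>F nhds b. dist (fst x + snd x) (a + b) < e"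
    proof (rule eventually_mono)
      fix x :: "'a \<times> 'a"
      assume "dist (fst x) a < e \<and> dist (snd x) b < e"
      then show "dist (fst x + snd x) (a + b) < e"
        using vabs_ultrametric[of "fst x - a" "snd x - b"]
        by (auto simp: dist_vabs add_diff_add)
    qed
  qed
  show "filterlim uminus (nhds (- a)) (nhds a)"
  proof (rule tendstoI)
    fix e :: real
    assume "0 < e"
    moreover have "dist (- x) (- a) = dist x a" for x
      by (simp add: dist_vabs vabs_minus_commute)
    ultimately show "\<forall>\<^sub>F x in nhds a. dist (- x) (- a) < e"
      by (auto simp: eventually_nhds_metric)
  qed
qed

lemma tendsto_vabs_iff:
  fixes l :: "'c::nonarch_valued_field"
  shows "(f \<longlongrightarrow> l) A \<longleftrightarrow> ((\<lambda>x. vabs (f x - l)) \<longlongrightarrow> 0) A"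
  by (subst tendsto_dist_iff) (simp add: dist_vabs)

lemma tendsto_vabs_mult_left:
  fixes l :: "'c::nonarch_valued_field"
  assumes "(f \<longlongrightarrow> l) A"
  shows "((\<lambda>x. c * f x) \<longlongrightarrow> c * l) A"
proof -
  have "((\<lambda>x. vabs c * vabs (f x - l)) \<longlongrightarrow> vabs c * 0) A"
    using assms by (intro tendsto_mult_left) (simp add: tendsto_vabs_iff)
  then show ?thesis
    by (subst tendsto_vabs_iff) (simp flip: vabs_mult add: right_diff_distrib)
qed

lemma sums_vabs_mult_left:
  fixes s :: "'c::nonarch_valued_field"
  assumes "f sums s"
  shows "(\<lambda>n. c * f n) sums (c * s)"
  using tendsto_vabs_mult_left[of "\<lambda>n. \<Sum>i<n. f i" s sequentially c] assms
  by (simp add: sums_def sum_distrib_left)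

text \<open>By the ultrametric inequality a block of the series is no larger than its largest term,
  so terms tending to 0 already give Cauchy partial sums.\<close>

lemma summable_vabs_tendsto_0:
  fixes f :: "nat \<Rightarrow> 'c::{nonarch_valued_field, complete_space}"
  assumes "(\<lambda>n. vabs (f n)) \<longlonglongrightarrow> 0"
  shows "summable f"
proof -
  have "Cauchy (\<lambda>n. \<Sum>i<n. f i)"
  proof (rule metric_CauchyI)
    fix e :: real
    assume e: "0 < e"
    obtain N where N: "\<And>n. n \<ge> N \<Longrightarrow> vabs (f n) < e / 2"
      using order_tendstoD(2)[OF assms, of "e / 2"] e by (auto simp: eventually_sequentially)
    have *: "dist (\<Sum>i<k. f i) (\<Sum>i<n. f i) < e" if "N \<le> k" "k \<le> n" for k n
    proof -
      have "(\<Sum>i<n. f i) - (\<Sum>i<k. f i) = (\<Sum>i=k..<n. f i)"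
        using that sum_diff_nat_ivl[of 0 k n f] by (simp add: lessThan_atLeast0)
      moreover have "vabs (\<Sum>i=k..<n. f i) \<le> e / 2"
      proof (rule vabs_sum_le)
        show "vabs (f i) \<le> e / 2" if "i \<in> {k..<n}" for i
          using N[of i] that \<open>N \<le> k\<close> by simp
      qed (use e in simp)
      ultimately show ?thesis
        using e vabs_minus_commute[of "\<Sum>i<k. f i"] by (simp add: dist_vabs)
    qed
    show "\<exists>M. \<forall>m\<ge>M. \<forall>n\<ge>M. dist (\<Sum>i<m. f i) (\<Sum>i<n. f i) < e"
      using * by (metis dist_commute nle_le)
  qed
  then show ?thesis
    by (simp add: summable_iff_convergent Cauchy_convergent_iff)
qed

text \<open>A term that is closer to \<open>l\<close> than \<open>vabs l\<close> cannot be smaller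
  than \<open>l\<close> in absolute value.\<close>

lemma vabs_tendsto_le:
  fixes l :: "'c::nonarch_valued_field"
  assumes "f \<longlonglongrightarrow> l" "\<And>n. vabs (f n) \<le> B"
  shows "vabs l \<le> B"
proof (rule ccontr)
  assume "\<not> vabs l \<le> B"
  moreover have "0 \<le> B"
    using assms(2)[of 0] vabs_nonneg order_trans by blast
  ultimately have "0 < vabs l"
    by linarith
  then obtain n where "vabs (f n - l) < vabs l"
    using order_tendstoD(2)[of "\<lambda>n. vabs (f n - l)" 0 sequentially "vabs l"] assms(1)
    by (auto simp: eventually_sequentially simp flip: tendsto_vabs_iff)
  moreover have "vabs l \<le> max (vabs (f n)) (vabs (f n - l))"
    using vabs_diff_le[of "f n" "f n - l"] by simp
  ultimately show False
    using assms(2)[of n] \<open>\<not> vabs l \<le> B\<close> by simp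
qed

lemma vabs_sums_le:
  fixes s :: "'c::nonarch_valued_field"
  assumes "f sums s" "\<And>n. vabs (f n) \<le> B"
  shows "vabs s \<le> B"
proof (rule vabs_tendsto_le)
  show "(\<lambda>n. \<Sum>i<n. f i) \<longlonglongrightarrow> s"
    using assms(1) by (simp add: sums_def)
  show "vabs (\<Sum>i<n. f i) \<le> B" for n
    using assms(2) order_trans[OF vabs_nonneg assms(2)] by (intro vabs_sum_le) auto
qed

section \<open>Subfields and algebraic closures\<close>

lemma is_subfieldD:
  assumes "is_subfield S"
  shows "0 \<in> S" "1 \<in> S" "\<And>x y. x \<in> S \<Longrightarrow> y \<in> S \<Longrightarrow> x + y \<in> S" "\<And>x y. x \<in> S \<Longrightarrow> y \<in> S \<Longrightarrow> x * y \<in> S"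
    "\<And>x. x \<in> S \<Longrightarrow> - x \<in> S" "\<And>x. x \<in> S \<Longrightarrow> inverse x \<in> S"
  using assms by (auto simp: is_subfield_def)

lemma is_subfield_sum: "is_subfield S \<Longrightarrow> (\<And>i. i \<in> A \<Longrightarrow> f i \<in> S) \<Longrightarrow> sum f A \<in> S"
  by (induction A rule: infinite_finite_induct) (auto simp: is_subfieldD)

lemma is_subfield_power: "is_subfield S \<Longrightarrow> x \<in> S \<Longrightarrow> x ^ n \<in> S"
  by (induction n) (auto simp: is_subfieldD)

lemma polys_over_closed:
  assumes "is_subfield S"
  shows "0 \<in> polys_over S" "1 \<in> polys_over S"
    and "\<And>a b. a \<in> polys_over S \<Longrightarrow> b \<in> polys_over S \<Longrightarrow> a + b \<in> polys_over S"
    and "\<And>a b. a \<in> polys_over S \<Longrightarrow> b \<in> polys_over S \<Longrightarrow> a * b \<in> polys_over S"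
    and "\<And>a. a \<in> polys_over S \<Longrightarrow> - a \<in> polys_over S"
    and "\<And>c. c \<in> S \<Longrightarrow> [:c:] \<in> polys_over S"
    and "\<And>c i. c \<in> S \<Longrightarrow> monom c i \<in> polys_over S"
  using is_subfieldD[OF assms]
  by (auto simp: polys_over_def coeff_mult coeff_pCons intro!: is_subfield_sum[OF assms] split: nat.split)

lemma polys_over_sum: "is_subfield S \<Longrightarrow> (\<And>i. i \<in> A \<Longrightarrow> f i \<in> polys_over S) \<Longrightarrow> sum f A \<in> polys_over S"
  by (induction A rule: infinite_finite_induct) (auto simp: polys_over_closed)

lemma polys_over_power: "is_subfield S \<Longrightarrow> a \<in> polys_over S \<Longrightarrow> a ^ n \<in> polys_over S"
  by (induction n) (auto simp: polys_over_closed)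

lemma is_subfield_rational_subfield:
  assumes "is_subfield F"
  shows "is_subfield (rational_subfield F \<theta>)"
proof -
  note pc = polys_over_closed[OF assms]
  have I: "poly a \<theta> / poly b \<theta> \<in> rational_subfield F \<theta>"
    if "a \<in> polys_over F" "b \<in> polys_over F" "poly b \<theta> \<noteq> 0" for a b
    using that unfolding rational_subfield_def by blast
  have "0 \<in> rational_subfield F \<theta>" "1 \<in> rational_subfield F \<theta>"
    using I[of 0 1] I[of 1 1] pc(1,2) by simp_all
  moreover have "x + y \<in> rational_subfield F \<theta> \<and> x * y \<in> rational_subfield F \<theta>"
    if "x \<in> rational_subfield F \<theta>" "y \<in> rational_subfield F \<theta>" for x y
  proof -
    obtain a b a' b' where *: "x = poly a \<theta> / poly b \<theta>" "y = poly a' \<theta> / poly b' \<theta>"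
      "a \<in> polys_over F" "b \<in> polys_over F" "a' \<in> polys_over F" "b' \<in> polys_over F"
      "poly b \<theta> \<noteq> 0" "poly b' \<theta> \<noteq> 0"
      using \<open>x \<in> _\<close> \<open>y \<in> _\<close> unfolding rational_subfield_def by blast
    show ?thesis
      using I[of "a * b' + a' * b" "b * b'"] I[of "a * a'" "b * b'"] * pc(3,4)
      by (simp add: add_frac_eq)
  qed
  moreover have "- x \<in> rational_subfield F \<theta> \<and> inverse x \<in> rational_subfield F \<theta>"
    if "x \<in> rational_subfield F \<theta>" for x
  proof -
    obtain a b where *: "x = poly a \<theta> / poly b \<theta>" "a \<in> polys_over F" "b \<in> polys_over F" "poly b \<theta> \<noteq> 0"
      using \<open>x \<in> _\<close> unfolding rational_subfield_def by blast
    show ?thesis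
      using I[of "- a" b] I[of b a] * pc(5) \<open>0 \<in> rational_subfield F \<theta>\<close>
      by (cases "poly a \<theta> = 0") simp_all
  qed
  ultimately show ?thesis
    by (simp add: is_subfield_def)
qed

lemma is_subfield_algebraic_closure_in:
  fixes S :: "'c::field set"
  assumes S: "is_subfield S"
  shows "is_subfield (algebraic_closure_in S)"
proof -
  \<comment> \<open>HOL-Algebra proves that algebraic elements form a subfield, for rings with an
    explicit carrier. The type is repackaged as such a ring, and the notions of both sides are
    matched.\<close>
  define R :: "'c ring" where "R = \<lparr>carrier = UNIV, monoid.mult = (*), one = 1, ring.zero = 0, add = (+)\<rparr>"
  have "\<exists>y. x + y = 0" "x \<noteq> 0 \<Longrightarrow> \<exists>y. x * y = 1" for x :: 'c
    using add.right_inverse right_inverse by blast+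
  then interpret R: field R
    unfolding R_def by unfold_locales (auto simp: algebra_simps Units_def)
  have simps [simp]: "carrier R = UNIV" "x \<otimes>\<^bsub>R\<^esub> y = x * y" "x \<oplus>\<^bsub>R\<^esub> y = x + y" "\<zero>\<^bsub>R\<^esub> = 0" "\<one>\<^bsub>R\<^esub> = 1" for x y
    by (simp_all add: R_def)
  have a_inv [simp]: "\<ominus>\<^bsub>R\<^esub> x = - x" for x
    by (rule R.minus_equality) simp_all
  have m_inv: "inv\<^bsub>R\<^esub> x = inverse x" if "x \<noteq> 0" for x
    by (rule R.inv_char) (use that in simp_all)
  have pow [simp]: "x [^]\<^bsub>R\<^esub> n = x ^ n" for x and n :: nat
    by (induction n) (simp_all add: mult.commute)
  \<comment> \<open>Polynomials of HOL-Algebra are lists with the leading coefficient first, hence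
    the \<open>rev\<close>.\<close>
  have eval: "R.eval p x = poly (Poly (rev p)) x" for p x
    by (induction p) (simp_all add: Poly_append poly_monom)
  have subring: "subring T R \<longleftrightarrow> 1 \<in> T \<and> (\<forall>x\<in>T. - x \<in> T) \<and> (\<forall>x\<in>T. \<forall>y\<in>T. x * y \<in> T \<and> x + y \<in> T)" for T
  proof
    assume T: "subring T R"
    show "1 \<in> T \<and> (\<forall>x\<in>T. - x \<in> T) \<and> (\<forall>x\<in>T. \<forall>y\<in>T. x * y \<in> T \<and> x + y \<in> T)"
      using subringE(3,5-7)[OF T] by simp
  qed (intro R.subringI, simp_all)
  have "subring S R"
    using S by (auto simp: subring is_subfield_def)
  then have sub: "subfield S R"
    using R.subfieldI'[of S] S by (auto simp: m_inv is_subfield_def)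
  have alg: "(R.algebraic over S) x \<longleftrightarrow> x \<in> algebraic_closure_in S" for x
  proof
    assume "(R.algebraic over S) x"
    then obtain p where p: "p \<in> carrier (S[X]\<^bsub>R\<^esub>)" "p \<noteq> []" "R.eval p x = 0"
      using R.algebraicE[OF \<open>subring S R\<close>, of x] by auto
    then have *: "set p \<subseteq> S" "hd p \<noteq> 0"
      by (auto simp: univ_poly_def polynomial_def)
    have "coeff (Poly (rev p)) (length p - 1) = hd p"
      using p(2) by (simp add: nth_default_def rev_nth hd_conv_nth)
    then have "Poly (rev p) \<noteq> 0"
      using *(2) by (metis coeff_0)
    moreover have "Poly (rev p) \<in> polys_over S"
      using *(1) is_subfieldD(1)[OF S] nth_mem[of _ "rev p"]
      by (auto simp: polys_over_def nth_default_def simp del: nth_mem)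
    ultimately show "x \<in> algebraic_closure_in S"
      using p(3) by (auto simp: algebraic_closure_in_def eval)
  next
    assume "x \<in> algebraic_closure_in S"
    then obtain p where p: "p \<in> polys_over S" "p \<noteq> 0" "poly p x = 0"
      by (auto simp: algebraic_closure_in_def)
    have "rev (coeffs p) \<in> carrier (S[X]\<^bsub>R\<^esub>)"
      using p(1,2) by (auto simp: univ_poly_def polynomial_def polys_over_def hd_rev last_coeffs_eq_coeff_degree coeffs_def)
    then show "(R.algebraic over S) x"
      using p by (intro R.algebraicI[of "rev (coeffs p)"]) (simp_all add: eval)
  qed
  have T: "subfield (algebraic_closure_in S) R"
    using R.subfield_of_algebraics[OF sub] by (simp add: alg)
  then have "subring (algebraic_closure_in S) R"
    by (meson subfieldE(1))
  moreover have "inverse x \<in> algebraic_closure_in S" if "x \<in> algebraic_closure_in S" for x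
    using R.subfield_m_inv(1)[OF T, of x] that m_inv[of x] by (cases "x = 0") auto
  moreover have "0 \<in> algebraic_closure_in S"
    using \<open>subring (algebraic_closure_in S) R\<close> subringE(2) by fastforce
  ultimately show ?thesis
    by (auto simp: subring is_subfield_def)
qed

section \<open>The Frobenius of \<open>\<complex>\<^sub>\<infinity>\<close>\<close>

lemma additive_group_pow:
  "x [^]\<^bsub>\<lparr>carrier = S, monoid.mult = (+), one = 0\<rparr>\<^esub> n = of_nat n * (x::'c::field)"
  by (induction n) (simp_all add: nat_pow_def algebra_simps)

context C_infinity
begin

lemma q_ge_2: "q \<ge> 2"
proof -
  have "card {0::'c, 1} \<le> card F"
    using finite is_subfieldD[OF subfield] by (intro card_mono) auto
  then show ?thesis
    by (simp add: card)
qed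

lemma prime_CHAR: "Factorial_Ring.prime CHAR('c)"
proof -
  have "of_nat n \<in> F" for n
    using is_subfieldD[OF subfield] by (induction n) auto
  then have "range (of_nat :: nat \<Rightarrow> 'c) \<subseteq> F"
    by blast
  then have "\<not> inj (of_nat :: nat \<Rightarrow> 'c)"
    using finite finite_subset range_inj_infinite by blast
  then obtain i j where ij: "i < j" "of_nat i = (of_nat j :: 'c)"
    by (metis injI linorder_neqE_nat)
  then have "of_nat (j - i) = (0::'c)"
    by (simp add: of_nat_diff)
  then have "CHAR('c) > 0"
    using \<open>i < j\<close> unfolding CHAR_pos_iff by (intro exI[of _ "j - i"]) simp
  then show ?thesis
    by (rule prime_CHAR_semidom)
qed

text \<open>A prime divisor \<open>l\<close> of q gives, by Sylow, a subgroup of order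
  \<open>l\<close> in the additive group of \<open>F\<close>. A nonzero element of it is killed by
  \<open>l\<close>, so \<open>l\<close> is the characteristic; hence no other prime divides
  q.\<close>

lemma q_CHAR_power: "\<exists>e. q = CHAR('c) ^ e"
proof -
  have *: "l = CHAR('c)" if l: "Factorial_Ring.prime l" "l dvd q" for l
  proof -
    let ?G = "\<lparr>carrier = F, monoid.mult = (+), one = 0\<rparr> :: 'c monoid"
    have "\<exists>y\<in>F. y + x = 0" if "x \<in> F" for x
      using is_subfieldD(5)[OF subfield that] by (intro bexI[of _ "- x"]) auto
    then have G: "group ?G"
      using is_subfieldD[OF subfield] by (intro groupI) (auto simp: add.assoc)
    obtain k where "q = l ^ 1 * k"
      using l(2) by auto
    then obtain H where H: "subgroup H ?G" "card H = l ^ 1"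
      using sylow_thm[OF l(1) G, of 1 k] finite card by (auto simp: order_def)
    have "l \<ge> 2"
      using l(1) prime_ge_2_nat by blast
    then have "\<not> H \<subseteq> {0}"
      using card_mono[of "{0::'c}" H] H(2) by auto
    then obtain x where x: "x \<in> H" "x \<noteq> 0"
      by auto
    have "group (?G\<lparr>carrier := H\<rparr>)"
      using subgroup.subgroup_is_group[OF H(1) G] .
    then have "x [^]\<^bsub>?G\<lparr>carrier := H\<rparr>\<^esub> order (?G\<lparr>carrier := H\<rparr>) = \<one>\<^bsub>?G\<lparr>carrier := H\<rparr>\<^esub>"
      using x by (intro group.pow_order_eq_1) auto
    then have "of_nat l * x = 0"
      using H(2) by (simp add: order_def additive_group_pow)
    then have "CHAR('c) dvd l"
      using x by (simp add: of_nat_eq_0_iff_char_dvd)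
    then show ?thesis
      using prime_CHAR l(1) primes_dvd_imp_eq by blast
  qed
  have "q \<noteq> 0"
    using q_ge_2 by simp
  then obtain k where k: "q = CHAR('c) ^ multiplicity CHAR('c) q * k" "\<not> CHAR('c) dvd k"
    using multiplicity_decompose'[of q "CHAR('c)"] prime_CHAR by (metis not_prime_unit)
  have "k = 1"
  proof (rule ccontr)
    assume "k \<noteq> 1"
    then obtain l where "Factorial_Ring.prime l" "l dvd k"
      using prime_factor_nat by blast
    then show False
      using *[of l] k dvd_mult by metis
  qed
  then show ?thesis
    using k by auto
qed

lemma q_power_pos [simp]: "q ^ k > 0"
  using q_ge_2 by simp

lemma frob_add: "(x + y :: 'c) ^ (q ^ k) = x ^ (q ^ k) + y ^ (q ^ k)"
proof -
  obtain e where "q = CHAR('c) ^ e"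
    using q_CHAR_power by auto
  then show ?thesis
    using freshmans_dream'[OF prime_CHAR, of "q ^ k" "e * k" x y] by (simp add: power_mult)
qed

lemma frob_0 [simp]: "(0 :: 'c) ^ (q ^ k) = 0"
  using q_power_pos[of k] by (simp add: power_0_left)

lemma frob_diff: "(x - y :: 'c) ^ (q ^ k) = x ^ (q ^ k) - y ^ (q ^ k)"
  using frob_add[of "x - y" y k] by (simp add: algebra_simps)

lemma frob_minus: "(- y :: 'c) ^ (q ^ k) = - (y ^ (q ^ k))"
  using frob_diff[of 0 y k] by simp

lemma frob_sum: "(\<Sum>i\<in>A. f i :: 'c) ^ (q ^ k) = (\<Sum>i\<in>A. f i ^ (q ^ k))"
  by (induction A rule: infinite_finite_induct) (simp_all add: frob_add)

lemma frob_eq_iff [simp]: "(x::'c) ^ (q ^ k) = y ^ (q ^ k) \<longleftrightarrow> x = y"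
  using frob_diff[of x y k] by (metis eq_iff_diff_eq_0 frob_0 power_not_zero)

lemma frob1: "(x + y :: 'c) ^ q = x ^ q + y ^ q" "(x - y :: 'c) ^ q = x ^ q - y ^ q" "(- x :: 'c) ^ q = - (x ^ q)"
  "(x::'c) ^ q = y ^ q \<longleftrightarrow> x = y"
  using frob_add[of x y 1] frob_diff[of x y 1] frob_minus[of x 1] frob_eq_iff[of x 1 y] by simp_all

text \<open>The q^k-th power map is additive and multiplies distances in the sense |x^Q - y^Q| = |x
  - y|^Q, so it commutes with infinite sums.\<close>

lemma sums_frob:
  fixes s :: 'c
  assumes "f sums s"
  shows "(\<lambda>n. f n ^ (q ^ k)) sums (s ^ (q ^ k))"
proof -
  have "(\<lambda>n. vabs ((\<Sum>i<n. f i) - s) ^ (q ^ k)) \<longlonglongrightarrow> 0 ^ (q ^ k)"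
    using assms by (intro tendsto_power) (simp add: sums_def flip: tendsto_vabs_iff)
  then have "(\<lambda>n. vabs ((\<Sum>i<n. f i ^ (q ^ k)) - s ^ (q ^ k))) \<longlonglongrightarrow> 0"
    using q_ge_2 by (simp flip: vabs_power frob_sum frob_diff add: power_0_left)
  then show ?thesis
    by (simp add: sums_def tendsto_vabs_iff[symmetric])
qed

section \<open>Surjectivity of the q-power map\<close>

lemma K_infinity_uminus: "x \<in> K_infinity F \<theta> \<Longrightarrow> - x \<in> K_infinity F \<theta>"
proof -
  assume "x \<in> K_infinity F \<theta>"
  then obtain f where f: "\<And>n. f n \<in> rational_subfield F \<theta>" "f \<longlonglongrightarrow> x"
    unfolding K_infinity_def closure_sequential by blast
  then have "(\<lambda>n. - f n) \<longlonglongrightarrow> - x"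
    by (intro tendsto_minus)
  then show ?thesis
    using f(1) is_subfieldD(5)[OF is_subfield_rational_subfield[OF subfield]]
    unfolding K_infinity_def closure_sequential by (intro exI[of _ "\<lambda>n. - f n"]) blast
qed

text \<open>Substituting -X changes coefficients only by a sign. Closure under negation is what
  makes X^q - c an admissible polynomial for \<open>alg_closed\<close>.\<close>

lemma algebraic_K_infinity_uminus:
  assumes "x \<in> algebraic_closure_in (K_infinity F \<theta>)"
  shows "- x \<in> algebraic_closure_in (K_infinity F \<theta>)"
proof -
  obtain p where p: "p \<in> polys_over (K_infinity F \<theta>)" "p \<noteq> 0" "poly p x = 0"
    using assms by (auto simp: algebraic_closure_in_def)
  have "coeff (pcompose p [:0, -1:]) i = (-1) ^ i * coeff p i" for i
    by (simp add: coeff_pcompose_linear)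
  then have "coeff (pcompose p [:0, -1:]) i \<in> K_infinity F \<theta>" for i
    using p(1) K_infinity_uminus by (cases "even i") (auto simp: polys_over_def)
  moreover have "pcompose p [:0, -1:] \<noteq> 0"
    using p(2) by (simp add: pcompose_eq_0_iff)
  moreover have "poly (pcompose p [:0, -1:]) (- x) = 0"
    using p(3) by (simp add: poly_pcompose)
  ultimately show ?thesis
    by (auto simp: algebraic_closure_in_def polys_over_def)
qed

lemma rational_subset_algebraic_K_infinity:
  "rational_subfield F \<theta> \<subseteq> algebraic_closure_in (K_infinity F \<theta>)"
proof
  fix x
  assume x: "x \<in> rational_subfield F \<theta>"
  note sf = is_subfieldD[OF is_subfield_rational_subfield[OF subfield, of \<theta>]]
  have "[:- x, 1:] \<in> polys_over (K_infinity F \<theta>)"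
    using x sf(1,2,5) closure_subset[of "rational_subfield F \<theta>"]
    by (auto simp: polys_over_def K_infinity_def coeff_pCons split: nat.split)
  then show "x \<in> algebraic_closure_in (K_infinity F \<theta>)"
    unfolding algebraic_closure_in_def by (intro CollectI bexI[of _ "[:- x, 1:]"]) auto
qed

lemma algebraic_K_infinity_root:
  assumes "c \<in> algebraic_closure_in (K_infinity F \<theta>)"
  shows "\<exists>x. x ^ q = c"
proof -
  let ?p = "monom 1 q + [:- c:]"
  have "coeff ?p i \<in> algebraic_closure_in (K_infinity F \<theta>)" for i
    using algebraic_K_infinity_uminus[OF assms] rational_subset_algebraic_K_infinity q_ge_2
      is_subfieldD(1,2)[OF is_subfield_rational_subfield[OF subfield, of \<theta>]]
    by (auto simp: coeff_pCons split: nat.split)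
  moreover have "degree ?p = q"
    using q_ge_2 degree_add_eq_left[of "[:- c:]" "monom 1 q"] by (simp add: degree_monom_eq)
  ultimately obtain x where "poly ?p x = 0"
    using alg_closed[of ?p] q_ge_2 by (auto simp: polys_over_def)
  then show ?thesis
    by (auto simp: poly_monom)
qed

text \<open>q-th roots exist on a dense subset. As |x^q - y^q| = |x - y|^q, the roots of a Cauchy
  sequence form a Cauchy sequence again, and completeness provides the root of the limit.\<close>

lemma frob_surj: "\<exists>x::'c. x ^ q = c"
proof -
  have "c \<in> closure (algebraic_closure_in (K_infinity F \<theta>))"
    by (simp add: dense)
  then obtain f where f: "\<And>n. f n \<in> algebraic_closure_in (K_infinity F \<theta>)" "f \<longlonglongrightarrow> c"
    unfolding closure_sequential by blast
  then have "\<forall>n. \<exists>x. x ^ q = f n"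
    using algebraic_K_infinity_root by blast
  then obtain g where g: "\<And>n. g n ^ q = f n"
    using choice[of "\<lambda>n x. x ^ q = f n"] by blast
  have dist: "dist (x ^ q) (y ^ q) = dist x y ^ q" for x y :: 'c
    by (simp add: dist_vabs frob1(2)[symmetric] vabs_power)
  have "Cauchy g"
  proof (rule metric_CauchyI)
    fix e :: real
    assume e: "e > 0"
    have "Cauchy f"
      using f(2) LIMSEQ_imp_Cauchy by blast
    then obtain M where M: "\<And>i j. i \<ge> M \<Longrightarrow> j \<ge> M \<Longrightarrow> dist (f i) (f j) < e ^ q"
      using e metric_CauchyD[of f "e ^ q"] by auto
    have "dist (g i) (g j) < e" if "i \<ge> M" "j \<ge> M" for i j
    proof -
      have "dist (g i) (g j) ^ q < e ^ q"
        using M[OF that] by (simp flip: g add: dist)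
      then show ?thesis
        using e by (simp add: power_less_imp_less_base)
    qed
    then show "\<exists>M. \<forall>m\<ge>M. \<forall>n\<ge>M. dist (g m) (g n) < e"
      by blast
  qed
  then obtain x where "g \<longlonglongrightarrow> x"
    by (auto simp: Cauchy_convergent_iff convergent_def)
  then have "(\<lambda>n. dist (g n) x ^ q) \<longlonglongrightarrow> 0 ^ q"
    by (intro tendsto_power) (simp flip: tendsto_dist_iff)
  then have "f \<longlonglongrightarrow> x ^ q"
    using q_ge_2 by (subst tendsto_dist_iff) (simp flip: g add: dist power_0_left)
  then show ?thesis
    using f(2) LIMSEQ_unique by blast
qed

lemma twist_nat [simp]: "twist q (int k) c = c ^ (q ^ k)"
  by (simp add: twist_def)

lemma twist_m1_eqI: "b ^ q = c \<Longrightarrow> twist q (- 1) c = (b::'c)"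
  unfolding twist_def by (auto intro!: the_equality simp: frob1)

lemma twist_m1_power [simp]: "twist q (- 1) c ^ q = (c::'c)"
  using frob_surj[of c] twist_m1_eqI by metis

lemma twist_m1_hom [simp]:
  "twist q (- 1) (0::'c) = 0" "twist q (- 1) (1::'c) = 1"
  and twist_m1_add: "twist q (- 1) (x + y :: 'c) = twist q (- 1) x + twist q (- 1) y"
  and twist_m1_mult: "twist q (- 1) (x * y :: 'c) = twist q (- 1) x * twist q (- 1) y"
  and twist_m1_minus: "twist q (- 1) (- x :: 'c) = - twist q (- 1) x"
  using q_ge_2 by (auto intro!: twist_m1_eqI simp: frob1 power_mult_distrib)

lemma twist_m1_sum: "twist q (- 1) (\<Sum>i\<in>A. f i :: 'c) = (\<Sum>i\<in>A. twist q (- 1) (f i))"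
  by (induction A rule: infinite_finite_induct) (simp_all add: twist_m1_add)

lemma twist_m1_eq_0_iff [simp]: "twist q (- 1) x = (0::'c) \<longleftrightarrow> x = 0"
  using twist_m1_power[of x] q_ge_2 by (metis twist_m1_hom(1) power_0_left not_numeral_le_zero)

lemma vabs_twist_m1: "vabs (twist q (- 1) (c::'c)) ^ q = vabs c"
  by (simp flip: vabs_power)

lemma is_subfield_K_bar: "is_subfield (K_bar F \<theta>)"
  unfolding K_bar_def by (intro is_subfield_algebraic_closure_in is_subfield_rational_subfield subfield)

text \<open>If p annihilates x, then p(X^q) annihilates the q-th root of x.\<close>

lemma twist_m1_K_bar: "x \<in> K_bar F \<theta> \<Longrightarrow> twist q (- 1) x \<in> K_bar F \<theta>"
proof -
  assume "x \<in> K_bar F \<theta>"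
  then obtain p where p: "p \<in> polys_over (rational_subfield F \<theta>)" "p \<noteq> 0" "poly p x = 0"
    by (auto simp: K_bar_def algebraic_closure_in_def)
  have "pcompose p (monom 1 q) \<in> polys_over (rational_subfield F \<theta>)"
    unfolding pcompose_altdef poly_altdef
    using p(1) is_subfield_rational_subfield[OF subfield, of \<theta>]
    by (intro polys_over_sum polys_over_closed(4) polys_over_power polys_over_closed(6,7))
      (auto simp: polys_over_def coeff_map_poly is_subfieldD coeff_pCons split: nat.split)
  moreover have "pcompose p (monom 1 q) \<noteq> 0"
    using p(2) q_ge_2 by (subst pcompose_eq_0_iff) (auto simp: degree_monom_eq)
  moreover have "poly (pcompose p (monom 1 q)) (twist q (- 1) x) = 0"
    using p(3) by (simp add: poly_pcompose poly_monom)
  ultimately show ?thesis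
    by (auto simp: K_bar_def algebraic_closure_in_def)
qed

lemma theta_K_bar: "\<theta> \<in> K_bar F \<theta>"
proof -
  have "poly [:0, 1:] \<theta> / poly 1 \<theta> \<in> rational_subfield F \<theta>"
    unfolding rational_subfield_def
    using is_subfieldD[OF subfield] polys_over_closed[OF subfield]
    by (intro CollectI exI[of _ "[:0,1:]"] exI[of _ "1"]) (auto simp: polys_over_def coeff_pCons split: nat.split)
  then have "\<theta> \<in> rational_subfield F \<theta>"
    by simp
  then have "[:- \<theta>, 1:] \<in> polys_over (rational_subfield F \<theta>)"
    using is_subfieldD[OF is_subfield_rational_subfield[OF subfield, of \<theta>]]
    by (auto simp: polys_over_def coeff_pCons split: nat.split)
  then show ?thesis
    unfolding K_bar_def algebraic_closure_in_def
    by (intro CollectI bexI[of _ "[:- \<theta>, 1:]"]) auto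
qed

text \<open>The powers of \<theta> have pairwise different absolute values. Infinitely many scalars
  are needed in \<open>A_eq_cf\<close> to compare coefficients of polynomial functions.\<close>

lemma infinite_K_bar: "infinite (K_bar F \<theta>)"
proof
  assume "finite (K_bar F \<theta>)"
  moreover have "range (\<lambda>n. \<theta> ^ n) \<subseteq> K_bar F \<theta>"
    using is_subfield_power[OF is_subfield_K_bar theta_K_bar] by blast
  moreover have "inj (\<lambda>n. \<theta> ^ n)"
  proof (rule injI)
    fix i j
    assume "\<theta> ^ i = \<theta> ^ j"
    then have "real q ^ i = real q ^ j"
      by (metis vabs_power vabs_theta)
    then show "i = j"
      using q_ge_2 by (simp add: power_inject_exp)
  qed
  ultimately show False
    using finite_subset range_inj_infinite by blast
qed

end

no_notation fps_nth (infixl \<open>$\<close> 75)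

section \<open>The exponential series\<close>

declare index_mult_mat_vec [simp del] index_mult_mat(1) [simp del]

lemma index_mat_vec:
  assumes "M \<in> carrier_mat d d" "v \<in> carrier_vec d" "i < d"
  shows "(M *\<^sub>v v) $ i = (\<Sum>j<d. M $$ (i, j) * v $ j)"
  using assms by (auto simp: index_mult_mat_vec scalar_prod_def lessThan_atLeast0 intro!: sum.cong)

lemma zero_mat_vec: "v \<in> carrier_vec d \<Longrightarrow> 0\<^sub>m d d *\<^sub>v v = 0\<^sub>v d"
  by (intro eq_vecI) (auto simp: index_mat_vec[of _ d])

text \<open>The exponential is studied through E'_\<theta>, whose coefficient of \<tau>^k is
  \<open>A k\<close>: \<open>K\<close> bounds its degree, \<open>Q_rec\<close> is the functional
  equation for a = \<theta>, and \<open>s\<close> kills the nilpotent part of d[\<theta>].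
  Positivity of \<open>s\<close> puts the zeroth iterate into the norm below, which therefore
  dominates all entries.\<close>

locale t_module_exponential = C_infinity q F \<theta>
  for q :: nat and F :: "'c::{nonarch_valued_field, complete_space} set" and \<theta> :: 'c +
  fixes d K s :: nat and A Q :: "nat \<Rightarrow> 'c mat"
  assumes A_carrier [simp]: "\<And>k. A k \<in> carrier_mat d d"
    and A_zero: "\<And>k. k > K \<Longrightarrow> A k = 0\<^sub>m d d"
    and Q_carrier [simp]: "\<And>n. Q n \<in> carrier_mat d d"
    and Q_0: "Q 0 = 1\<^sub>m d"
    and Q_rec: "\<And>n i j. i < d \<Longrightarrow> j < d \<Longrightarrow>
          (Q n * map_mat (twist q (int n)) (A 0)) $$ (i, j) =
          (\<Sum>k\<le>n. (A k * map_mat (twist q (int k)) (Q (n - k))) $$ (i, j))"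
    and nilpotent: "\<And>v. v \<in> carrier_vec d \<Longrightarrow> ((\<lambda>v. A 0 *\<^sub>v v - \<theta> \<cdot>\<^sub>v v) ^^ s) v = 0\<^sub>v d"
    and s_pos: "s > 0"
begin

section \<open>A norm adapted to the nilpotent part of d[\<theta>]\<close>

definition frob :: "nat \<Rightarrow> 'c vec \<Rightarrow> 'c vec" where
  "frob k v = map_vec (\<lambda>c. c ^ (q ^ k)) v"

definition nil :: "'c vec \<Rightarrow> 'c vec" where
  "nil v = A 0 *\<^sub>v v - \<theta> \<cdot>\<^sub>v v"

text \<open>In this norm the derivative \<open>d[\<theta>] = \<theta> + nil\<close> has operator norm at most \<open>|\<theta>| = q\<close>.\<close>
definition nrm :: "'c vec \<Rightarrow> real" where
  "nrm v = Max (insert 0 ((\<lambda>(k, i). vabs ((nil ^^ k) v $ i)) ` ({..<s} \<times> {..<d})))"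

definition exp_term :: "nat \<Rightarrow> 'c vec \<Rightarrow> 'c vec" where
  "exp_term n z = Q n *\<^sub>v frob n z"

lemma frob_carrier [simp]: "v \<in> carrier_vec d \<Longrightarrow> frob k v \<in> carrier_vec d"
  by (simp add: frob_def)

lemma frob_index [simp]: "v \<in> carrier_vec d \<Longrightarrow> i < d \<Longrightarrow> frob k v $ i = (v $ i) ^ (q ^ k)"
  by (simp add: frob_def)

lemma map_vec_twist [simp]: "map_vec (twist q (int k)) v = frob k v"
  by (intro eq_vecI) (auto simp: frob_def)

lemma frob_zero [simp]: "frob 0 v = v"
  by (intro eq_vecI) (auto simp: frob_def)

lemma dims [simp]:
  "dim_row (A k) = d" "dim_col (A k) = d" "dim_row (Q k) = d" "dim_col (Q k) = d"
  using A_carrier[of k] Q_carrier[of k] by (simp_all del: A_carrier Q_carrier)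

lemma A_vec_carrier [simp]: "v \<in> carrier_vec d \<Longrightarrow> A k *\<^sub>v v \<in> carrier_vec d"
  by (rule mult_mat_vec_carrier[OF A_carrier])

lemma nil_carrier [simp]: "v \<in> carrier_vec d \<Longrightarrow> nil v \<in> carrier_vec d"
  by (simp add: nil_def)

lemma nil_pow_carrier [simp]: "v \<in> carrier_vec d \<Longrightarrow> (nil ^^ k) v \<in> carrier_vec d"
  by (induction k) auto

lemma exp_term_carrier [simp]: "z \<in> carrier_vec d \<Longrightarrow> exp_term n z \<in> carrier_vec d"
  by (simp add: exp_term_def mult_mat_vec_carrier[OF Q_carrier])

lemma nil_pow_s: "v \<in> carrier_vec d \<Longrightarrow> (nil ^^ s) v = 0\<^sub>v d"
  using nilpotent unfolding nil_def by blast

lemma A0_eq: "v \<in> carrier_vec d \<Longrightarrow> A 0 *\<^sub>v v = \<theta> \<cdot>\<^sub>v v + nil v"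
  by (intro eq_vecI) (auto simp: nil_def)

lemma nil_add: "u \<in> carrier_vec d \<Longrightarrow> v \<in> carrier_vec d \<Longrightarrow> nil (u + v) = nil u + nil v"
  by (intro eq_vecI) (auto simp: nil_def mult_add_distrib_mat_vec[OF A_carrier] algebra_simps)

lemma nil_smult: "v \<in> carrier_vec d \<Longrightarrow> nil (c \<cdot>\<^sub>v v) = c \<cdot>\<^sub>v nil v"
  by (intro eq_vecI) (auto simp: nil_def mult_mat_vec[OF A_carrier] algebra_simps)

lemma nil_pow_add:
  "u \<in> carrier_vec d \<Longrightarrow> v \<in> carrier_vec d \<Longrightarrow> (nil ^^ k) (u + v) = (nil ^^ k) u + (nil ^^ k) v"
  by (induction k) (auto simp: nil_add)

lemma nil_pow_smult: "v \<in> carrier_vec d \<Longrightarrow> (nil ^^ k) (c \<cdot>\<^sub>v v) = c \<cdot>\<^sub>v (nil ^^ k) v"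
  by (induction k) (auto simp: nil_smult)

lemma nrm_le_iff: "nrm v \<le> B \<longleftrightarrow> 0 \<le> B \<and> (\<forall>k<s. \<forall>i<d. vabs ((nil ^^ k) v $ i) \<le> B)"
  unfolding nrm_def by (subst Max_le_iff) auto

lemma nrm_ge: "k < s \<Longrightarrow> i < d \<Longrightarrow> vabs ((nil ^^ k) v $ i) \<le> nrm v"
  using nrm_le_iff[of v "nrm v"] by auto

lemma nrm_nonneg [simp]: "0 \<le> nrm v"
  using nrm_le_iff[of v "nrm v"] by auto

lemma vabs_le_nrm: "i < d \<Longrightarrow> vabs (v $ i) \<le> nrm v"
  using nrm_ge[of 0 i v] s_pos by simp

lemma nrm_eq_0D: "v \<in> carrier_vec d \<Longrightarrow> nrm v = 0 \<Longrightarrow> v = 0\<^sub>v d"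
  using vabs_le_nrm[of _ v] by (intro eq_vecI) (auto simp flip: vabs_eq_0_iff simp: order.antisym simp del: vabs_eq_0_iff)

lemma nrm_add_leI:
  "u \<in> carrier_vec d \<Longrightarrow> v \<in> carrier_vec d \<Longrightarrow> nrm u \<le> B \<Longrightarrow> nrm v \<le> B \<Longrightarrow> nrm (u + v) \<le> B"
  by (auto simp: nrm_le_iff nil_pow_add carrier_vecD[OF nil_pow_carrier] intro!: vabs_add_leI)

lemma nrm_smult: "v \<in> carrier_vec d \<Longrightarrow> nrm (c \<cdot>\<^sub>v v) = vabs c * nrm v"
proof -
  assume v: "v \<in> carrier_vec d"
  have le: "nrm (c \<cdot>\<^sub>v v) \<le> vabs c * nrm v" if "v \<in> carrier_vec d" for c v
    using that nrm_ge[of _ _ v]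
    by (auto simp: nrm_le_iff[of "c \<cdot>\<^sub>v v"] nil_pow_smult carrier_vecD[OF nil_pow_carrier] vabs_mult
        intro!: mult_left_mono)
  show ?thesis
  proof (cases "c = 0")
    case False
    have "nrm v = nrm (inverse c \<cdot>\<^sub>v (c \<cdot>\<^sub>v v))"
      using False v by (simp add: smult_smult_assoc)
    also have "\<dots> \<le> inverse (vabs c) * nrm (c \<cdot>\<^sub>v v)"
      using le[of "c \<cdot>\<^sub>v v" "inverse c"] v by (simp add: vabs_inverse)
    finally have "vabs c * nrm v \<le> vabs c * (inverse (vabs c) * nrm (c \<cdot>\<^sub>v v))"
      by (intro mult_left_mono) auto
    then have "vabs c * nrm v \<le> nrm (c \<cdot>\<^sub>v v)"
      using False by (simp add: mult.assoc[symmetric])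
    then show ?thesis
      using le[OF v] by (simp add: order.antisym)
  next
    case True
    then show ?thesis
      using le[OF v, of 0] nrm_nonneg by (simp add: order.antisym)
  qed
qed

lemma nrm_diff_leI:
  assumes "u \<in> carrier_vec d" "v \<in> carrier_vec d" "nrm u \<le> B" "nrm v \<le> B"
  shows "nrm (u - v) \<le> B"
proof -
  have "u - v = u + (-1) \<cdot>\<^sub>v v"
    using assms by auto
  then show ?thesis
    using nrm_add_leI[of u "(-1) \<cdot>\<^sub>v v" B] assms nrm_smult[of v "-1"] by simp
qed

lemma nrm_zero [simp]: "nrm (0\<^sub>v d) = 0"
proof -
  have "0 \<cdot>\<^sub>v (0\<^sub>v d) = (0\<^sub>v d :: 'c vec)"
    by auto
  then show ?thesis
    using nrm_smult[of "0\<^sub>v d" 0] by simp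
qed

text \<open>Applying \<open>nil\<close> shifts the list of iterates over which \<open>nrm\<close>
  takes the maximum, and the iterate that newly enters at the end is \<open>nil ^^ s\<close>, which
  is zero.\<close>

lemma nrm_nil_le: "v \<in> carrier_vec d \<Longrightarrow> nrm (nil v) \<le> nrm v"
proof -
  assume v: "v \<in> carrier_vec d"
  have "vabs ((nil ^^ k) (nil v) $ i) \<le> nrm v" if "k < s" "i < d" for k i
  proof (cases "Suc k = s")
    case True
    then have "(nil ^^ k) (nil v) = 0\<^sub>v d"
      using nil_pow_s[OF v] by (metis comp_apply funpow_Suc_right)
    then show ?thesis
      using that by simp
  next
    case False
    then show ?thesis
      using that nrm_ge[of "Suc k" i v] by (simp add: funpow_swap1)
  qed
  then show ?thesis
    by (simp add: nrm_le_iff)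
qed

lemma nrm_A0_le: "v \<in> carrier_vec d \<Longrightarrow> nrm (A 0 *\<^sub>v v) \<le> q * nrm v"
proof -
  assume v: "v \<in> carrier_vec d"
  have "nrm v \<le> q * nrm v"
    using q_ge_2 mult_right_mono[of 1 "real q" "nrm v"] by simp
  then show ?thesis
    unfolding A0_eq[OF v] using v nrm_nil_le[OF v]
    by (intro nrm_add_leI) (auto simp: nrm_smult vabs_theta)
qed

section \<open>Bounds for matrices composed with the Frobenius\<close>

lemma mat_vec_bound:
  assumes "M \<in> carrier_mat d d"
  shows "\<exists>C\<ge>1. \<forall>v\<in>carrier_vec d. \<forall>B. (\<forall>i<d. vabs (v $ i) \<le> B) \<longrightarrow> (\<forall>i<d. vabs ((M *\<^sub>v v) $ i) \<le> C * B)"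
proof -
  define C where "C = Max (insert 1 ((\<lambda>(i, j). vabs (M $$ (i, j))) ` ({..<d} \<times> {..<d})))"
  have C: "C \<ge> 1" "\<And>i j. i < d \<Longrightarrow> j < d \<Longrightarrow> vabs (M $$ (i, j)) \<le> C"
    unfolding C_def by (auto intro!: Max_ge)
  have "vabs ((M *\<^sub>v v) $ i) \<le> C * B" if "v \<in> carrier_vec d" "\<forall>i<d. vabs (v $ i) \<le> B" "i < d" for v B i
  proof -
    have "0 \<le> B"
      using that order_trans[OF vabs_nonneg] by blast
    then show ?thesis
      using that C assms
      by (subst index_mat_vec[of M d]) (auto intro!: vabs_sum_le mult_mono simp: vabs_mult)
  qed
  then show ?thesis
    using C(1) by blast
qed

text \<open>Together with \<open>vabs_le_nrm\<close> this makes \<open>nrm\<close> equivalent to the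
  sup norm, so entrywise estimates pass to \<open>nrm\<close> at the cost of a constant.\<close>

lemma nrm_le_sup:
  "\<exists>C\<ge>1. \<forall>v\<in>carrier_vec d. \<forall>B\<ge>0. (\<forall>i<d. vabs (v $ i) \<le> B) \<longrightarrow> nrm v \<le> C * B"
proof -
  define N where "N = A 0 - \<theta> \<cdot>\<^sub>m 1\<^sub>m d"
  have N: "N \<in> carrier_mat d d"
    unfolding N_def by (intro minus_carrier_mat) simp
  have nil_N: "nil v = N *\<^sub>v v" if "v \<in> carrier_vec d" for v
    using that by (intro eq_vecI) (auto simp: nil_def N_def minus_mult_distrib_mat_vec[OF A_carrier] index_mult_mat_vec)
  obtain C where C: "C \<ge> 1"
    "\<And>v B i. v \<in> carrier_vec d \<Longrightarrow> \<forall>i<d. vabs (v $ i) \<le> B \<Longrightarrow> i < d \<Longrightarrow> vabs ((N *\<^sub>v v) $ i) \<le> C * B"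
    using mat_vec_bound[OF N] by blast
  have *: "\<forall>i<d. vabs ((nil ^^ k) v $ i) \<le> C ^ k * B"
    if "v \<in> carrier_vec d" "\<forall>i<d. vabs (v $ i) \<le> B" for v B k
    using that
  proof (induction k)
    case (Suc k)
    then show ?case
      using C(2)[of "(nil ^^ k) v" "C ^ k * B"] by (simp add: nil_N mult.assoc)
  qed simp
  have "nrm v \<le> C ^ s * B" if "v \<in> carrier_vec d" "B \<ge> 0" "\<forall>i<d. vabs (v $ i) \<le> B" for v B
  proof -
    have "vabs ((nil ^^ k) v $ i) \<le> C ^ s * B" if "k < s" "i < d" for k i
    proof -
      have "C ^ k * B \<le> C ^ s * B"
        using C(1) \<open>B \<ge> 0\<close> \<open>k < s\<close> by (intro mult_right_mono power_increasing) auto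
      then show ?thesis
        using *[of v B k] \<open>v \<in> carrier_vec d\<close> \<open>\<forall>i<d. vabs (v $ i) \<le> B\<close> \<open>i < d\<close> by force
    qed
    then show ?thesis
      using C(1) that(2) by (simp add: nrm_le_iff)
  qed
  moreover have "C ^ s \<ge> 1"
    using C(1) by (rule one_le_power)
  ultimately show ?thesis
    by blast
qed

lemma mat_frob_bound:
  assumes M: "M \<in> carrier_mat d d"
  shows "\<exists>C\<ge>1. \<forall>k. \<forall>v\<in>carrier_vec d. nrm (M *\<^sub>v frob k v) \<le> C * nrm v ^ (q ^ k)"
proof -
  obtain C where C: "C \<ge> 1"
    "\<And>v B i. v \<in> carrier_vec d \<Longrightarrow> \<forall>i<d. vabs (v $ i) \<le> B \<Longrightarrow> i < d \<Longrightarrow> vabs ((M *\<^sub>v v) $ i) \<le> C * B"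
    using mat_vec_bound[OF M] by blast
  obtain C' where C': "C' \<ge> 1"
    "\<And>v B. v \<in> carrier_vec d \<Longrightarrow> B \<ge> 0 \<Longrightarrow> \<forall>i<d. vabs (v $ i) \<le> B \<Longrightarrow> nrm v \<le> C' * B"
    using nrm_le_sup by blast
  have "nrm (M *\<^sub>v frob k v) \<le> (C' * C) * nrm v ^ (q ^ k)" if v: "v \<in> carrier_vec d" for k v
  proof -
    have "\<forall>i<d. vabs (frob k v $ i) \<le> nrm v ^ (q ^ k)"
      using v by (auto simp: vabs_power intro!: power_mono vabs_le_nrm)
    then have "\<forall>i<d. vabs ((M *\<^sub>v frob k v) $ i) \<le> C * nrm v ^ (q ^ k)"
      using C(2)[of "frob k v"] v by auto
    then show ?thesis
      using C'(2)[of "M *\<^sub>v frob k v" "C * nrm v ^ (q ^ k)"] M v C(1) by (simp add: mult.assoc)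
  qed
  moreover have "C' * C \<ge> 1"
    using C(1) C'(1) mult_mono[of 1 C' 1 C] by simp
  ultimately show ?thesis
    by blast
qed

lemma A_bound: "\<exists>C\<ge>1. \<forall>j k. \<forall>v\<in>carrier_vec d. nrm (A j *\<^sub>v frob k v) \<le> C * nrm v ^ (q ^ k)"
proof -
  have "\<forall>j. \<exists>C. C \<ge> 1 \<and> (\<forall>k. \<forall>v\<in>carrier_vec d. nrm (A j *\<^sub>v frob k v) \<le> C * nrm v ^ (q ^ k))"
    using mat_frob_bound[OF A_carrier] by blast
  then obtain C where C: "\<And>j. C j \<ge> 1" "\<And>j k v. v \<in> carrier_vec d \<Longrightarrow> nrm (A j *\<^sub>v frob k v) \<le> C j * nrm v ^ (q ^ k)"
    using choice[of "\<lambda>j C. C \<ge> 1 \<and> (\<forall>k. \<forall>v\<in>carrier_vec d. nrm (A j *\<^sub>v frob k v) \<le> C * nrm v ^ (q ^ k))"] by blast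
  define D where "D = Max (C ` {..K})"
  have D: "C j \<le> D" if "j \<le> K" for j
    unfolding D_def using that by (intro Max_ge) auto
  have "nrm (A j *\<^sub>v frob k v) \<le> D * nrm v ^ (q ^ k)" if "v \<in> carrier_vec d" for j k v
  proof (cases "j \<le> K")
    case True
    have "C j * nrm v ^ (q ^ k) \<le> D * nrm v ^ (q ^ k)"
      using D[OF True] by (intro mult_right_mono) auto
    then show ?thesis
      using C(2)[OF that, of j k] by linarith
  next
    case False
    then have "A j *\<^sub>v frob k v = 0\<^sub>v d"
      using that by (simp add: A_zero zero_mat_vec)
    then show ?thesis
      using D[of 0] C(1)[of 0] by simp
  qed
  moreover have "D \<ge> 1"
    using D[of 0] C(1)[of 0] by simp
  ultimately show ?thesis
    by blast
qed

lemma nrm_vec_sum_le: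
  assumes "finite S" "0 \<le> B" "\<And>k. k \<in> S \<Longrightarrow> u k \<in> carrier_vec d \<and> nrm (u k) \<le> B"
  shows "nrm (vec d (\<lambda>i. \<Sum>k\<in>S. u k $ i)) \<le> B"
  using assms
proof (induction S rule: finite_induct)
  case empty
  have "vec d (\<lambda>i. 0) = (0\<^sub>v d :: 'c vec)"
    by auto
  then show ?case
    using empty by simp
next
  case (insert k S)
  have "vec d (\<lambda>i. \<Sum>k\<in>insert k S. u k $ i) = u k + vec d (\<lambda>i. \<Sum>k\<in>S. u k $ i)"
    using insert by auto
  then show ?case
    using insert by (auto intro!: nrm_add_leI)
qed

section \<open>Terms of the exponential series\<close>

lemma frob_mat_vec:
  assumes "M \<in> carrier_mat d d" "v \<in> carrier_vec d"
  shows "frob k (M *\<^sub>v v) = map_mat (twist q (int k)) M *\<^sub>v frob k v"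
  using assms
  by (intro eq_vecI) (auto simp: index_mat_vec[of _ d] frob_sum power_mult_distrib)

lemma frob_frob: "v \<in> carrier_vec d \<Longrightarrow> frob j (frob k v) = frob (j + k) v"
  by (intro eq_vecI) (auto simp: frob_def power_add power_mult mult.commute simp flip: power_mult)

text \<open>The homogeneous part of degree q^n of the functional equation, evaluated at z.\<close>

lemma exp_term_A0:
  assumes z: "z \<in> carrier_vec d" and i: "i < d"
  shows "exp_term n (A 0 *\<^sub>v z) $ i = (\<Sum>k\<le>n. (A k *\<^sub>v frob k (exp_term (n - k) z)) $ i)"
proof -
  have tw: "map_mat (twist q (int k)) M \<in> carrier_mat d d" if "M \<in> carrier_mat d d" for k M
    using that by simp
  have "exp_term n (A 0 *\<^sub>v z) = (Q n * map_mat (twist q (int n)) (A 0)) *\<^sub>v frob n z"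
    using z by (simp add: exp_term_def frob_mat_vec[of _ "z"] assoc_mult_mat_vec[OF Q_carrier tw[OF A_carrier]])
  then have "exp_term n (A 0 *\<^sub>v z) $ i =
      (\<Sum>j<d. (Q n * map_mat (twist q (int n)) (A 0)) $$ (i, j) * frob n z $ j)"
    using z i index_mat_vec[of "Q n * map_mat (twist q (int n)) (A 0)" d "frob n z" i]
      mult_carrier_mat[OF Q_carrier tw[OF A_carrier]] by simp
  also have "\<dots> = (\<Sum>j<d. (\<Sum>k\<le>n. (A k * map_mat (twist q (int k)) (Q (n - k))) $$ (i, j)) * frob n z $ j)"
    using i by (intro sum.cong refl) (simp add: Q_rec)
  also have "\<dots> = (\<Sum>k\<le>n. \<Sum>j<d. (A k * map_mat (twist q (int k)) (Q (n - k))) $$ (i, j) * frob n z $ j)"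
    by (subst sum.swap) (simp add: sum_distrib_right)
  also have "\<dots> = (\<Sum>k\<le>n. (A k *\<^sub>v frob k (exp_term (n - k) z)) $ i)"
  proof (intro sum.cong refl)
    fix k
    assume "k \<in> {..n}"
    then have "frob k (exp_term (n - k) z) = map_mat (twist q (int k)) (Q (n - k)) *\<^sub>v frob n z"
      using z by (simp add: exp_term_def frob_mat_vec frob_frob)
    then have "A k *\<^sub>v frob k (exp_term (n - k) z) = (A k * map_mat (twist q (int k)) (Q (n - k))) *\<^sub>v frob n z"
      using z by (simp add: assoc_mult_mat_vec[OF A_carrier tw[OF Q_carrier]])
    then show "(\<Sum>j<d. (A k * map_mat (twist q (int k)) (Q (n - k))) $$ (i, j) * frob n z $ j) =
        (A k *\<^sub>v frob k (exp_term (n - k) z)) $ i"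
      using z i index_mat_vec[of "A k * map_mat (twist q (int k)) (Q (n - k))" d "frob n z" i]
        mult_carrier_mat[OF A_carrier tw[OF Q_carrier]] by simp
  qed
  finally show ?thesis .
qed

lemma exp_term_diff:
  assumes "u \<in> carrier_vec d" "v \<in> carrier_vec d"
  shows "exp_term n (u - v) = exp_term n u - exp_term n v"
proof -
  have "frob n (u - v) = frob n u - frob n v"
    using assms by (intro eq_vecI) (auto simp: frob_def frob_diff)
  then show ?thesis
    using assms by (simp add: exp_term_def mult_minus_distrib_mat_vec[OF Q_carrier])
qed

lemma exp_term_smult:
  assumes "v \<in> carrier_vec d"
  shows "exp_term n (c \<cdot>\<^sub>v v) = c ^ (q ^ n) \<cdot>\<^sub>v exp_term n v"
proof -
  have "frob n (c \<cdot>\<^sub>v v) = c ^ (q ^ n) \<cdot>\<^sub>v frob n v"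
    using assms by (intro eq_vecI) (auto simp: frob_def power_mult_distrib)
  then show ?thesis
    using assms by (simp add: exp_term_def mult_mat_vec[OF Q_carrier])
qed

lemma exp_term_0: "z \<in> carrier_vec d \<Longrightarrow> exp_term 0 z = z"
  by (auto simp: exp_term_def Q_0 frob_def)

section \<open>Growth of the coefficients \<open>Q n\<close>\<close>

definition exp_bounds :: "nat \<Rightarrow> real set" where
  "exp_bounds n = {B. 0 \<le> B \<and> (\<forall>z\<in>carrier_vec d. nrm (exp_term n z) \<le> B * nrm z ^ (q ^ n))}"

text \<open>The norm of \<open>exp_term n\<close> as a homogeneous map of degree q^n. It has to be
  the best constant: in \<open>exp_bound_rec\<close> it occurs on both sides of an estimate, and
  minimality is what allows the absorption.\<close>

definition exp_bound :: "nat \<Rightarrow> real" where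
  "exp_bound n = Inf (exp_bounds n)"

lemma exp_bounds_nonempty: "exp_bounds n \<noteq> {}"
proof -
  obtain C where "C \<ge> 1" "\<forall>k. \<forall>v\<in>carrier_vec d. nrm (Q n *\<^sub>v frob k v) \<le> C * nrm v ^ (q ^ k)"
    using mat_frob_bound[OF Q_carrier] by blast
  then have "C \<in> exp_bounds n"
    by (simp add: exp_bounds_def exp_term_def)
  then show ?thesis
    by blast
qed

lemma exp_bound_nonneg: "0 \<le> exp_bound n"
  unfolding exp_bound_def using exp_bounds_nonempty by (intro cInf_greatest) (auto simp: exp_bounds_def)

lemma exp_bound_le: "B \<in> exp_bounds n \<Longrightarrow> exp_bound n \<le> B"
  unfolding exp_bound_def by (intro cInf_lower bdd_belowI[of _ 0]) (auto simp: exp_bounds_def)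

lemma nrm_exp_term_le:
  assumes z: "z \<in> carrier_vec d"
  shows "nrm (exp_term n z) \<le> exp_bound n * nrm z ^ (q ^ n)"
proof (cases "nrm z = 0")
  case True
  then show ?thesis
    using exp_bounds_nonempty[of n] z q_ge_2 by (auto simp: exp_bounds_def power_0_left)
next
  case False
  then have pos: "nrm z ^ (q ^ n) > 0"
    using nrm_nonneg[of z] by (intro zero_less_power) linarith
  have "nrm (exp_term n z) / nrm z ^ (q ^ n) \<le> exp_bound n"
    unfolding exp_bound_def using exp_bounds_nonempty pos z
    by (intro cInf_greatest) (auto simp: exp_bounds_def field_simps)
  then show ?thesis
    using pos by (simp add: field_simps)
qed

text \<open>
  Estimate \<open>\<theta>\<^bsup>q^n\<^esup> Q\<^sub>n z\<^bsup>(n)\<^esup> = Q\<^sub>n (d[\<theta>] z)\<^bsup>(n)\<^esup> - Q\<^sub>n (nil z)\<^bsup>(n)\<^esup>\<close>: the terms of the right-hand side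
  that still contain \<open>Q\<^sub>n\<close> have norm at most \<open>q < q\<^bsup>q^n\<^esup>\<close> times that of \<open>Q\<^sub>n\<close> and can be absorbed.
\<close>
lemma exp_bound_rec:
  assumes C: "C \<ge> 1" "\<forall>j k. \<forall>v\<in>carrier_vec d. nrm (A j *\<^sub>v frob k v) \<le> C * nrm v ^ (q ^ k)"
    and n: "n \<ge> 1" and \<rho>: "0 \<le> \<rho>"
    and le: "\<And>k. 1 \<le> k \<Longrightarrow> k \<le> n \<Longrightarrow> k \<le> K \<Longrightarrow> C * exp_bound (n - k) ^ (q ^ k) \<le> \<rho>"
  shows "real q ^ (q ^ n) * exp_bound n \<le> \<rho>"
proof -
  let ?b = "exp_bound n"
  have main: "real q ^ (q ^ n) * nrm (exp_term n z) \<le> max (q * ?b) \<rho> * nrm z ^ (q ^ n)"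
    if z: "z \<in> carrier_vec d" for z
  proof -
    let ?B = "max (q * ?b) \<rho> * nrm z ^ (q ^ n)"
    define R where "R = vec d (\<lambda>i. \<Sum>k\<in>{1..n}. (A k *\<^sub>v frob k (exp_term (n - k) z)) $ i)"
    have B: "0 \<le> ?B"
      using \<rho> by simp
    have "\<theta> \<cdot>\<^sub>v z = A 0 *\<^sub>v z - nil z"
      using z A_vec_carrier[OF z, of 0] unfolding nil_def by auto
    then have "\<theta> ^ (q ^ n) \<cdot>\<^sub>v exp_term n z = exp_term n (A 0 *\<^sub>v z) - exp_term n (nil z)"
      using z by (simp flip: exp_term_smult add: exp_term_diff)
    also have "exp_term n (A 0 *\<^sub>v z) = A 0 *\<^sub>v exp_term n z + R"
    proof (rule eq_vecI)
      fix i
      assume "i < dim_vec (A 0 *\<^sub>v exp_term n z + R)"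
      then have i: "i < d"
        by (simp add: R_def)
      have "{..n} = insert 0 {1..n}"
        by auto
      then show "exp_term n (A 0 *\<^sub>v z) $ i = (A 0 *\<^sub>v exp_term n z + R) $ i"
        using z i A_vec_carrier[OF exp_term_carrier[OF z], of 0 n]
        by (simp add: exp_term_A0 R_def)
    qed (use z A_vec_carrier[OF z, of 0] in \<open>simp add: R_def carrier_vecD[OF exp_term_carrier]\<close>)
    finally have eq: "\<theta> ^ (q ^ n) \<cdot>\<^sub>v exp_term n z = A 0 *\<^sub>v exp_term n z + R - exp_term n (nil z)" .
    have b1: "?b * nrm z ^ (q ^ n) \<le> ?B"
    proof (rule mult_right_mono)
      show "?b \<le> max (q * ?b) \<rho>"
        using q_ge_2 exp_bound_nonneg[of n] mult_right_mono[of 1 "real q" ?b] by simp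
    qed simp
    have b2: "nrm (A 0 *\<^sub>v exp_term n z) \<le> ?B"
    proof -
      have "nrm (A 0 *\<^sub>v exp_term n z) \<le> q * (?b * nrm z ^ (q ^ n))"
        using nrm_A0_le[OF exp_term_carrier[OF z], of n]
          mult_left_mono[OF nrm_exp_term_le[OF z, of n], of "real q"] by simp
      also have "\<dots> \<le> ?B"
        by (subst mult.assoc[symmetric]) (intro mult_right_mono, auto)
      finally show ?thesis .
    qed
    have b3: "nrm R \<le> ?B"
      unfolding R_def
    proof (rule nrm_vec_sum_le)
      fix k
      assume k: "k \<in> {1..n}"
      show "A k *\<^sub>v frob k (exp_term (n - k) z) \<in> carrier_vec d \<and> nrm (A k *\<^sub>v frob k (exp_term (n - k) z)) \<le> ?B"
      proof (cases "k \<le> K")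
        case True
        have "nrm (A k *\<^sub>v frob k (exp_term (n - k) z)) \<le> C * nrm (exp_term (n - k) z) ^ (q ^ k)"
          using C(2) z by simp
        also have "\<dots> \<le> C * (exp_bound (n - k) * nrm z ^ (q ^ (n - k))) ^ (q ^ k)"
          using C(1) by (intro mult_left_mono power_mono nrm_exp_term_le z) auto
        also have "\<dots> = C * exp_bound (n - k) ^ (q ^ k) * nrm z ^ (q ^ n)"
          using k by (simp add: power_mult_distrib flip: power_mult power_add)
        also have "\<dots> \<le> ?B"
          using le[of k] k True by (intro mult_right_mono) auto
        finally show ?thesis
          using z by simp
      next
        case False
        then have "A k *\<^sub>v frob k (exp_term (n - k) z) = 0\<^sub>v d"
          using z by (simp add: A_zero zero_mat_vec)
        then show ?thesis
          using B by simp
      qed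
    qed (use B in auto)
    have b4: "nrm (exp_term n (nil z)) \<le> ?B"
    proof -
      have "nrm (exp_term n (nil z)) \<le> ?b * nrm (nil z) ^ (q ^ n)"
        using z by (intro nrm_exp_term_le) simp
      also have "\<dots> \<le> ?b * nrm z ^ (q ^ n)"
        by (intro mult_left_mono power_mono nrm_nil_le z exp_bound_nonneg nrm_nonneg)
      finally show ?thesis
        using b1 by linarith
    qed
    have "nrm (\<theta> ^ (q ^ n) \<cdot>\<^sub>v exp_term n z) \<le> ?B"
      unfolding eq using z by (intro nrm_diff_leI nrm_add_leI b2 b3 b4 exp_term_carrier nil_carrier A_vec_carrier add_carrier_vec) (auto simp: R_def)
    then show ?thesis
      using z by (simp add: nrm_smult vabs_power vabs_theta)
  qed
  let ?P = "real q ^ (q ^ n)"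
  have P: "?P > 0"
    using q_ge_2 by simp
  have "max (q * ?b) \<rho> / ?P \<in> exp_bounds n"
    unfolding exp_bounds_def using main \<rho> P by (auto simp: field_simps)
  \<comment> \<open>By \<open>main\<close> the quotient is an admissible constant, so it bounds the
    infimum \<open>?b\<close>.\<close>
  then have b: "?P * ?b \<le> max (q * ?b) \<rho>"
    using exp_bound_le P by (fastforce simp: field_simps)
  \<comment> \<open>Since n \<ge> 1, the factor \<open>?P\<close> beats q; unless \<open>?b\<close>
    is 0, the maximum in \<open>b\<close> must therefore be attained by \<rho>.\<close>
  have "real q < ?P"
  proof -
    have "q ^ 1 \<le> q ^ n"
      using n q_ge_2 by (intro power_increasing) auto
    then have "1 < q ^ n"
      using q_ge_2 by simp
    then show ?thesis
      using q_ge_2 power_strict_increasing[of 1 "q ^ n" "real q"] by simp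
  qed
  show ?thesis
  proof (cases "?b = 0")
    case False
    then have "?b > 0"
      using exp_bound_nonneg[of n] by linarith
    then have "q * ?b < ?P * ?b"
      using \<open>real q < ?P\<close> by simp
    then show ?thesis
      using b by simp
  qed (use \<rho> in simp)
qed

text \<open>Let b_n be the q^n-th root of \<open>exp_bound n\<close>. By
  \<open>exp_bound_rec\<close>, q b_n is at most C^(1/q^n) times the maximum of b_(n-k) for 1 \<le>
  k \<le> K. As C^(1/q^n) tends to 1, a factor near 1/q is gained at least every K steps, which
  makes b_n decay geometrically.\<close>

lemma exp_bound_decay:
  "\<exists>D \<eta>. 0 < D \<and> 0 < \<eta> \<and> \<eta> < 1 \<and> (\<forall>n. exp_bound n \<le> (D * \<eta> ^ n) ^ (q ^ n))"
proof -
  obtain C where C: "C \<ge> 1" "\<forall>j k. \<forall>v\<in>carrier_vec d. nrm (A j *\<^sub>v frob k v) \<le> C * nrm v ^ (q ^ k)"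
    using A_bound by blast
  \<comment> \<open>By Bernoulli's inequality \<eta>^K > 1/2, so \<open>a\<close> = q \<eta>^K
    exceeds 1. This excess, raised to the power q^n, absorbs \<open>C\<close> as soon as n \<ge>
    \<open>n1\<close>.\<close>
  define \<eta> where "\<eta> = 1 - 1 / (2 * real (Suc K))"
  have \<eta>: "0 < \<eta>" "\<eta> < 1"
    by (auto simp: \<eta>_def field_simps)
  have "1 + real K * (- 1 / (2 * real (Suc K))) \<le> \<eta> ^ K"
    using Bernoulli_inequality[of "- 1 / (2 * real (Suc K))" K] by (simp add: \<eta>_def field_simps)
  moreover have "1 + real K * (- 1 / (2 * real (Suc K))) > 1 / 2"
    by (simp add: field_simps)
  ultimately have "\<eta> ^ K > 1 / 2"
    by linarith
  define a where "a = real q * \<eta> ^ K"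
  have "2 * \<eta> ^ K \<le> a"
    using q_ge_2 \<eta>(1) unfolding a_def by (intro mult_right_mono) auto
  then have "a > 1"
    using \<open>\<eta> ^ K > 1 / 2\<close> by linarith
  then obtain n1 where n1: "C < a ^ n1"
    using real_arch_pow by blast
  have big: "C \<le> a ^ (q ^ n)" if "n \<ge> n1" for n
  proof -
    have "n \<le> q ^ n"
      using q_ge_2 less_imp_le[OF less_exp[of n]] power_mono[of 2 q n] by linarith
    then have "a ^ n1 \<le> a ^ (q ^ n)"
      using \<open>a > 1\<close> that by (intro power_increasing) auto
    then show ?thesis
      using n1 by linarith
  qed
  \<comment> \<open>The sum covers the indices up to \<open>n1\<close>, to which the recursion is
    not applied. The summand 1 in each numerator gives D \<eta>^n \<ge> 1 there, so raising to the
    power q^n only enlarges the bound.\<close>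
  define D where "D = 1 + (\<Sum>n<Suc n1. (1 + exp_bound n) / \<eta> ^ n)"
  have pos: "0 \<le> (1 + exp_bound n) / \<eta> ^ n" for n
    using \<eta>(1) exp_bound_nonneg[of n] by simp
  then have D: "D \<ge> 1"
    unfolding D_def by (simp add: sum_nonneg del: sum.lessThan_Suc)
  have "exp_bound n \<le> (D * \<eta> ^ n) ^ (q ^ n)" for n
  proof (induction n rule: less_induct)
    case (less n)
    show ?case
    proof (cases "n < Suc n1")
      case True
      have "(1 + exp_bound n) / \<eta> ^ n \<le> (\<Sum>n<Suc n1. (1 + exp_bound n) / \<eta> ^ n)"
        using True pos by (intro member_le_sum) auto
      then have "(1 + exp_bound n) / \<eta> ^ n \<le> D"
        unfolding D_def by linarith
      then have "1 + exp_bound n \<le> D * \<eta> ^ n"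
        using \<eta>(1) by (simp add: pos_divide_le_eq)
      moreover have "(D * \<eta> ^ n) ^ 1 \<le> (D * \<eta> ^ n) ^ (q ^ n)"
        using calculation exp_bound_nonneg[of n] q_power_pos[of n]
        by (intro power_increasing) (auto simp: Suc_leI)
      ultimately show ?thesis
        by simp
    next
      case False
      let ?\<rho> = "real q ^ (q ^ n) * (D * \<eta> ^ n) ^ (q ^ n)"
      have "real q ^ (q ^ n) * exp_bound n \<le> ?\<rho>"
      proof (rule exp_bound_rec[OF C])
        fix k
        assume k: "1 \<le> k" "k \<le> n" "k \<le> K"
        have "C * exp_bound (n - k) ^ (q ^ k) \<le> C * ((D * \<eta> ^ (n - k)) ^ (q ^ (n - k))) ^ (q ^ k)"
          using C(1) k by (intro mult_left_mono power_mono less exp_bound_nonneg) auto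
        also have "\<dots> = C * (D * \<eta> ^ (n - k)) ^ (q ^ n)"
          using k by (simp flip: power_mult power_add)
        also have "\<dots> \<le> a ^ (q ^ n) * (D * \<eta> ^ (n - k)) ^ (q ^ n)"
          using big[of n] False D \<eta> by (intro mult_right_mono) auto
        also have "\<dots> = (a * (D * \<eta> ^ (n - k))) ^ (q ^ n)"
          by (simp add: power_mult_distrib)
        also have "\<dots> \<le> (real q * (D * \<eta> ^ n)) ^ (q ^ n)"
        proof (rule power_mono)
          have "\<eta> ^ K \<le> \<eta> ^ k"
            using \<eta> k by (intro power_decreasing) auto
          then have "a * (D * \<eta> ^ (n - k)) \<le> (real q * \<eta> ^ k) * (D * \<eta> ^ (n - k))"
            unfolding a_def using D \<eta> by (intro mult_right_mono mult_left_mono) auto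
          also have "\<dots> = real q * (D * (\<eta> ^ k * \<eta> ^ (n - k)))"
            by simp
          also have "\<eta> ^ k * \<eta> ^ (n - k) = \<eta> ^ n"
            using k by (simp flip: power_add)
          finally show "a * (D * \<eta> ^ (n - k)) \<le> real q * (D * \<eta> ^ n)" .
        qed (use \<open>a > 1\<close> D \<eta> in auto)
        finally show "C * exp_bound (n - k) ^ (q ^ k) \<le> ?\<rho>"
          by (simp add: power_mult_distrib)
      qed (use False D \<eta> in auto)
      then show ?thesis
        using q_ge_2 by simp
    qed
  qed
  then show ?thesis
    using D \<eta> by (intro exI[of _ D] exI[of _ \<eta>]) auto
qed

lemma nrm_exp_term_tendsto_0:
  assumes z: "z \<in> carrier_vec d"
  shows "(\<lambda>n. nrm (exp_term n z)) \<longlonglongrightarrow> 0"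
proof -
  obtain D \<eta> where D: "0 < D" "0 < \<eta>" "\<eta> < 1" "\<And>n. exp_bound n \<le> (D * \<eta> ^ n) ^ (q ^ n)"
    using exp_bound_decay by blast
  have lim: "(\<lambda>n. D * nrm z * \<eta> ^ n) \<longlonglongrightarrow> 0"
    using D LIMSEQ_realpow_zero[of \<eta>] tendsto_mult_right_zero by (metis less_imp_le)
  have "\<forall>\<^sub>F n in sequentially. D * nrm z * \<eta> ^ n < 1"
    using order_tendstoD(2)[OF lim] by simp
  then have "\<forall>\<^sub>F n in sequentially. nrm (exp_term n z) \<le> D * nrm z * \<eta> ^ n"
  proof (rule eventually_mono)
    fix n
    assume small: "D * nrm z * \<eta> ^ n < 1"
    have "nrm (exp_term n z) \<le> exp_bound n * nrm z ^ (q ^ n)"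
      by (rule nrm_exp_term_le[OF z])
    also have "\<dots> \<le> (D * \<eta> ^ n) ^ (q ^ n) * nrm z ^ (q ^ n)"
      using D(4) by (intro mult_right_mono) auto
    also have "\<dots> = (D * nrm z * \<eta> ^ n) ^ (q ^ n)"
      by (simp add: power_mult_distrib)
    also have "\<dots> \<le> (D * nrm z * \<eta> ^ n) ^ 1"
      using small D q_power_pos[of n] by (intro power_decreasing) (auto simp: Suc_leI)
    finally show "nrm (exp_term n z) \<le> D * nrm z * \<eta> ^ n"
      by simp
  qed
  then show ?thesis
    using lim by (intro tendsto_sandwich[OF _ _ tendsto_const lim]) auto
qed

lemma exp_bound_bounded: "\<exists>C\<ge>0. \<forall>n. exp_bound n \<le> C"
proof -
  obtain D \<eta> where D: "0 < D" "0 < \<eta>" "\<eta> < 1" "\<And>n. exp_bound n \<le> (D * \<eta> ^ n) ^ (q ^ n)"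
    using exp_bound_decay by blast
  have "(\<lambda>n. D * \<eta> ^ n) \<longlonglongrightarrow> 0"
    using D LIMSEQ_realpow_zero[of \<eta>] tendsto_mult_right_zero by (metis less_imp_le)
  then have "\<forall>\<^sub>F n in sequentially. D * \<eta> ^ n < 1"
    by (intro order_tendstoD(2)) auto
  then obtain M where M: "\<And>n. n \<ge> M \<Longrightarrow> D * \<eta> ^ n < 1"
    by (auto simp: eventually_sequentially)
  have "exp_bound n \<le> 1 + (\<Sum>n<M. exp_bound n)" for n
  proof (cases "n < M")
    case True
    then have "exp_bound n \<le> (\<Sum>n<M. exp_bound n)"
      using exp_bound_nonneg by (intro member_le_sum) auto
    then show ?thesis
      by simp
  next
    case False
    then have "(D * \<eta> ^ n) ^ (q ^ n) \<le> 1"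
      using M[of n] D by (intro power_le_one) auto
    then show ?thesis
      using D(4)[of n] sum_nonneg[of "{..<M}" exp_bound] exp_bound_nonneg by fastforce
  qed
  then show ?thesis
    using exp_bound_nonneg by (intro exI[of _ "1 + (\<Sum>n<M. exp_bound n)"]) (auto intro!: add_nonneg_nonneg sum_nonneg)
qed

section \<open>The exponential and E'_\<theta> as functions\<close>

abbreviation Exp :: "'c vec \<Rightarrow> 'c vec" where
  "Exp z \<equiv> Exp_value q d Q z"

abbreviation E :: "'c vec \<Rightarrow> 'c vec" where
  "E x \<equiv> tau_poly_apply q d A x"

lemma Exp_carrier [simp]: "Exp z \<in> carrier_vec d"
  by (simp add: Exp_value_def)

lemma E_carrier [simp]: "E z \<in> carrier_vec d"
  by (simp add: tau_poly_apply_def)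

lemma dim_Exp_E [simp]: "dim_vec (Exp z) = d" "dim_vec (E z) = d"
  by (simp_all add: Exp_value_def tau_poly_apply_def)

lemma exp_sums:
  assumes z: "z \<in> carrier_vec d" and i: "i < d"
  shows "(\<lambda>n. exp_term n z $ i) sums (Exp z $ i)"
proof -
  have "(\<lambda>n. vabs (exp_term n z $ i)) \<longlonglongrightarrow> 0"
    using vabs_le_nrm[OF i]
    by (intro tendsto_sandwich[OF _ _ tendsto_const nrm_exp_term_tendsto_0[OF z]]) auto
  then have "summable (\<lambda>n. exp_term n z $ i)"
    by (rule summable_vabs_tendsto_0)
  moreover have "exp_term n z = Q n *\<^sub>v map_vec (twist q (int n)) z" for n
    by (simp add: exp_term_def)
  ultimately show ?thesis
    using i by (simp add: Exp_value_def summable_sums)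
qed

lemma E_index:
  assumes x: "x \<in> carrier_vec d" and i: "i < d"
  shows "E x $ i = (\<Sum>k\<le>K. (A k *\<^sub>v frob k x) $ i)"
proof -
  have "(\<Sum>k | A k \<noteq> 0\<^sub>m d d. (A k *\<^sub>v map_vec (twist q (int k)) x) $ i) = (\<Sum>k\<le>K. (A k *\<^sub>v map_vec (twist q (int k)) x) $ i)"
  proof (rule sum.mono_neutral_left)
    show "{k. A k \<noteq> 0\<^sub>m d d} \<subseteq> {..K}"
      using A_zero by (auto simp: not_le[symmetric])
    show "\<forall>k\<in>{..K} - {k. A k \<noteq> 0\<^sub>m d d}. (A k *\<^sub>v map_vec (twist q (int k)) x) $ i = 0"
      using x i by (auto simp: zero_mat_vec)
  qed simp
  then show ?thesis
    using i by (simp add: tau_poly_apply_def)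
qed

lemma sums_shift:
  fixes f :: "nat \<Rightarrow> 'c"
  assumes "f sums l"
  shows "(\<lambda>n. if k \<le> n then f (n - k) else 0) sums l"
proof (induction k)
  case (Suc k)
  have "(\<lambda>n. (if Suc k \<le> Suc n then f (Suc n - Suc k) else 0)) sums l"
    using Suc by (simp cong: if_cong)
  from sums_Suc[of "\<lambda>n. if Suc k \<le> n then f (n - Suc k) else 0", OF this] show ?case
    by simp
qed (use assms in simp)

text \<open>E'_\<theta>(Exp z) is a finite sum over k of the series \<open>A k\<close> applied to
  q^k-th powers. Delaying the k-th series by k places lets the terms of equal total degree q^n meet,
  and \<open>exp_term_A0\<close> evaluates their sum.\<close>

lemma Exp_A0:
  assumes z: "z \<in> carrier_vec d"
  shows "Exp (A 0 *\<^sub>v z) = E (Exp z)"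
proof (rule eq_vecI)
  fix i
  assume "i < dim_vec (E (Exp z))"
  then have i: "i < d"
    by (simp add: tau_poly_apply_def)
  have "(\<lambda>n. (A k *\<^sub>v frob k (exp_term n z)) $ i) sums ((A k *\<^sub>v frob k (Exp z)) $ i)" for k
    using i z by (simp add: index_mat_vec[of _ d]) (intro sums_sum sums_vabs_mult_left sums_frob exp_sums, auto)
  then have "(\<lambda>n. if k \<le> n then (A k *\<^sub>v frob k (exp_term (n - k) z)) $ i else 0) sums ((A k *\<^sub>v frob k (Exp z)) $ i)" for k
    by (rule sums_shift)
  then have "(\<lambda>n. \<Sum>k\<le>K. if k \<le> n then (A k *\<^sub>v frob k (exp_term (n - k) z)) $ i else 0) sums (E (Exp z) $ i)"
    using i by (simp add: E_index sums_sum)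
  moreover have "(\<Sum>k\<le>K. if k \<le> n then (A k *\<^sub>v frob k (exp_term (n - k) z)) $ i else 0) = exp_term n (A 0 *\<^sub>v z) $ i" for n
  proof -
    have "(\<Sum>k\<le>K. if k \<le> n then (A k *\<^sub>v frob k (exp_term (n - k) z)) $ i else 0) =
        (\<Sum>k\<in>{..K} \<inter> {..n}. (A k *\<^sub>v frob k (exp_term (n - k) z)) $ i)"
      by (subst sum.inter_restrict) auto
    also have "\<dots> = (\<Sum>k\<le>n. (A k *\<^sub>v frob k (exp_term (n - k) z)) $ i)"
    proof (rule sum.mono_neutral_left)
      show "\<forall>k\<in>{..n} - {..K} \<inter> {..n}. (A k *\<^sub>v frob k (exp_term (n - k) z)) $ i = 0"
      proof
        fix k
        assume "k \<in> {..n} - {..K} \<inter> {..n}"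
        then have "A k = 0\<^sub>m d d"
          by (intro A_zero) auto
        then show "(A k *\<^sub>v frob k (exp_term (n - k) z)) $ i = 0"
          using z i by (simp add: zero_mat_vec)
      qed
    qed auto
    finally show ?thesis
      using z i by (simp add: exp_term_A0)
  qed
  ultimately have "(\<lambda>n. exp_term n (A 0 *\<^sub>v z) $ i) sums (E (Exp z) $ i)"
    by simp
  then show "Exp (A 0 *\<^sub>v z) $ i = E (Exp z) $ i"
    using exp_sums[OF A_vec_carrier[OF z] i] sums_unique2 by blast
qed (simp add: Exp_value_def tau_poly_apply_def)

lemma E_diff:
  assumes "x \<in> carrier_vec d" "y \<in> carrier_vec d"
  shows "E (x - y) = E x - E y"
proof (rule eq_vecI)
  fix i
  assume "i < dim_vec (E x - E y)"
  then have i: "i < d"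
    by (simp add: tau_poly_apply_def)
  have "frob k (x - y) = frob k x - frob k y" for k
    using assms by (intro eq_vecI) (auto simp: frob_def frob_diff)
  then show "E (x - y) $ i = (E x - E y) $ i"
    using assms i
    by (simp add: E_index mult_minus_distrib_mat_vec[OF A_carrier] sum_subtractf)
qed (simp add: tau_poly_apply_def)

lemma E_zero: "E (0\<^sub>v d) = 0\<^sub>v d"
  using E_diff[of "0\<^sub>v d" "0\<^sub>v d"] minus_cancel_vec[OF E_carrier] by simp

text \<open>The terms after the linear one have degree q^n \<ge> 2, and their coefficients are
  uniformly bounded.\<close>

lemma Exp_close:
  "\<exists>C\<ge>0. \<forall>z\<in>carrier_vec d. nrm z \<le> 1 \<longrightarrow> nrm (Exp z - z) \<le> C * nrm z ^ 2"
proof -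
  obtain C where C: "C \<ge> 0" "\<And>n. exp_bound n \<le> C"
    using exp_bound_bounded by blast
  obtain C' where C': "C' \<ge> 1"
    "\<And>v B. v \<in> carrier_vec d \<Longrightarrow> B \<ge> 0 \<Longrightarrow> \<forall>i<d. vabs (v $ i) \<le> B \<Longrightarrow> nrm v \<le> C' * B"
    using nrm_le_sup by blast
  have "nrm (Exp z - z) \<le> C' * C * nrm z ^ 2" if z: "z \<in> carrier_vec d" "nrm z \<le> 1" for z
  proof -
    have "vabs ((Exp z - z) $ i) \<le> C * nrm z ^ 2" if i: "i < d" for i
    proof (rule vabs_sums_le)
      have "(\<lambda>n. exp_term n z $ i + (if n = 0 then - (z $ i) else 0)) sums (Exp z $ i + - (z $ i))"
        by (intro sums_add exp_sums z i sums_single)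
      then show "(\<lambda>n. exp_term n z $ i + (if n = 0 then - (z $ i) else 0)) sums ((Exp z - z) $ i)"
        using z i by simp
      show "vabs (exp_term n z $ i + (if n = 0 then - (z $ i) else 0)) \<le> C * nrm z ^ 2" for n
      proof (cases "n = 0")
        case False
        have "vabs (exp_term n z $ i) \<le> exp_bound n * nrm z ^ (q ^ n)"
          using vabs_le_nrm[OF i] nrm_exp_term_le[OF z(1)] order_trans by blast
        also have "\<dots> \<le> C * nrm z ^ 2"
        proof (intro mult_mono C power_decreasing)
          show "2 \<le> q ^ n"
            using power_increasing[of 1 n q] q_ge_2 False by simp
        qed (use z in auto)
        finally show ?thesis
          using False by simp
      qed (use z C in \<open>simp add: exp_term_0\<close>)
    qed
    then show ?thesis
      using C'(2)[of "Exp z - z" "C * nrm z ^ 2"] z C(1) by (simp add: mult.assoc)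
  qed
  then show ?thesis
    using C C'(1) by (intro exI[of _ "C' * C"]) auto
qed

text \<open>The terms in \<tau>, \<tau>^2, ... are at most C |x|^2, hence at most |x| within the
  radius 1/C; the linear term then decides.\<close>

lemma E_small:
  "\<exists>\<epsilon>>0. \<forall>x\<in>carrier_vec d. nrm x \<le> \<epsilon> \<longrightarrow> nrm (E x) \<le> q * nrm x"
proof -
  obtain C where C: "C \<ge> 1" "\<forall>j k. \<forall>v\<in>carrier_vec d. nrm (A j *\<^sub>v frob k v) \<le> C * nrm v ^ (q ^ k)"
    using A_bound by blast
  have "nrm (E x) \<le> q * nrm x" if x: "x \<in> carrier_vec d" "nrm x \<le> 1 / C" for x
  proof -
    have "E x = vec d (\<lambda>i. \<Sum>k\<le>K. (A k *\<^sub>v frob k x) $ i)"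
      using x by (intro eq_vecI) (auto simp: E_index carrier_vecD[OF E_carrier])
    moreover have "nrm (vec d (\<lambda>i. \<Sum>k\<le>K. (A k *\<^sub>v frob k x) $ i)) \<le> q * nrm x"
    proof (rule nrm_vec_sum_le)
      fix k
      show "A k *\<^sub>v frob k x \<in> carrier_vec d \<and> nrm (A k *\<^sub>v frob k x) \<le> q * nrm x"
      proof (cases "k = 0")
        case True
        then show ?thesis
          using nrm_A0_le[OF x(1)] x by simp
      next
        case False
        have "1 / C \<le> 1"
          using C(1) by simp
        then have "nrm x \<le> 1"
          using x(2) by linarith
        have "nrm (A k *\<^sub>v frob k x) \<le> C * nrm x ^ (q ^ k)"
          using C(2) x by simp
        also have "\<dots> \<le> C * nrm x ^ 2"
          using C(1) \<open>nrm x \<le> 1\<close> power_increasing[of 1 k q] q_ge_2 False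
          by (intro mult_left_mono power_decreasing) auto
        also have "\<dots> \<le> 1 * nrm x"
          using x(2) C(1) mult_right_mono[of "C * nrm x" 1 "nrm x"]
          by (simp add: power2_eq_square field_simps)
        also have "\<dots> \<le> q * nrm x"
          using q_ge_2 by (intro mult_right_mono) auto
        finally show ?thesis
          using x by simp
      qed
    qed auto
    ultimately show ?thesis
      by simp
  qed
  then show ?thesis
    using C(1) by (intro exI[of _ "1 / C"]) auto
qed

text \<open>Stated for arbitrary backward orbits, so that the motive enters only through the two
  rates. The rates may hold for large n alone: once some error \<open>e N\<close> is zero,
  \<open>E\<close> carries the zero back to \<open>e 0\<close>.\<close>

lemma Exp_eqI:
  assumes carr: "\<And>n. y n \<in> carrier_vec d" "\<And>n. z n \<in> carrier_vec d"
    and y: "\<And>n. E (y (Suc n)) = y n"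
    and z: "\<And>n. A 0 *\<^sub>v z (Suc n) = z n"
    and C: "C \<ge> 0" "\<And>n. n \<ge> n0 \<Longrightarrow> nrm (y n - z n) \<le> C * (1 / q) ^ (2 * n)"
      "\<And>n. n \<ge> n0 \<Longrightarrow> nrm (z n) \<le> C * (1 / q) ^ n"
  shows "Exp (z 0) = y 0"
proof -
  define e where "e n = y n - Exp (z n)" for n
  have e_carr [simp]: "e n \<in> carrier_vec d" for n
    by (simp add: e_def carr)
  have e_rec: "E (e (Suc n)) = e n" for n
    using carr by (simp add: e_def E_diff y z flip: Exp_A0)
  obtain C1 where C1: "C1 \<ge> 0" "\<And>z. z \<in> carrier_vec d \<Longrightarrow> nrm z \<le> 1 \<Longrightarrow> nrm (Exp z - z) \<le> C1 * nrm z ^ 2"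
    using Exp_close by blast
  obtain \<epsilon> where \<epsilon>: "\<epsilon> > 0" "\<And>x. x \<in> carrier_vec d \<Longrightarrow> nrm x \<le> \<epsilon> \<Longrightarrow> nrm (E x) \<le> q * nrm x"
    using E_small by blast
  let ?g = "1 / real q"
  define C2 where "C2 = C + C1 * C ^ 2"
  have g: "0 \<le> ?g" "?g < 1"
    using q_ge_2 by auto
  have C2: "C2 \<ge> 0"
    using C(1) C1(1) by (simp add: C2_def)
  have lim: "(\<lambda>n. B * ?g ^ n) \<longlonglongrightarrow> 0" for B
    using LIMSEQ_realpow_zero[OF g] tendsto_mult_right_zero by blast
  obtain n1 where n1: "\<And>n. n \<ge> n1 \<Longrightarrow> C * ?g ^ n < 1"
    using order_tendstoD(2)[OF lim[of C], of 1] by (auto simp: eventually_sequentially)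
  have e_le: "nrm (e n) \<le> C2 * ?g ^ (2 * n)" if "n \<ge> max n0 n1" for n
  proof -
    have zn: "nrm (z n) \<le> C * ?g ^ n" "nrm (z n) \<le> 1"
      using C(3)[of n] n1[of n] that by auto
    have "nrm (Exp (z n) - z n) \<le> C1 * nrm (z n) ^ 2"
      using C1(2) carr zn by blast
    also have "\<dots> \<le> C1 * (C * ?g ^ n) ^ 2"
      using zn C1(1) by (intro mult_left_mono power_mono) auto
    also have "\<dots> = C1 * C ^ 2 * ?g ^ (2 * n)"
      by (simp add: power_mult_distrib mult.commute[of 2] flip: power_mult)
    also have "\<dots> \<le> C2 * ?g ^ (2 * n)"
      using C(1) g by (intro mult_right_mono) (auto simp: C2_def)
    finally have 1: "nrm (Exp (z n) - z n) \<le> C2 * ?g ^ (2 * n)" .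
    have "C * ?g ^ (2 * n) \<le> C2 * ?g ^ (2 * n)"
      using C1(1) C(1) g by (intro mult_right_mono) (auto simp: C2_def)
    then have 2: "nrm (y n - z n) \<le> C2 * ?g ^ (2 * n)"
      using C(2)[of n] that by simp
    have "e n = (y n - z n) - (Exp (z n) - z n)"
      using carr[of n] by (intro eq_vecI) (auto simp: e_def)
    then show ?thesis
      using 1 2 carr nrm_diff_leI[of "y n - z n" "Exp (z n) - z n"] by simp
  qed
  obtain n2 where n2: "\<And>n. n \<ge> n2 \<Longrightarrow> C2 * ?g ^ n < \<epsilon>"
    using order_tendstoD(2)[OF lim[of C2], of \<epsilon>] \<epsilon>(1) by (auto simp: eventually_sequentially)
  define N where "N = max n2 (max n0 n1)"
  have step: "nrm (e n) \<le> q * nrm (e (Suc n))" if "n \<ge> N" for n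
  proof -
    have "nrm (e (Suc n)) \<le> C2 * ?g ^ (2 * Suc n)"
      by (rule e_le) (use that in \<open>simp add: N_def\<close>)
    also have "\<dots> < \<epsilon>"
      using n2[of "2 * Suc n"] that by (simp add: N_def)
    finally show ?thesis
      using \<epsilon>(2)[of "e (Suc n)"] by (simp add: e_rec)
  qed
  have iter: "nrm (e N) \<le> real q ^ k * nrm (e (N + k))" for k
  proof (induction k)
    case (Suc k)
    then show ?case
      using step[of "N + k"] mult_left_mono[of "nrm (e (N + k))" "q * nrm (e (Suc (N + k)))" "real q ^ k"]
      by (simp add: mult.assoc mult.commute mult.left_commute)
  qed simp
  \<comment> \<open>N stays fixed while k grows: the accumulated stretch q^k meets the rate q^(-2(N
    + k)), and the limit in k is 0.\<close>
  have "nrm (e N) \<le> C2 * ?g ^ k" for k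
  proof -
    have "max n0 n1 \<le> N + k"
      unfolding N_def by (intro trans_le_add1 max.cobounded2)
    then have "real q ^ k * nrm (e (N + k)) \<le> real q ^ k * (C2 * ?g ^ (2 * (N + k)))"
      by (intro mult_left_mono e_le) auto
    then have "nrm (e N) \<le> real q ^ k * (C2 * ?g ^ (2 * (N + k)))"
      using iter[of k] by linarith
    also have "\<dots> \<le> real q ^ k * (C2 * ?g ^ (2 * k))"
      using C2 g by (intro mult_left_mono power_decreasing) auto
    also have "\<dots> = C2 * ?g ^ k"
      using q_ge_2 by (simp add: field_simps power_mult power2_eq_square flip: power_mult_distrib)
    finally show ?thesis .
  qed
  then have "nrm (e N) \<le> 0"
    using lim[of C2] by (intro LIMSEQ_le_const) auto
  then have "nrm (e N) = 0"
    by (simp add: order.antisym)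
  then have "e N = 0\<^sub>v d"
    by (intro nrm_eq_0D) simp
  then have "e (N - k) = 0\<^sub>v d" if "k \<le> N" for k
    using that
  proof (induction k)
    case (Suc k)
    then have "e (N - Suc k) = E (e (N - k))"
      using e_rec[of "N - Suc k"] by (simp add: Suc_diff_Suc)
    then show ?case
      using Suc by (simp add: E_zero)
  qed simp
  from this[of N] have "y 0 - Exp (z 0) = 0\<^sub>v d"
    by (simp add: e_def)
  then show ?thesis
    using carr(1)[of 0]
    by (intro eq_vecI) (auto simp: vec_eq_iff)
qed

end

section \<open>Coordinates with respect to the two bases\<close>

lemma polys_over_pCons: "c \<in> S \<Longrightarrow> a \<in> polys_over S \<Longrightarrow> pCons c a \<in> polys_over S"
  by (auto simp: polys_over_def coeff_pCons split: nat.split)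

text \<open>Replaces the range up to the degree, which varies with p, by a range common to several
  polynomials.\<close>

lemma sum_poly_coeff_eq:
  assumes "\<And>i. i \<ge> n \<Longrightarrow> coeff p i = 0" "\<And>i. g i 0 = (0 :: 'b::comm_monoid_add)"
  shows "(\<Sum>i\<le>degree p. g i (coeff p i)) = (\<Sum>i<n. g i (coeff p i))"
  by (rule sum.mono_neutral_cong) (use assms in \<open>auto simp: coeff_eq_0 not_le not_less\<close>)

locale motive_with_bases = effective_dual_t_motive q F \<theta> act \<sigma>
  for q :: nat and F :: "'c::{nonarch_valued_field, complete_space} set" and \<theta> :: 'c
    and act :: "'c poly \<Rightarrow> 'm::ab_group_add \<Rightarrow> 'm" and \<sigma> :: "'m \<Rightarrow> 'm" +
  fixes r d :: nat and m w :: "nat \<Rightarrow> 'm"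
  assumes Kt: "Kt_basis F \<theta> act r m" and Ksigma: "Ksigma_basis F \<theta> act \<sigma> d w"
begin

abbreviation Kb :: "'c set" where "Kb \<equiv> K_bar F \<theta>"
abbreviation tt :: "'c poly" where "tt \<equiv> [:0, 1:]"
abbreviation \<delta>\<^sub>0 :: "'m \<Rightarrow> 'c vec" where "\<delta>\<^sub>0 \<equiv> delta0 F \<theta> act \<sigma> d w"
abbreviation \<delta>\<^sub>1 :: "'m \<Rightarrow> 'c vec" where "\<delta>\<^sub>1 \<equiv> delta1 q F \<theta> act \<sigma> d w"
abbreviation root :: "'c \<Rightarrow> 'c" where "root \<equiv> twist q (- 1)"

lemmas Kb_closed = is_subfieldD[OF is_subfield_K_bar]
lemmas PK_closed = polys_over_closed[OF is_subfield_K_bar]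

lemma tt_PK [simp]: "tt \<in> polys_over Kb"
  by (intro polys_over_pCons Kb_closed PK_closed)

lemma theta_PK [simp]: "[:- \<theta>, 1:] \<in> polys_over Kb"
  by (intro polys_over_pCons Kb_closed PK_closed theta_K_bar)

lemma act_0_left [simp]: "act 0 x = 0"
  using scale_add_left[of 0 0 x] PK_closed(1) by simp

lemma act_0_right [simp]: "a \<in> polys_over Kb \<Longrightarrow> act a 0 = 0"
  using scale_add_right[of a 0 0] by simp

lemma act_sum_right: "a \<in> polys_over Kb \<Longrightarrow> act a (\<Sum>i\<in>I. f i) = (\<Sum>i\<in>I. act a (f i))"
  by (induction I rule: infinite_finite_induct) (auto simp: scale_add_right)

lemma act_sum_left:
  "(\<And>i. i \<in> I \<Longrightarrow> f i \<in> polys_over Kb) \<Longrightarrow> act (\<Sum>i\<in>I. f i) x = (\<Sum>i\<in>I. act (f i) x)"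
  by (induction I rule: infinite_finite_induct)
    (auto simp: scale_add_left polys_over_sum[OF is_subfield_K_bar])

lemma act_commute:
  "a \<in> polys_over Kb \<Longrightarrow> b \<in> polys_over Kb \<Longrightarrow> act a (act b x) = act b (act a x)"
  using scale_mult[of a b x] scale_mult[of b a x] by (simp add: mult.commute)

lemma sigma_0 [simp]: "\<sigma> 0 = 0"
  using sigma_add[of 0 0] by simp

lemma sigma_sum: "\<sigma> (\<Sum>i\<in>I. f i) = (\<Sum>i\<in>I. \<sigma> (f i))"
  by (induction I rule: infinite_finite_induct) (auto simp: sigma_add)

lemma sigma_const: "c \<in> Kb \<Longrightarrow> \<sigma> (act [:c:] x) = act [:root c:] (\<sigma> x)"
  using sigma_scale[of "[:c:]" x] PK_closed(6) by (simp add: map_poly_pCons)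

lemma sigma_tt: "\<sigma> (act tt x) = act tt (\<sigma> x)"
  using sigma_scale[of tt x] by (simp add: map_poly_pCons)

lemma sigma_pow_tt: "(\<sigma> ^^ k) (act tt x) = act tt ((\<sigma> ^^ k) x)"
  by (induction k) (auto simp: sigma_tt)

section \<open>Coordinates with respect to the basis over K_bar[\<sigma>]\<close>

definition coords :: "'m \<Rightarrow> 'c poly vec" where
  "coords x = (THE c. sigma_coords F \<theta> act \<sigma> d w x c)"

text \<open>The coefficient c_(i,j) of \<sigma>^i w_j in x, with the indices in the order j,
  i.\<close>

definition cf :: "'m \<Rightarrow> nat \<Rightarrow> nat \<Rightarrow> 'c" where
  "cf x j i = coeff (coords x $ j) i"

lemma sigma_coords_coords: "sigma_coords F \<theta> act \<sigma> d w x (coords x)"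
proof -
  have "\<exists>!c. sigma_coords F \<theta> act \<sigma> d w x c"
    using Ksigma by (simp add: Ksigma_basis_def)
  from theI'[OF this] show ?thesis
    by (simp add: coords_def)
qed

lemma coords_eqI: "sigma_coords F \<theta> act \<sigma> d w x c \<Longrightarrow> coords x = c"
  using Ksigma sigma_coords_coords[of x] unfolding Ksigma_basis_def by blast

lemma cf_Kb [simp]: "j < d \<Longrightarrow> cf x j i \<in> Kb"
  using sigma_coords_coords[of x] by (auto simp: sigma_coords_def cf_def polys_over_def)

text \<open>One strict bound for all components. The \<open>Suc\<close> keeps the index 0 in the
  range \<open>{..<cf_bound x}\<close> even for x = 0, which \<open>cf0_act_tt\<close> and
  \<open>delta1c_close\<close> rely on.\<close>

definition cf_bound :: "'m \<Rightarrow> nat" where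
  "cf_bound x = Suc (\<Sum>j<d. degree (coords x $ j))"

lemma cf_zero: "j < d \<Longrightarrow> i \<ge> cf_bound x \<Longrightarrow> cf x j i = 0"
proof -
  assume "j < d" "i \<ge> cf_bound x"
  moreover have "degree (coords x $ j) \<le> (\<Sum>j<d. degree (coords x $ j))"
    using \<open>j < d\<close> by (intro member_le_sum) auto
  ultimately show ?thesis
    unfolding cf_def cf_bound_def by (intro coeff_eq_0) simp
qed

lemma cf_expand:
  assumes "\<And>j i. j < d \<Longrightarrow> i \<ge> n \<Longrightarrow> cf x j i = 0"
  shows "x = (\<Sum>j<d. \<Sum>i<n. act [:cf x j i:] ((\<sigma> ^^ i) (w j)))"
proof -
  have "x = (\<Sum>j<d. \<Sum>i\<le>degree (coords x $ j). act [:cf x j i:] ((\<sigma> ^^ i) (w j)))"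
    using sigma_coords_coords[of x] by (simp add: sigma_coords_def sigma_combination_def cf_def)
  also have "\<dots> = (\<Sum>j<d. \<Sum>i<n. act [:cf x j i:] ((\<sigma> ^^ i) (w j)))"
    using assms unfolding cf_def
    by (intro sum.cong refl sum_poly_coeff_eq[where g = "\<lambda>i c. act [:c:] ((\<sigma> ^^ i) (w _))"]) auto
  finally show ?thesis .
qed

lemma cf_eqI:
  assumes a: "\<And>j i. j < d \<Longrightarrow> i < n \<Longrightarrow> a j i \<in> Kb"
    and x: "x = (\<Sum>j<d. \<Sum>i<n. act [:a j i:] ((\<sigma> ^^ i) (w j)))" and j: "j < d"
  shows "cf x j i = (if i < n then a j i else 0)"
proof -
  define c where "c = vec d (\<lambda>j. \<Sum>i<n. monom (a j i) i)"
  have coeff: "coeff (c $ j) i = (if i < n then a j i else 0)" if "j < d" for j i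
    using that by (simp add: c_def coeff_sum if_distrib sum.delta cong: if_cong)
  have "(\<Sum>i\<le>degree (c $ j). act [:coeff (c $ j) i:] ((\<sigma> ^^ i) (w j))) = (\<Sum>i<n. act [:a j i:] ((\<sigma> ^^ i) (w j)))"
    if "j < d" for j
  proof -
    have "(\<Sum>i\<le>degree (c $ j). act [:coeff (c $ j) i:] ((\<sigma> ^^ i) (w j))) =
        (\<Sum>i<n. act [:coeff (c $ j) i:] ((\<sigma> ^^ i) (w j)))"
      using coeff[OF that] by (intro sum_poly_coeff_eq[where g = "\<lambda>i c. act [:c:] ((\<sigma> ^^ i) (w j))"]) auto
    then show ?thesis
      using coeff[OF that] by simp
  qed
  then have "sigma_coords F \<theta> act \<sigma> d w x c"
    unfolding sigma_coords_def sigma_combination_def polys_over_def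
    using a x coeff Kb_closed(1) by (auto simp: c_def)
  then have "coords x = c"
    by (rule coords_eqI)
  then show ?thesis
    using coeff[OF j] by (simp add: cf_def)
qed

lemma cf_add:
  assumes j: "j < d"
  shows "cf (x + y) j i = cf x j i + cf y j i"
proof -
  define n where "n = max (Suc i) (max (cf_bound x) (cf_bound y))"
  have "x = (\<Sum>j<d. \<Sum>i<n. act [:cf x j i:] ((\<sigma> ^^ i) (w j)))"
    "y = (\<Sum>j<d. \<Sum>i<n. act [:cf y j i:] ((\<sigma> ^^ i) (w j)))"
    by (intro cf_expand cf_zero; simp add: n_def)+
  then have "x + y = (\<Sum>j<d. \<Sum>i<n. act [:cf x j i:] ((\<sigma> ^^ i) (w j))) + (\<Sum>j<d. \<Sum>i<n. act [:cf y j i:] ((\<sigma> ^^ i) (w j)))"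
    by (rule arg_cong2)
  also have "\<dots> = (\<Sum>j<d. \<Sum>i<n. act [:cf x j i + cf y j i:] ((\<sigma> ^^ i) (w j)))"
    unfolding sum.distrib[symmetric]
  proof (intro sum.cong refl)
    fix j i
    assume "j \<in> {..<d}"
    then show "act [:cf x j i:] ((\<sigma> ^^ i) (w j)) + act [:cf y j i:] ((\<sigma> ^^ i) (w j)) =
        act [:cf x j i + cf y j i:] ((\<sigma> ^^ i) (w j))"
      using scale_add_left[of "[:cf x j i:]" "[:cf y j i:]"] by (simp add: PK_closed(6))
  qed
  finally have "cf (x + y) j i = (if i < n then cf x j i + cf y j i else 0)"
    by (intro cf_eqI j Kb_closed(3)) auto
  then show ?thesis
    by (simp add: n_def)
qed

lemma cf_0 [simp]: "j < d \<Longrightarrow> cf 0 j i = 0"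
  using cf_add[of j 0 0 i] by (simp only: add_0 add_cancel_right_right)

lemma cf_sum: "j < d \<Longrightarrow> cf (\<Sum>k\<in>I. f k) j i = (\<Sum>k\<in>I. cf (f k) j i)"
  by (induction I rule: infinite_finite_induct) (auto simp: cf_add)

lemma cf_const:
  assumes j: "j < d" and c: "c \<in> Kb"
  shows "cf (act [:c:] x) j i = c * cf x j i"
proof -
  define n where "n = max (Suc i) (cf_bound x)"
  have "x = (\<Sum>j<d. \<Sum>i<n. act [:cf x j i:] ((\<sigma> ^^ i) (w j)))"
    by (intro cf_expand cf_zero) (simp_all add: n_def)
  then have "act [:c:] x = act [:c:] (\<Sum>j<d. \<Sum>i<n. act [:cf x j i:] ((\<sigma> ^^ i) (w j)))"
    by (rule arg_cong)
  also have "\<dots> = (\<Sum>j<d. \<Sum>i<n. act [:c * cf x j i:] ((\<sigma> ^^ i) (w j)))"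
    unfolding act_sum_right[OF PK_closed(6)[OF c]]
  proof (intro sum.cong refl)
    fix j i
    assume "j \<in> {..<d}"
    then show "act [:c:] (act [:cf x j i:] ((\<sigma> ^^ i) (w j))) = act [:c * cf x j i:] ((\<sigma> ^^ i) (w j))"
      using scale_mult[of "[:c:]" "[:cf x j i:]"] c by (simp add: PK_closed(6) mult.commute[of c])
  qed
  finally have "cf (act [:c:] x) j i = (if i < n then c * cf x j i else 0)"
    by (intro cf_eqI j Kb_closed(4)) (auto simp: c)
  then show ?thesis
    by (simp add: n_def)
qed

lemma cf_sigma:
  assumes j: "j < d"
  shows "cf (\<sigma> x) j i = (case i of 0 \<Rightarrow> 0 | Suc i' \<Rightarrow> root (cf x j i'))"
proof -
  define n where "n = max i (cf_bound x)"
  define a where "a j i = (case i of 0 \<Rightarrow> 0 | Suc i' \<Rightarrow> root (cf x j i'))" for j i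
  have "x = (\<Sum>j<d. \<Sum>i<n. act [:cf x j i:] ((\<sigma> ^^ i) (w j)))"
    by (intro cf_expand cf_zero) (simp_all add: n_def)
  then have "\<sigma> x = \<sigma> (\<Sum>j<d. \<Sum>i<n. act [:cf x j i:] ((\<sigma> ^^ i) (w j)))"
    by (rule arg_cong)
  also have "\<dots> = (\<Sum>j<d. \<Sum>i<n. act [:a j (Suc i):] ((\<sigma> ^^ Suc i) (w j)))"
    unfolding sigma_sum by (intro sum.cong refl) (simp add: sigma_const a_def)
  also have "\<dots> = (\<Sum>j<d. \<Sum>i<Suc n. act [:a j i:] ((\<sigma> ^^ i) (w j)))"
    unfolding sum.lessThan_Suc_shift by (simp add: a_def)
  finally have "cf (\<sigma> x) j i = (if i < Suc n then a j i else 0)"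
    using j by (intro cf_eqI) (auto simp: a_def Kb_closed(1) twist_m1_K_bar split: nat.split)
  then show ?thesis
    by (simp add: n_def a_def)
qed

lemma cf_w: "j < d \<Longrightarrow> l < d \<Longrightarrow> cf (w l) j i = (if j = l \<and> i = 0 then 1 else 0)"
proof -
  assume jl: "j < d" "l < d"
  have w: "w l = (\<Sum>j<d. \<Sum>i<1. act [:if j = l then 1 else 0:] ((\<sigma> ^^ i) (w j)))"
  proof -
    have "(\<Sum>j<d. \<Sum>i<1. act [:if j = l then 1 else 0:] ((\<sigma> ^^ i) (w j))) = (\<Sum>j<d. if j = l then w j else 0)"
      using scale_one by (intro sum.cong refl) (auto simp: one_pCons[symmetric])
    then show ?thesis
      using jl by (simp add: sum.delta)
  qed
  have "cf (w l) j i = (if i < 1 then (if j = l then 1 else 0) else 0)"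
    by (rule cf_eqI[OF _ w jl(1)]) (auto simp: Kb_closed)
  then show ?thesis
    by auto
qed

section \<open>The maps \<delta>_0 and \<delta>_1\<close>

lemma delta0_index: "j < d \<Longrightarrow> \<delta>\<^sub>0 x $ j = cf x j 0"
  by (simp add: delta0_def cf_def coords_def)

lemma delta0_carrier [simp]: "\<delta>\<^sub>0 x \<in> carrier_vec d"
  by (simp add: delta0_def Let_def)

text \<open>The \<open>j\<close>-th component of \<open>\<delta>\<^sub>1\<close> of \<open>c \<otimes> x\<close> in the scalar extension of the motive to \<open>\<complex>\<^sub>\<infinity>\<close>.\<close>
definition delta1c :: "'c \<Rightarrow> 'm \<Rightarrow> nat \<Rightarrow> 'c" where
  "delta1c c x j = (\<Sum>i<cf_bound x. (c * cf x j i) ^ (q ^ i))"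

lemma delta1c_eq:
  assumes "j < d" "\<And>i. i \<ge> n \<Longrightarrow> cf x j i = 0"
  shows "delta1c c x j = (\<Sum>i<n. (c * cf x j i) ^ (q ^ i))"
  unfolding delta1c_def
  by (rule sum.mono_neutral_cong) (use assms cf_zero[OF assms(1), of x] in \<open>auto simp: not_less\<close>)

lemma delta1_index: "j < d \<Longrightarrow> \<delta>\<^sub>1 x $ j = delta1c 1 x j"
proof -
  assume j: "j < d"
  have "(\<Sum>i\<le>degree (coords x $ j). coeff (coords x $ j) i ^ (q ^ i)) = (\<Sum>i<cf_bound x. coeff (coords x $ j) i ^ (q ^ i))"
    using cf_zero[OF j, of x] unfolding cf_def
    by (intro sum_poly_coeff_eq[where g = "\<lambda>i c. c ^ (q ^ i)"]) auto
  then show ?thesis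
    using j by (simp add: delta1_def delta1c_def cf_def coords_def Let_def)
qed

lemma delta1_carrier [simp]: "\<delta>\<^sub>1 x \<in> carrier_vec d"
  by (simp add: delta1_def Let_def)

lemma delta1c_add_left: "delta1c (a + b) x j = delta1c a x j + delta1c b x j"
  by (simp add: delta1c_def distrib_right frob_add sum.distrib)

lemma delta1c_0_left [simp]: "delta1c 0 x j = 0"
  by (simp add: delta1c_def)

lemma delta1c_sum_left: "delta1c (\<Sum>k\<in>I. f k) x j = (\<Sum>k\<in>I. delta1c (f k) x j)"
  by (induction I rule: infinite_finite_induct) (auto simp: delta1c_add_left)

lemma delta1c_diff_left: "delta1c (a - b) x j = delta1c a x j - delta1c b x j"
  using delta1c_add_left[of "a - b" b x j] by simp

lemma delta1c_add_right:
  assumes j: "j < d"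
  shows "delta1c c (x + y) j = delta1c c x j + delta1c c y j"
proof -
  define n where "n = max (cf_bound x) (cf_bound y)"
  have "cf x j i = 0" "cf y j i = 0" if "i \<ge> n" for i
    using that j by (auto intro!: cf_zero simp: n_def)
  then show ?thesis
    using j by (simp add: delta1c_eq[where n = n] cf_add distrib_left frob_add sum.distrib)
qed

lemma delta1c_0_right [simp]: "j < d \<Longrightarrow> delta1c c 0 j = 0"
  by (simp add: delta1c_def)

lemma delta1c_sum_right: "j < d \<Longrightarrow> delta1c c (\<Sum>k\<in>I. f k) j = (\<Sum>k\<in>I. delta1c c (f k) j)"
  by (induction I rule: infinite_finite_induct) (auto simp: delta1c_add_right)

text \<open>Scalars from K_bar can be moved between both arguments; with additivity on either side
  this makes \<open>delta1c\<close> well defined on the scalar extension.\<close>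

lemma delta1c_const:
  assumes "j < d" "a \<in> Kb"
  shows "delta1c c (act [:a:] x) j = delta1c (c * a) x j"
  using assms cf_zero[OF assms(1), of x]
  by (simp add: delta1c_eq[where n = "cf_bound x"] cf_const mult.assoc)

text \<open>This is why \<sigma> b - b is killed: if c^q = b, then c times \<sigma> x and b times x
  have the same image.\<close>

lemma delta1c_sigma:
  assumes j: "j < d"
  shows "delta1c c (\<sigma> x) j = delta1c (c ^ q) x j"
proof -
  have "delta1c c (\<sigma> x) j = (\<Sum>i<Suc (cf_bound x). (c * cf (\<sigma> x) j i) ^ (q ^ i))"
    using cf_zero[OF j, of x] by (intro delta1c_eq j) (auto simp: cf_sigma[OF j] split: nat.split)
  also have "\<dots> = (\<Sum>i<cf_bound x. (c * root (cf x j i)) ^ (q ^ Suc i))"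
    unfolding sum.lessThan_Suc_shift by (simp add: cf_sigma[OF j])
  also have "\<dots> = delta1c (c ^ q) x j"
    unfolding delta1c_def by (intro sum.cong refl) (simp add: power_mult power_mult_distrib)
  finally show ?thesis .
qed

lemma delta1c_sigma_pow: "j < d \<Longrightarrow> delta1c c ((\<sigma> ^^ k) x) j = delta1c (c ^ (q ^ k)) x j"
  by (induction k arbitrary: c) (simp_all add: delta1c_sigma power_mult)

lemma delta1c_w: "j < d \<Longrightarrow> l < d \<Longrightarrow> delta1c c (w l) j = (if j = l then c else 0)"
  by (subst delta1c_eq[where n = 1]) (auto simp: cf_w)

end

section \<open>The t-module in coordinates\<close>

locale t_module_of_motive = motive_with_bases q F \<theta> act \<sigma> r d m w
  for q :: nat and F :: "'c::{nonarch_valued_field, complete_space} set" and \<theta> :: 'c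
    and act :: "'c poly \<Rightarrow> 'm::ab_group_add \<Rightarrow> 'm" and \<sigma> :: "'m \<Rightarrow> 'm"
    and r d :: nat and m w :: "nat \<Rightarrow> 'm" +
  fixes A :: "nat \<Rightarrow> 'c mat"
  assumes A_carrier: "\<And>k. A k \<in> carrier_mat d d"
    and A_finite: "finite {k. A k \<noteq> 0\<^sub>m d d}"
    and A_delta1: "\<And>x. tau_poly_apply q d A (\<delta>\<^sub>1 x) = \<delta>\<^sub>1 (act tt x)"
begin

lemma A_index_0: "i < d \<Longrightarrow> j < d \<Longrightarrow> A k = 0\<^sub>m d d \<Longrightarrow> A k $$ (i, j) = 0"
  by simp

lemma tau_poly_apply_index:
  assumes M: "\<And>k. k \<ge> M \<Longrightarrow> A k = 0\<^sub>m d d" and z: "z \<in> carrier_vec d" and l: "l < d"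
  shows "tau_poly_apply q d A z $ l = (\<Sum>k<M. \<Sum>j<d. A k $$ (l, j) * (z $ j) ^ (q ^ k))"
proof -
  have eq: "(A k *\<^sub>v map_vec (twist q (int k)) z) $ l = (\<Sum>j<d. A k $$ (l, j) * (z $ j) ^ (q ^ k))" for k
    using z l A_carrier[of k] by (simp add: index_mat_vec[of _ d])
  have "(\<Sum>k | A k \<noteq> 0\<^sub>m d d. (A k *\<^sub>v map_vec (twist q (int k)) z) $ l) =
      (\<Sum>k<M. \<Sum>j<d. A k $$ (l, j) * (z $ j) ^ (q ^ k))"
    unfolding eq
  proof (rule sum.mono_neutral_left)
    show "{k. A k \<noteq> 0\<^sub>m d d} \<subseteq> {..<M}"
      using M not_less by blast
    show "\<forall>k\<in>{..<M} - {k. A k \<noteq> 0\<^sub>m d d}. (\<Sum>j<d. A k $$ (l, j) * (z $ j) ^ (q ^ k)) = 0"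
      using l by (auto simp: A_index_0)
  qed simp
  then show ?thesis
    using l by (simp add: tau_poly_apply_def)
qed

lemma A_bounded: "\<exists>M. \<forall>k\<ge>M. A k = 0\<^sub>m d d"
proof -
  obtain M where "\<And>k. k \<in> {k. A k \<noteq> 0\<^sub>m d d} \<Longrightarrow> k < M"
    using finite_nat_set_iff_bounded A_finite by auto
  then have "\<forall>k\<ge>M. A k = 0\<^sub>m d d"
    by (metis linorder_not_less mem_Collect_eq)
  then show ?thesis
    by blast
qed

text \<open>
  Both sides are the coefficient of \<open>c\<^bsup>q^k\<^esup>\<close> in \<open>\<delta>\<^sub>1(t c w\<^sub>j)\<close>, a polynomial function of \<open>c\<close> on the
  infinite field \<open>Kb\<close>.
\<close>
lemma A_eq_cf:
  assumes l: "l < d" and j: "j < d"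
  shows "A k $$ (l, j) = cf (act tt (w j)) l k ^ (q ^ k)"
proof -
  obtain M0 where M0: "\<And>k. k \<ge> M0 \<Longrightarrow> A k = 0\<^sub>m d d"
    using A_bounded by blast
  define M where "M = max (Suc k) (max M0 (cf_bound (act tt (w j))))"
  have M: "\<And>k. k \<ge> M \<Longrightarrow> A k = 0\<^sub>m d d" "\<And>i. i \<ge> M \<Longrightarrow> cf (act tt (w j)) l i = 0"
    using M0 cf_zero[OF l] by (auto simp: M_def)
  define u where "u k = A k $$ (l, j) - cf (act tt (w j)) l k ^ (q ^ k)" for k
  define P where "P = (\<Sum>k<M. monom (u k) (q ^ k))"
  have "poly P c = 0" if c: "c \<in> Kb" for c
  proof -
    have 1: "\<delta>\<^sub>1 (act [:c:] (w j)) $ j' = (if j' = j then c else 0)" if "j' < d" for j'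
      using that j c by (simp add: delta1_index delta1c_const delta1c_w)
    have "tau_poly_apply q d A (\<delta>\<^sub>1 (act [:c:] (w j))) $ l =
        (\<Sum>k<M. \<Sum>j'<d. A k $$ (l, j') * (\<delta>\<^sub>1 (act [:c:] (w j)) $ j') ^ (q ^ k))"
      by (intro tau_poly_apply_index M l) auto
    also have "\<dots> = (\<Sum>k<M. \<Sum>j'<d. if j' = j then A k $$ (l, j) * c ^ (q ^ k) else 0)"
      by (intro sum.cong refl) (auto simp: 1)
    also have "\<dots> = (\<Sum>k<M. A k $$ (l, j) * c ^ (q ^ k))"
      using j by (simp add: sum.delta)
    finally have "(\<Sum>k<M. A k $$ (l, j) * c ^ (q ^ k)) = \<delta>\<^sub>1 (act tt (act [:c:] (w j))) $ l"
      by (simp add: A_delta1)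
    also have "act tt (act [:c:] (w j)) = act [:c:] (act tt (w j))"
      by (intro act_commute PK_closed(6) c tt_PK)
    also have "\<delta>\<^sub>1 (act [:c:] (act tt (w j))) $ l = delta1c c (act tt (w j)) l"
      using l c by (simp add: delta1_index delta1c_const)
    also have "\<dots> = (\<Sum>k<M. cf (act tt (w j)) l k ^ (q ^ k) * c ^ (q ^ k))"
      using l M(2) by (subst delta1c_eq[where n = M]) (auto simp: power_mult_distrib mult.commute)
    finally show ?thesis
      by (simp add: P_def poly_sum poly_monom u_def left_diff_distrib sum_subtractf)
  qed
  then have "Kb \<subseteq> {c. poly P c = 0}"
    by blast
  then have "P = 0"
    using infinite_K_bar poly_roots_finite[of P] finite_subset by blast
  \<comment> \<open>The exponents q^i are pairwise distinct because q \<ge> 2, so each coefficient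
    of \<open>P\<close> is a single \<open>u i\<close>.\<close>
  have "coeff P (q ^ k) = (\<Sum>i<M. if i = k then u i else 0)"
    unfolding P_def coeff_sum using q_ge_2 by (intro sum.cong refl) (auto simp: power_inject_exp)
  then have "coeff P (q ^ k) = u k"
    by (simp add: sum.delta M_def)
  then show ?thesis
    using \<open>P = 0\<close> by (simp add: u_def)
qed

lemma act_tt_expand:
  assumes "\<And>j i. j < d \<Longrightarrow> i \<ge> n \<Longrightarrow> cf x j i = 0"
  shows "act tt x = (\<Sum>j<d. \<Sum>i<n. act [:cf x j i:] ((\<sigma> ^^ i) (act tt (w j))))"
proof -
  have "act tt x = act tt (\<Sum>j<d. \<Sum>i<n. act [:cf x j i:] ((\<sigma> ^^ i) (w j)))"
    using cf_expand[OF assms] by (rule arg_cong)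
  also have "\<dots> = (\<Sum>j<d. \<Sum>i<n. act [:cf x j i:] ((\<sigma> ^^ i) (act tt (w j))))"
    unfolding act_sum_right[OF tt_PK]
    by (intro sum.cong refl) (simp add: sigma_pow_tt act_commute[of tt] PK_closed(6))
  finally show ?thesis .
qed

text \<open>The defining property of E' concerns elements of the motive, that is, c in K_bar. It
  extends to all scalars c because \<open>A_eq_cf\<close> gives the coefficients of E'_\<theta>
  explicitly: both sides become the same additive polynomial in c.\<close>

lemma E_delta1c:
  assumes l: "l < d"
  shows "tau_poly_apply q d A (vec d (delta1c c x)) $ l = delta1c c (act tt x) l"
proof -
  obtain M0 where M0: "\<And>k. k \<ge> M0 \<Longrightarrow> A k = 0\<^sub>m d d"
    using A_bounded by blast
  define M where "M = max M0 (\<Sum>j<d. cf_bound (act tt (w j)))"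
  have M: "cf (act tt (w j)) l i = 0" if "i \<ge> M" "j < d" for i j
  proof -
    have "cf_bound (act tt (w j)) \<le> (\<Sum>j<d. cf_bound (act tt (w j)))"
      using \<open>j < d\<close> by (intro member_le_sum) auto
    then show ?thesis
      using cf_zero[OF l] that by (simp add: M_def)
  qed
  have "delta1c c (act tt x) l =
      (\<Sum>j<d. \<Sum>i<cf_bound x. delta1c c (act [:cf x j i:] ((\<sigma> ^^ i) (act tt (w j)))) l)"
    by (subst act_tt_expand[where n = "cf_bound x"]) (simp_all add: cf_zero delta1c_sum_right l)
  also have "\<dots> = (\<Sum>j<d. \<Sum>i<cf_bound x. delta1c ((c * cf x j i) ^ (q ^ i)) (act tt (w j)) l)"
    by (intro sum.cong refl) (simp add: delta1c_const delta1c_sigma_pow l)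
  also have "\<dots> = (\<Sum>j<d. delta1c (delta1c c x j) (act tt (w j)) l)"
    by (simp add: delta1c_sum_left[symmetric] delta1c_def[of c x])
  also have "\<dots> = (\<Sum>j<d. \<Sum>k<M. A k $$ (l, j) * delta1c c x j ^ (q ^ k))"
    using l M by (intro sum.cong refl) (auto simp: delta1c_eq[where n = M] A_eq_cf power_mult_distrib mult.commute)
  also have "\<dots> = (\<Sum>k<M. \<Sum>j<d. A k $$ (l, j) * delta1c c x j ^ (q ^ k))"
    by (rule sum.swap)
  also have "\<dots> = tau_poly_apply q d A (vec d (delta1c c x)) $ l"
    using l M0 by (subst tau_poly_apply_index[where M = M]) (auto simp: M_def)
  finally show ?thesis
    by simp
qed

text \<open>Since t commutes with \<sigma>, the terms with i > 0 remain in the image of \<sigma> and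
  do not contribute. Thus d[\<theta>] is the matrix of t on the quotient of the motive by that
  image.\<close>

lemma cf0_act_tt:
  assumes l: "l < d"
  shows "cf (act tt x) l 0 = (\<Sum>j<d. A 0 $$ (l, j) * cf x j 0)"
proof -
  have "cf (act tt x) l 0 = (\<Sum>j<d. \<Sum>i<cf_bound x. cf (act [:cf x j i:] ((\<sigma> ^^ i) (act tt (w j)))) l 0)"
    by (subst act_tt_expand[where n = "cf_bound x"]) (simp_all add: cf_zero cf_sum l)
  also have "\<dots> = (\<Sum>j<d. \<Sum>i<cf_bound x. if i = 0 then cf x j 0 * cf (act tt (w j)) l 0 else 0)"
  proof (intro sum.cong refl)
    fix j i
    assume "j \<in> {..<d}"
    then show "cf (act [:cf x j i:] ((\<sigma> ^^ i) (act tt (w j)))) l 0 =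
        (if i = 0 then cf x j 0 * cf (act tt (w j)) l 0 else 0)"
      using l by (cases i) (auto simp: cf_const cf_sigma)
  qed
  also have "\<dots> = (\<Sum>j<d. A 0 $$ (l, j) * cf x j 0)"
    using l by (intro sum.cong refl) (auto simp: sum.delta A_eq_cf cf_bound_def)
  finally show ?thesis .
qed

lemma delta0_act_tt: "\<delta>\<^sub>0 (act tt x) = A 0 *\<^sub>v \<delta>\<^sub>0 x"
proof (rule eq_vecI)
  fix i
  assume "i < dim_vec (A 0 *\<^sub>v \<delta>\<^sub>0 x)"
  then have "i < d"
    using A_carrier[of 0] by simp
  then show "\<delta>\<^sub>0 (act tt x) $ i = (A 0 *\<^sub>v \<delta>\<^sub>0 x) $ i"
    using A_carrier[of 0] by (simp add: index_mat_vec[of _ d] delta0_index cf0_act_tt)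
qed (use A_carrier[of 0] in \<open>simp add: delta0_def Let_def\<close>)

text \<open>The k-th power of d[\<theta>] - \<theta> is the matrix of (t - \<theta>)^k on the
  quotient by the image of \<sigma>, in the basis w, applied to a vector over C_\<infinity>.
  Nilpotency can then be read off from effectivity.\<close>

lemma nilpotent_index:
  assumes v: "v \<in> carrier_vec d"
  shows "((\<lambda>v. A 0 *\<^sub>v v - \<theta> \<cdot>\<^sub>v v) ^^ k) v \<in> carrier_vec d \<and>
    (\<forall>i<d. ((\<lambda>v. A 0 *\<^sub>v v - \<theta> \<cdot>\<^sub>v v) ^^ k) v $ i = (\<Sum>j<d. v $ j * cf (act ([:- \<theta>, 1:] ^ k) (w j)) i 0))"
proof (induction k)
  case 0
  have "(\<Sum>j<d. v $ j * cf (w j) i 0) = (\<Sum>j<d. if j = i then v $ j else 0)" if "i < d" for i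
    using that by (intro sum.cong refl) (auto simp: cf_w)
  then show ?case
    using v by (auto simp: scale_one sum.delta)
next
  case (Suc k)
  let ?p = "[:- \<theta>, 1:]"
  let ?y = "\<lambda>j. act (?p ^ k) (w j)"
  define u where "u = ((\<lambda>v. A 0 *\<^sub>v v - \<theta> \<cdot>\<^sub>v v) ^^ k) v"
  have u: "u \<in> carrier_vec d" "\<And>i. i < d \<Longrightarrow> u $ i = (\<Sum>j<d. v $ j * cf (?y j) i 0)"
    using Suc by (auto simp: u_def)
  have "(A 0 *\<^sub>v u - \<theta> \<cdot>\<^sub>v u) $ i = (\<Sum>j<d. v $ j * cf (act (?p ^ Suc k) (w j)) i 0)" if i: "i < d" for i
  proof -
    have y: "cf (act (?p ^ Suc k) (w j)) i 0 = (\<Sum>l<d. A 0 $$ (i, l) * cf (?y j) l 0) - \<theta> * cf (?y j) i 0" for j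
    proof -
      have "act (?p ^ Suc k) (w j) = act ?p (?y j)"
        using scale_mult[of ?p "?p ^ k" "w j"] by (simp add: polys_over_power[OF is_subfield_K_bar])
      also have "\<dots> = act tt (?y j) + act [:- \<theta>:] (?y j)"
        using scale_add_left[of tt "[:- \<theta>:]"] by (simp add: PK_closed(6) Kb_closed(5) theta_K_bar)
      finally show ?thesis
        using i by (simp add: cf_add cf0_act_tt cf_const Kb_closed(5) theta_K_bar)
    qed
    have "(A 0 *\<^sub>v u - \<theta> \<cdot>\<^sub>v u) $ i = (\<Sum>l<d. A 0 $$ (i, l) * u $ l) - \<theta> * u $ i"
      using i u(1) A_carrier[of 0] by (simp add: index_mat_vec[of _ d])
    also have "\<dots> = (\<Sum>l<d. \<Sum>j<d. A 0 $$ (i, l) * (v $ j * cf (?y j) l 0)) - (\<Sum>j<d. \<theta> * (v $ j * cf (?y j) i 0))"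
      using i by (simp add: u(2) sum_distrib_left)
    also have "(\<Sum>l<d. \<Sum>j<d. A 0 $$ (i, l) * (v $ j * cf (?y j) l 0)) =
        (\<Sum>j<d. \<Sum>l<d. A 0 $$ (i, l) * (v $ j * cf (?y j) l 0))"
      by (rule sum.swap)
    finally show ?thesis
      unfolding y by (simp add: right_diff_distrib sum_subtractf sum_distrib_left mult.left_commute)
  qed
  then show ?case
    using u(1) A_carrier[of 0] by (simp flip: u_def)
qed

lemma delta0_sigma: "\<delta>\<^sub>0 (\<sigma> x) = 0\<^sub>v d"
  by (intro eq_vecI) (auto simp: delta0_index cf_sigma carrier_vecD[OF delta0_carrier])

lemma nilpotent_ex:
  "\<exists>s>0. (\<forall>v\<in>carrier_vec d. ((\<lambda>v. A 0 *\<^sub>v v - \<theta> \<cdot>\<^sub>v v) ^^ s) v = 0\<^sub>v d) \<and>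
     (\<forall>x. \<delta>\<^sub>0 (act ([:- \<theta>, 1:] ^ s) x) = 0\<^sub>v d)"
proof -
  obtain l0 where l0: "\<And>l x. l \<ge> l0 \<Longrightarrow> \<exists>y. act ([:- \<theta>, 1:] ^ l) x = \<sigma> y"
    using effective by blast
  \<comment> \<open>The successor makes \<open>s\<close> positive, as required for the adapted
    norm.\<close>
  obtain s where s: "s > 0" "s \<ge> l0"
    by (rule that[of "Suc l0"]) auto
  have 1: "\<delta>\<^sub>0 (act ([:- \<theta>, 1:] ^ s) x) = 0\<^sub>v d" for x
    using l0[of s x] s(2) delta0_sigma by auto
  then have "cf (act ([:- \<theta>, 1:] ^ s) (w j)) i 0 = 0" if "i < d" for i j
    using that delta0_index[OF that, of "act ([:- \<theta>, 1:] ^ s) (w j)"] by simp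
  then have "((\<lambda>v. A 0 *\<^sub>v v - \<theta> \<cdot>\<^sub>v v) ^^ s) v = 0\<^sub>v d" if "v \<in> carrier_vec d" for v
    using nilpotent_index[OF that, of s] by (intro eq_vecI) auto
  then show ?thesis
    using 1 s(1) by blast
qed

end

section \<open>The last row of \<open>\<Upsilon>\<close>\<close>

lemma fps_to_fls_sum: "fps_to_fls (\<Sum>k\<in>I. f k) = (\<Sum>k\<in>I. fps_to_fls (f k :: 'c::field fps))"
  by (induction I rule: infinite_finite_induct) simp_all

lemma index_mat_mult:
  assumes "A \<in> carrier_mat n k" "B \<in> carrier_mat k l" "i < n" "j < l"
  shows "(A * B) $$ (i, j) = (\<Sum>a<k. A $$ (i, a) * B $$ (a, j))"
  using assms by (auto simp: index_mult_mat scalar_prod_def lessThan_atLeast0 intro!: sum.cong)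

text \<open>Over a field A/c would be the inverse of B. Over a domain the adjugate of B takes the
  place of the inverse, and det B, nonzero since det A det B = c^n, is cancelled entrywise at the
  end.\<close>

lemma mat_mult_scalar_commute:
  fixes A B :: "'a::idom mat"
  assumes A: "A \<in> carrier_mat n n" and B: "B \<in> carrier_mat n n"
    and AB: "A * B = c \<cdot>\<^sub>m 1\<^sub>m n" and c: "c \<noteq> 0"
  shows "B * A = c \<cdot>\<^sub>m 1\<^sub>m n"
proof -
  have "det A * det B = c ^ n"
    using det_mult[OF A B] by (simp add: AB)
  then have dB: "det B \<noteq> 0"
    using c by auto
  note adj = adj_mat[OF B]
  have "det B \<cdot>\<^sub>m (B * A) = (B * A) * (B * adj_mat B)"
    using mult_smult_distrib[OF mult_carrier_mat[OF B A] one_carrier_mat, of "det B"] A B by (simp add: adj)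
  also have "\<dots> = B * ((A * B) * adj_mat B)"
    using A B adj(1) by (simp add: assoc_mult_mat[of _ n n _ n _ n])
  also have "\<dots> = B * (c \<cdot>\<^sub>m adj_mat B)"
    using adj(1) by (simp add: AB mult_smult_assoc_mat[of _ n n])
  also have "\<dots> = det B \<cdot>\<^sub>m (c \<cdot>\<^sub>m 1\<^sub>m n)"
    using B adj by (simp add: mult_smult_distrib[of _ n n]) (auto intro!: eq_matI)
  finally have eq: "det B \<cdot>\<^sub>m (B * A) = det B \<cdot>\<^sub>m (c \<cdot>\<^sub>m 1\<^sub>m n)" .
  show ?thesis
  proof (rule eq_matI)
    fix i j
    assume ij: "i < dim_row (c \<cdot>\<^sub>m 1\<^sub>m n)" "j < dim_col (c \<cdot>\<^sub>m 1\<^sub>m n)"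
    have "(det B \<cdot>\<^sub>m (B * A)) $$ (i, j) = (det B \<cdot>\<^sub>m (c \<cdot>\<^sub>m 1\<^sub>m n)) $$ (i, j)"
      by (simp only: eq)
    then show "(B * A) $$ (i, j) = (c \<cdot>\<^sub>m 1\<^sub>m n) $$ (i, j)"
      using ij A B dB by simp
  qed (use A B in auto)
qed

section \<open>Twisted matrices and the equation of the row\<close>

context C_infinity
begin

lemma nth_twist_fls: "fls_nth (twist_fls q (- 1) g) n = twist q (- 1) (fls_nth g n :: 'c)"
  unfolding twist_fls_def
  by (rule nth_Abs_fls_ex_lower_bound) (intro exI[of _ "fls_subdegree g"], simp)

lemma subdegree_twist_fls: "fls_subdegree (twist_fls q (- 1) g) = fls_subdegree (g :: 'c fls)"
proof (cases "g = 0")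
  case True
  then have "twist_fls q (- 1) g = 0"
    by (intro fls_eqI) (simp add: nth_twist_fls)
  then show ?thesis
    using True by simp
next
  case False
  then show ?thesis
    by (intro fls_subdegree_eqI) (auto simp: nth_twist_fls)
qed

lemma semiring_hom_twist_fls: "semiring_hom (twist_fls q (- 1) :: 'c fls \<Rightarrow> 'c fls)"
proof
  fix x y :: "'c fls"
  show "twist_fls q (- 1) (x + y) = twist_fls q (- 1) x + twist_fls q (- 1) y"
    by (intro fls_eqI) (simp add: nth_twist_fls twist_m1_add)
  show "twist_fls q (- 1) (x * y) = twist_fls q (- 1) x * twist_fls q (- 1) y"
    by (intro fls_eqI)
      (simp add: nth_twist_fls fls_times_nth(2) subdegree_twist_fls twist_m1_sum twist_m1_mult)
  show "twist_fls q (- 1) (0 :: 'c fls) = 0"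
    by (intro fls_eqI) (simp add: nth_twist_fls)
  show "twist_fls q (- 1) (1 :: 'c fls) = 1"
    by (intro fls_eqI) (simp add: nth_twist_fls)
qed

definition fps_root :: "'c fps \<Rightarrow> 'c fps" where
  "fps_root g = Abs_fps (\<lambda>n. twist q (- 1) (fps_nth g n))"

lemma fps_root_nth [simp]: "fps_nth (fps_root g) n = twist q (- 1) (fps_nth g n)"
  by (simp add: fps_root_def)

lemma twist_fps_to_fls: "twist_fls q (- 1) (fps_to_fls g) = fps_to_fls (fps_root g)"
  by (intro fls_eqI) (simp add: nth_twist_fls)

text \<open>Twisting \<open>\<Psi> * \<Upsilon> = 1\<close> and inserting \<open>eq\<close> shows
  that \<open>\<Psi> * ?T\<close> is a right inverse of \<open>P\<close>. For square matrices it is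
  also a left inverse, and multiplication by \<Upsilon> from the left removes \<Psi>.\<close>

lemma twist_inverse_matrix:
  fixes \<Psi> \<Upsilon> P :: "'c fls mat"
  assumes \<Psi>: "\<Psi> \<in> carrier_mat n n" and \<Upsilon>: "\<Upsilon> \<in> carrier_mat n n" and P: "P \<in> carrier_mat n n"
    and inv: "inverts_mat \<Psi> \<Upsilon>" "inverts_mat \<Upsilon> \<Psi>"
    and eq: "map_mat (twist_fls q (- 1)) \<Psi> = P * \<Psi>"
  shows "map_mat (twist_fls q (- 1)) \<Upsilon> * P = \<Upsilon>"
proof -
  interpret semiring_hom "twist_fls q (- 1) :: 'c fls \<Rightarrow> 'c fls"
    by (rule semiring_hom_twist_fls)
  let ?T = "map_mat (twist_fls q (- 1)) \<Upsilon>"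
  have T: "?T \<in> carrier_mat n n"
    using \<Upsilon> by simp
  have PsiUps: "\<Psi> * \<Upsilon> = 1\<^sub>m n" "\<Upsilon> * \<Psi> = 1\<^sub>m n"
    using inv \<Psi> \<Upsilon> by (simp_all add: inverts_mat_def)
  have "P * (\<Psi> * ?T) = (P * \<Psi>) * ?T"
    using P \<Psi> T by (simp add: assoc_mult_mat[of _ n n _ n _ n])
  also have "\<dots> = map_mat (twist_fls q (- 1)) (\<Psi> * \<Upsilon>)"
    unfolding eq[symmetric] by (rule mat_hom_mult[OF \<Psi> \<Upsilon>, symmetric])
  also have "\<dots> = 1\<^sub>m n"
    by (simp add: PsiUps mat_hom_one)
  finally have "(\<Psi> * ?T) * P = 1\<^sub>m n"
    using P \<Psi> T by (intro mat_mult_left_right_inverse[of P n]) auto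
  then have "\<Upsilon> * ((\<Psi> * ?T) * P) = \<Upsilon>"
    using \<Upsilon> by simp
  moreover have "\<Upsilon> * ((\<Psi> * ?T) * P) = (\<Upsilon> * \<Psi>) * (?T * P)"
    using P \<Psi> T \<Upsilon> by (simp add: assoc_mult_mat[of _ n n _ n _ n])
  ultimately show ?thesis
    using P T by (simp add: PsiUps)
qed

text \<open>This is the bottom row of the equation for \<Upsilon>, without its last column; the
  entry 1 in the corner of \<Upsilon> produces the summand f.\<close>

lemma row_equation:
  fixes \<Phi>' f :: "'c poly mat" and \<Psi> \<Upsilon> :: "'c fls mat" and \<Upsilon>' \<Upsilon>\<^sub>r :: "'c fps mat"
  assumes \<Phi>': "\<Phi>' \<in> carrier_mat r r" and f: "f \<in> carrier_mat 1 r"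
    and \<Phi>: "\<Phi> = four_block_mat \<Phi>' (0\<^sub>m r 1) f (1\<^sub>m 1)"
    and \<Psi>: "\<Psi> \<in> carrier_mat (r + 1) (r + 1)"
    and eq: "map_mat (twist_fls q (- 1)) \<Psi> = map_mat poly_to_fls \<Phi> * \<Psi>"
    and \<Upsilon>: "\<Upsilon> \<in> carrier_mat (r + 1) (r + 1)" "inverts_mat \<Psi> \<Upsilon>" "inverts_mat \<Upsilon> \<Psi>"
    and \<Upsilon>': "\<Upsilon>' \<in> carrier_mat r r" and \<Upsilon>r: "\<Upsilon>\<^sub>r \<in> carrier_mat 1 r"
    and \<Upsilon>_block: "\<Upsilon> = four_block_mat (map_mat fps_to_fls \<Upsilon>') (0\<^sub>m r 1) (map_mat fps_to_fls \<Upsilon>\<^sub>r) (1\<^sub>m 1)"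
    and j: "j < r"
  shows "\<Upsilon>\<^sub>r $$ (0, j) =
    (\<Sum>k<r. fps_root (\<Upsilon>\<^sub>r $$ (0, k)) * fps_of_poly (\<Phi>' $$ (k, j))) + fps_of_poly (f $$ (0, j))"
proof -
  interpret semiring_hom "twist_fls q (- 1) :: 'c fls \<Rightarrow> 'c fls"
    by (rule semiring_hom_twist_fls)
  let ?P = "map_mat poly_to_fls \<Phi>" and ?T = "map_mat (twist_fls q (- 1)) \<Upsilon>"
  have P: "?P \<in> carrier_mat (r + 1) (r + 1)"
    using \<Phi>' f by (auto simp: \<Phi> intro!: four_block_carrier_mat)
  have T: "?T \<in> carrier_mat (r + 1) (r + 1)"
    using \<Upsilon>(1) by simp
  have "?T * ?P = \<Upsilon>"
    by (rule twist_inverse_matrix[OF \<Psi> \<Upsilon>(1) P \<Upsilon>(2,3) eq])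
  then have "\<Upsilon> $$ (r, j) = (\<Sum>k<r + 1. ?T $$ (r, k) * ?P $$ (k, j))"
    using index_mat_mult[OF T P, of r j] j by simp
  also have "\<dots> = (\<Sum>k<r. ?T $$ (r, k) * ?P $$ (k, j)) + ?T $$ (r, r) * ?P $$ (r, j)"
    by simp
  also have "?T $$ (r, r) * ?P $$ (r, j) = fps_to_fls (fps_of_poly (f $$ (0, j)))"
    using j \<Phi>' f \<Upsilon>' \<Upsilon>r by (simp add: \<Phi> \<Upsilon>_block)
  also have "(\<Sum>k<r. ?T $$ (r, k) * ?P $$ (k, j)) =
      (\<Sum>k<r. fps_to_fls (fps_root (\<Upsilon>\<^sub>r $$ (0, k)) * fps_of_poly (\<Phi>' $$ (k, j))))"
    using j \<Phi>' f \<Upsilon>' \<Upsilon>r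
    by (intro sum.cong refl) (simp add: \<Phi> \<Upsilon>_block twist_fps_to_fls fls_times_fps_to_fls)
  also have "\<Upsilon> $$ (r, j) = fps_to_fls (\<Upsilon>\<^sub>r $$ (0, j))"
    using j \<Upsilon>' \<Upsilon>r by (simp add: \<Upsilon>_block)
  finally have "fps_to_fls (\<Upsilon>\<^sub>r $$ (0, j)) = fps_to_fls ((\<Sum>k<r. fps_root (\<Upsilon>\<^sub>r $$ (0, k)) * fps_of_poly (\<Phi>' $$ (k, j)))
      + fps_of_poly (f $$ (0, j)))"
    by (simp add: fps_to_fls_sum)
  then show ?thesis
    by (simp only: fps_to_fls_eq_iff)
qed

text \<open>Coefficients that are O(q^-n), not o(q^-n): those of 1/(t - \<theta>) have absolute
  value exactly q^(-n-1), so this series belongs here but not to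
  \<open>Tate (real q)\<close>.\<close>

definition fps_bounded :: "'c fps \<Rightarrow> bool" where
  "fps_bounded y \<longleftrightarrow> (\<exists>C\<ge>0. \<forall>n. vabs (fps_nth y n) * real q ^ n \<le> C)"

lemma q_pos [simp]: "0 < q"
  using q_ge_2 by simp

lemma vabs_sum_mult_le:
  fixes f :: "'b \<Rightarrow> 'c"
  assumes "\<And>i. i \<in> I \<Longrightarrow> vabs (f i) * real q ^ n \<le> B" "0 \<le> B"
  shows "vabs (\<Sum>i\<in>I. f i) * real q ^ n \<le> B"
proof -
  have "vabs (\<Sum>i\<in>I. f i) \<le> B / real q ^ n"
    using assms by (intro vabs_sum_le) (auto simp: pos_le_divide_eq)
  then show ?thesis
    by (simp add: pos_le_divide_eq)
qed

lemma fps_mult_bound: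
  fixes x y :: "'c fps"
  assumes "B \<ge> 0" "C \<ge> 0" "\<And>k. k \<le> n \<Longrightarrow> vabs (fps_nth x k) * real q ^ k \<le> B"
    "\<And>k. vabs (fps_nth y k) * real q ^ k \<le> C"
  shows "vabs (fps_nth (x * y) n) * real q ^ n \<le> B * C"
  unfolding fps_mult_nth
proof (rule vabs_sum_mult_le)
  fix i
  assume i: "i \<in> {0..n}"
  then have "real q ^ n = real q ^ i * real q ^ (n - i)"
    by (simp flip: power_add)
  then have "vabs (fps_nth x i * fps_nth y (n - i)) * real q ^ n =
      (vabs (fps_nth x i) * real q ^ i) * (vabs (fps_nth y (n - i)) * real q ^ (n - i))"
    by (simp add: vabs_mult)
  also have "\<dots> \<le> B * C"
    using i assms by (intro mult_mono) auto
  finally show "vabs (fps_nth x i * fps_nth y (n - i)) * real q ^ n \<le> B * C" .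
qed (use assms in simp)

lemma fps_bounded_mult: "fps_bounded x \<Longrightarrow> fps_bounded y \<Longrightarrow> fps_bounded (x * y)"
  unfolding fps_bounded_def by (meson fps_mult_bound mult_nonneg_nonneg)

lemma fps_bounded_add: "fps_bounded x \<Longrightarrow> fps_bounded y \<Longrightarrow> fps_bounded (x + y)"
proof -
  assume "fps_bounded x" "fps_bounded y"
  then obtain B C where BC: "B \<ge> 0" "\<And>n. vabs (fps_nth x n) * real q ^ n \<le> B"
    "C \<ge> 0" "\<And>n. vabs (fps_nth y n) * real q ^ n \<le> C"
    unfolding fps_bounded_def by blast
  have "vabs (fps_nth (x + y) n) * real q ^ n \<le> max B C" for n
  proof -
    have "vabs (fps_nth x n) \<le> max B C / real q ^ n" "vabs (fps_nth y n) \<le> max B C / real q ^ n"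
      using BC(2,4)[of n] by (auto simp: pos_le_divide_eq le_max_iff_disj)
    then have "vabs (fps_nth (x + y) n) \<le> max B C / real q ^ n"
      by (simp add: vabs_add_leI)
    then show ?thesis
      by (simp add: pos_le_divide_eq)
  qed
  then show ?thesis
    unfolding fps_bounded_def using BC(1) by (intro exI[of _ "max B C"]) auto
qed

lemma fps_bounded_poly: "fps_bounded (fps_of_poly p)"
proof -
  have "vabs (coeff p n) * real q ^ n \<le> (\<Sum>i\<le>degree p. vabs (coeff p i) * real q ^ i)" for n
  proof (cases "n \<le> degree p")
    case True
    then show ?thesis
      by (intro member_le_sum) auto
  next
    case False
    then show ?thesis
      by (simp add: coeff_eq_0 sum_nonneg)
  qed
  then show ?thesis
    unfolding fps_bounded_def
    by (intro exI[of _ "\<Sum>i\<le>degree p. vabs (coeff p i) * real q ^ i"]) (auto intro: sum_nonneg)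
qed

lemma fps_bounded_sum: "(\<And>i. i \<in> I \<Longrightarrow> fps_bounded (f i)) \<Longrightarrow> fps_bounded (\<Sum>i\<in>I. f i)"
  using fps_bounded_poly[of 0]
  by (induction I rule: infinite_finite_induct) (auto intro: fps_bounded_add)

lemma fps_bounded_power: "fps_bounded x \<Longrightarrow> fps_bounded (x ^ n)"
  using fps_bounded_poly[of 1] by (induction n) (auto intro: fps_bounded_mult)

lemma theta_nonzero: "\<theta> \<noteq> 0"
  using vabs_theta q_ge_2 by auto

lemma linear_inverse_bounded:
  "\<exists>V. fps_bounded V \<and> fps_of_poly [:- \<theta>, 1:] * V = 1"
proof -
  \<comment> \<open>The geometric expansion of 1/(t - \<theta>) in powers of t/\<theta>.\<close>
  define V where "V = Abs_fps (\<lambda>n. - (inverse \<theta> ^ Suc n))"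
  have "fps_of_poly [:- \<theta>, 1:] * V = 1"
  proof (rule fps_ext)
    fix n
    have "fps_of_poly [:- \<theta>, 1:] * V = fps_X * V + fps_const (- \<theta>) * V"
      by (simp add: fps_of_poly_linear ring_distribs)
    then show "fps_nth (fps_of_poly [:- \<theta>, 1:] * V) n = fps_nth 1 n"
      using theta_nonzero by (cases n) (simp_all add: V_def fps_mult_left_const_nth)
  qed
  moreover have "fps_bounded V"
    unfolding fps_bounded_def
  proof (intro exI[of _ 1] conjI allI)
    fix n
    have "vabs (fps_nth V n) = inverse (real q) ^ Suc n"
      by (simp add: V_def vabs_mult vabs_power vabs_inverse vabs_theta)
    then have "vabs (fps_nth V n) * real q ^ n = inverse (real q)"
      using q_ge_2 by (simp add: power_inverse field_simps)
    also have "\<dots> \<le> 1"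
      using q_ge_2 by (simp add: field_simps)
    finally show "vabs (fps_nth V n) * real q ^ n \<le> 1" .
  qed simp
  ultimately show ?thesis
    by blast
qed

end

section \<open>Decay of solutions of twisted linear equations\<close>

lemma uniform_bound:
  fixes P :: "'a \<Rightarrow> real \<Rightarrow> bool"
  assumes "finite I" "\<And>x. x \<in> I \<Longrightarrow> \<exists>C. P x C" "\<And>x C C'. P x C \<Longrightarrow> C \<le> C' \<Longrightarrow> P x C'"
  shows "\<exists>C\<ge>0. \<forall>x\<in>I. P x C"
  using assms(1,2)
proof (induction I rule: finite_induct)
  case (insert x I)
  then obtain C C' where "C \<ge> 0" "\<forall>x\<in>I. P x C" "P x C'"
    by blast
  then show ?case
    using assms(3) by (intro exI[of _ "max C C'"]) (auto intro: assms(3))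
qed auto

text \<open>The bound for \<rho> n involves \<rho> n itself, through k = n, so plain induction does
  not close. But \<rho> tends to 0 and q \<ge> 2, so eventually \<rho>_k^q \<le> \<rho>_k/(2C): the
  term k = n costs at most half of the left-hand side and is absorbed, and earlier terms stay below
  the initial bound.\<close>

lemma recursive_growth_bound:
  fixes \<rho> :: "nat \<Rightarrow> real" and C R :: real
  assumes \<rho>: "\<And>n. 0 \<le> \<rho> n" "\<rho> \<longlonglongrightarrow> 0" and q: "q \<ge> 2" and C: "C > 0" and R: "R > 0"
    and rec: "\<And>n B. B \<ge> 1 \<Longrightarrow> (\<And>k. k \<le> n \<Longrightarrow> \<rho> k ^ q * R ^ k \<le> B) \<Longrightarrow> \<rho> n * R ^ n \<le> C * B"
  shows "\<exists>C'\<ge>0. \<forall>n. \<rho> n * R ^ n \<le> C'"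
proof -
  obtain k0 where k0: "\<And>k. k \<ge> k0 \<Longrightarrow> \<rho> k < min 1 (1 / (2 * C))"
    using order_tendstoD(2)[OF \<rho>(2), of "min 1 (1 / (2 * C))"] C by (auto simp: eventually_sequentially)
  \<comment> \<open>\<open>B0\<close> covers the finitely many k before \<rho> is small; the summand
    1 provides the condition \<open>B \<ge> 1\<close> of \<open>rec\<close>.\<close>
  define B0 where "B0 = 1 + (\<Sum>k<k0. \<rho> k ^ q * R ^ k)"
  have nn: "0 \<le> \<rho> k ^ q * R ^ k" for k
    using \<rho>(1) R by simp
  then have B0: "B0 \<ge> 1"
    by (simp add: B0_def sum_nonneg)
  have small: "\<rho> k ^ q * R ^ k \<le> (\<rho> k * R ^ k) / (2 * C)" if "k \<ge> k0" for k
  proof -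
    have le: "\<rho> k \<le> 1" "\<rho> k \<le> 1 / (2 * C)"
      using k0[OF that] by auto
    have "\<rho> k ^ q \<le> \<rho> k ^ 2"
      using q le(1) \<rho>(1) by (intro power_decreasing) auto
    also have "\<dots> \<le> \<rho> k * (1 / (2 * C))"
      unfolding power2_eq_square using le(2) \<rho>(1) by (intro mult_left_mono) auto
    finally have "\<rho> k ^ q * R ^ k \<le> \<rho> k * (1 / (2 * C)) * R ^ k"
      using R by (intro mult_right_mono) auto
    then show ?thesis
      by (simp add: field_simps)
  qed
  have "\<rho> n * R ^ n \<le> C * B0" for n
  proof (induction n rule: less_induct)
    case (less n)
    \<comment> \<open>The second argument serves k = n. If it is the maximum, the resulting estimate
      reads x \<le> x/2 with x \<ge> 0.\<close>
    define B where "B = max B0 ((\<rho> n * R ^ n) / (2 * C))"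
    have "\<rho> k ^ q * R ^ k \<le> B" if k: "k \<le> n" for k
    proof (cases "k < k0")
      case True
      then have "\<rho> k ^ q * R ^ k \<le> (\<Sum>k<k0. \<rho> k ^ q * R ^ k)"
        using nn by (intro member_le_sum) auto
      then show ?thesis
        by (simp add: B_def B0_def)
    next
      case False
      then have le: "\<rho> k ^ q * R ^ k \<le> (\<rho> k * R ^ k) / (2 * C)"
        using small by simp
      show ?thesis
      proof (cases "k = n")
        case True
        then show ?thesis
          using le by (simp add: B_def)
      next
        case False
        then have "\<rho> k * R ^ k \<le> C * B0"
          using less k by simp
        then have "(\<rho> k * R ^ k) / (2 * C) \<le> (C * B0) / (2 * C)"
          using C by (intro divide_right_mono) auto
        also have "\<dots> \<le> B0"
          using C B0 by simp
        finally show ?thesis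
          using le by (simp add: B_def)
      qed
    qed
    then have "\<rho> n * R ^ n \<le> C * B"
      using B0 by (intro rec) (auto simp: B_def)
    moreover have "0 \<le> \<rho> n * R ^ n" "0 \<le> C * B0"
      using \<rho>(1) R C B0 by simp_all
    moreover have "C * ((\<rho> n * R ^ n) / (2 * C)) = (\<rho> n * R ^ n) / 2"
      using C by simp
    moreover have "C * B = C * B0 \<or> C * B = C * ((\<rho> n * R ^ n) / (2 * C))"
      by (auto simp: B_def max_def)
    ultimately show ?case
      by linarith
  qed
  moreover have "0 \<le> C * B0"
    using C B0 by simp
  ultimately show ?thesis
    by blast
qed

context C_infinity
begin

lemma root_tendsto_0:
  fixes c :: "nat \<Rightarrow> 'c"
  assumes "(\<lambda>n. vabs (c n)) \<longlonglongrightarrow> 0"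
  shows "(\<lambda>n. vabs (twist q (- 1) (c n))) \<longlonglongrightarrow> 0"
proof (rule LIMSEQ_I)
  fix e :: real
  assume e: "0 < e"
  then have "0 < e ^ q"
    by simp
  then obtain N where N: "\<And>n. n \<ge> N \<Longrightarrow> vabs (c n) < e ^ q"
    using order_tendstoD(2)[OF assms] by (auto simp: eventually_sequentially)
  have "vabs (twist q (- 1) (c n)) < e" if "n \<ge> N" for n
    using N[OF that] e power_less_imp_less_base[of "vabs (twist q (- 1) (c n))" q e]
    by (simp add: vabs_twist_m1)
  then show "\<exists>N. \<forall>n\<ge>N. norm (vabs (twist q (- 1) (c n)) - 0) < e"
    by auto
qed

text \<open>The equation expresses the q-th roots of the coefficients through the coefficients,
  which are their q-th powers and hence much smaller once the roots are small. With \<rho> n the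
  total size of the roots, this is the situation of \<open>recursive_growth_bound\<close>; its
  condition \<open>B \<ge> 1\<close> lets \<open>H\<close> be absorbed into a multiple of B.\<close>

lemma solution_decay:
  fixes g H :: "nat \<Rightarrow> 'c fps" and Y :: "nat \<Rightarrow> nat \<Rightarrow> 'c fps"
  assumes eq: "\<And>i. i < r \<Longrightarrow> fps_root (g i) = (\<Sum>j<r. g j * Y j i) + H i"
    and Y: "\<And>i j. i < r \<Longrightarrow> j < r \<Longrightarrow> fps_bounded (Y j i)" and H: "\<And>i. i < r \<Longrightarrow> fps_bounded (H i)"
    and g: "\<And>j. j < r \<Longrightarrow> g j \<in> Tate 1"
  shows "\<exists>C\<ge>0. \<forall>n. \<forall>j<r. vabs (twist q (- 1) (fps_nth (g j) n)) * real q ^ n \<le> C"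
proof -
  have "\<exists>CY\<ge>0. \<forall>(i, j)\<in>{..<r} \<times> {..<r}. \<forall>n. vabs (fps_nth (Y j i) n) * real q ^ n \<le> CY"
  proof (rule uniform_bound)
    show "\<exists>C. case x of (i, j) \<Rightarrow> \<forall>n. vabs (fps_nth (Y j i) n) * real q ^ n \<le> C" if "x \<in> {..<r} \<times> {..<r}" for x
      using that Y[of "fst x" "snd x"] unfolding fps_bounded_def by (simp add: case_prod_beta mem_Times_iff) blast
  qed (auto intro: order_trans)
  then obtain CY where CY: "CY \<ge> 0" "\<And>i j n. i < r \<Longrightarrow> j < r \<Longrightarrow> vabs (fps_nth (Y j i) n) * real q ^ n \<le> CY"
    by blast
  have "\<exists>CH\<ge>0. \<forall>i\<in>{..<r}. \<forall>n. vabs (fps_nth (H i) n) * real q ^ n \<le> CH"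
  proof (rule uniform_bound)
    show "\<exists>C. \<forall>n. vabs (fps_nth (H i) n) * real q ^ n \<le> C" if "i \<in> {..<r}" for i
      using that H[of i] unfolding fps_bounded_def by simp blast
  qed (auto intro: order_trans)
  then obtain CH where CH: "CH \<ge> 0" "\<And>i n. i < r \<Longrightarrow> vabs (fps_nth (H i) n) * real q ^ n \<le> CH"
    by blast
  define \<rho> where "\<rho> n = (\<Sum>j<r. vabs (twist q (- 1) (fps_nth (g j) n)))" for n
  \<comment> \<open>The factor accounts for the r summands of \<rho>; the added ones keep
    \<open>C\<close> positive even if r = 0.\<close>
  define C where "C = (CY + CH + 1) * (real r + 1)"
  have \<rho>_ge: "vabs (twist q (- 1) (fps_nth (g j) n)) \<le> \<rho> n" if "j < r" for j n
    unfolding \<rho>_def using that by (intro member_le_sum) auto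
  have \<rho>0: "0 \<le> \<rho> n" for n
    by (simp add: \<rho>_def sum_nonneg)
  have "\<rho> \<longlonglongrightarrow> (\<Sum>j<r. 0)"
    unfolding \<rho>_def using g by (intro tendsto_sum root_tendsto_0) (auto simp: Tate_def)
  then have lim: "\<rho> \<longlonglongrightarrow> 0"
    by simp
  have rec: "\<rho> n * real q ^ n \<le> C * B"
    if B: "B \<ge> 1" "\<And>k. k \<le> n \<Longrightarrow> \<rho> k ^ q * real q ^ k \<le> B" for n B
  proof -
    have g_le: "vabs (fps_nth (g j) k) * real q ^ k \<le> B" if "j < r" "k \<le> n" for j k
    proof -
      have "vabs (fps_nth (g j) k) = vabs (twist q (- 1) (fps_nth (g j) k)) ^ q"
        by (simp add: vabs_twist_m1)
      also have "\<dots> \<le> \<rho> k ^ q"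
        using \<rho>_ge[OF that(1)] by (intro power_mono) auto
      finally have "vabs (fps_nth (g j) k) * real q ^ k \<le> \<rho> k ^ q * real q ^ k"
        by (intro mult_right_mono) auto
      then show ?thesis
        using B(2)[OF that(2)] by linarith
    qed
    have "vabs (twist q (- 1) (fps_nth (g i) n)) * real q ^ n \<le> (CY + CH + 1) * B" if i: "i < r" for i
    proof -
      let ?B = "(CY + CH + 1) * B"
      have B': "CY * B \<le> ?B" "CH \<le> ?B" "0 \<le> ?B"
      proof -
        have "CH * 1 \<le> CH * B"
          using CH(1) B(1) by (intro mult_left_mono) auto
        moreover have "0 \<le> CY * B" "0 \<le> CH * B" "0 \<le> B"
          using B(1) CY(1) CH(1) by auto
        ultimately show "CY * B \<le> ?B" "CH \<le> ?B" "0 \<le> ?B"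
          by (simp_all add: ring_distribs)
      qed
      have "twist q (- 1) (fps_nth (g i) n) = fps_nth (fps_root (g i)) n"
        by simp
      also have "\<dots> = (\<Sum>j<r. fps_nth (g j * Y j i) n) + fps_nth (H i) n"
        by (simp add: eq[OF i] fps_sum_nth)
      finally have *: "twist q (- 1) (fps_nth (g i) n) = (\<Sum>j<r. fps_nth (g j * Y j i) n) + fps_nth (H i) n" .
      have "vabs (fps_nth (g j * Y j i) n) * real q ^ n \<le> B * CY" if "j < r" for j
        using B(1) CY i that g_le by (intro fps_mult_bound) auto
      then have "vabs (\<Sum>j<r. fps_nth (g j * Y j i) n) * real q ^ n \<le> ?B"
        using B' by (intro vabs_sum_mult_le) (fastforce simp: mult.commute)+
      then have "vabs (\<Sum>j<r. fps_nth (g j * Y j i) n) \<le> ?B / real q ^ n"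
        by (simp add: pos_le_divide_eq)
      moreover have "vabs (fps_nth (H i) n) \<le> ?B / real q ^ n"
        using CH(2)[OF i, of n] B'(2) by (simp add: pos_le_divide_eq)
      ultimately have "vabs (twist q (- 1) (fps_nth (g i) n)) \<le> ?B / real q ^ n"
        unfolding * by (rule vabs_add_leI)
      then show ?thesis
        by (simp add: pos_le_divide_eq)
    qed
    then have "\<rho> n * real q ^ n \<le> (\<Sum>i<r. (CY + CH + 1) * B)"
      unfolding \<rho>_def sum_distrib_right by (intro sum_mono) auto
    also have "\<dots> \<le> C * B"
      using B(1) CY(1) CH(1) by (simp add: C_def mult.assoc mult.left_commute[of _ "real r"])
    finally show ?thesis .
  qed
  have "C > 0"
    using CY(1) CH(1) by (simp add: C_def)
  then obtain C' where C': "C' \<ge> 0" "\<And>n. \<rho> n * real q ^ n \<le> C'"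
    using recursive_growth_bound[of \<rho> q C "real q"] \<rho>0 lim q_ge_2 rec by auto
  have "vabs (twist q (- 1) (fps_nth (g j) n)) * real q ^ n \<le> C'" if "j < r" for n j
    by (rule order_trans[OF mult_right_mono[OF \<rho>_ge[OF that]] C'(2)]) simp
  then show ?thesis
    using C'(1) by blast
qed

end

section \<open>Inverting \<Phi>' up to a power of t - \<theta>\<close>

context motive_with_bases
begin

lemma Kt_coords_unique:
  assumes "\<And>j. j < r \<Longrightarrow> a j \<in> polys_over Kb" "\<And>j. j < r \<Longrightarrow> b j \<in> polys_over Kb"
    and "(\<Sum>j<r. act (a j) (m j)) = (\<Sum>j<r. act (b j) (m j))" and j: "j < r"
  shows "a j = b j"
proof -
  have "\<exists>!g. g \<in> carrier_vec r \<and> (\<forall>j<r. g $ j \<in> polys_over Kb) \<and>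
      (\<Sum>j<r. act (a j) (m j)) = (\<Sum>j<r. act (g $ j) (m j))"
    using Kt unfolding Kt_basis_def by blast
  then have "g = h"
    if "g \<in> carrier_vec r \<and> (\<forall>j<r. g $ j \<in> polys_over Kb) \<and> (\<Sum>j<r. act (a j) (m j)) = (\<Sum>j<r. act (g $ j) (m j))"
      "h \<in> carrier_vec r \<and> (\<forall>j<r. h $ j \<in> polys_over Kb) \<and> (\<Sum>j<r. act (a j) (m j)) = (\<Sum>j<r. act (h $ j) (m j))"
    for g h
    using that by blast
  from this[of "vec r a" "vec r b"] have "vec r a = vec r b"
    using assms(1-3) by simp
  then show ?thesis
    using j by (metis index_vec)
qed

text \<open>Effectivity writes (t - \<theta>)^l m_i as \<sigma> y_i. Expanding y_i in the basis and
  applying \<sigma> puts the twisted coordinates of y_i into row i of Z.\<close>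

lemma effective_matrix:
  assumes \<Phi>': "\<Phi>' \<in> carrier_mat r r" "elements_mat \<Phi>' \<subseteq> polys_over Kb"
    and \<sigma>m: "\<And>i. i < r \<Longrightarrow> \<sigma> (m i) = (\<Sum>j<r. act (\<Phi>' $$ (i, j)) (m j))"
  shows "\<exists>l Z. Z \<in> carrier_mat r r \<and> Z * \<Phi>' = ([:- \<theta>, 1:] ^ l) \<cdot>\<^sub>m 1\<^sub>m r"
proof -
  have \<Phi>'_PK: "\<Phi>' $$ (i, j) \<in> polys_over Kb" if "i < r" "j < r" for i j
    using that \<Phi>' elements_matI[of \<Phi>' r r i j] by auto
  obtain l where l: "\<And>x. \<exists>y. act ([:- \<theta>, 1:] ^ l) x = \<sigma> y"
    using effective by blast
  have "\<forall>i. \<exists>g. (\<forall>j<r. g $ j \<in> polys_over Kb) \<and> act ([:- \<theta>, 1:] ^ l) (m i) = \<sigma> (\<Sum>j<r. act (g $ j) (m j))"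
  proof
    fix i
    obtain y where y: "act ([:- \<theta>, 1:] ^ l) (m i) = \<sigma> y"
      using l by blast
    have "\<exists>!g. g \<in> carrier_vec r \<and> (\<forall>j<r. g $ j \<in> polys_over Kb) \<and> y = (\<Sum>j<r. act (g $ j) (m j))"
      using Kt unfolding Kt_basis_def by blast
    then obtain g where "\<forall>j<r. g $ j \<in> polys_over Kb" "y = (\<Sum>j<r. act (g $ j) (m j))"
      by blast
    then show "\<exists>g. (\<forall>j<r. g $ j \<in> polys_over Kb) \<and> act ([:- \<theta>, 1:] ^ l) (m i) = \<sigma> (\<Sum>j<r. act (g $ j) (m j))"
      using y by blast
  qed
  from choice[OF this] obtain a where a: "\<And>i j. j < r \<Longrightarrow> a i $ j \<in> polys_over Kb"
    "\<And>i. act ([:- \<theta>, 1:] ^ l) (m i) = \<sigma> (\<Sum>j<r. act (a i $ j) (m j))"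
    by blast
  define Z where "Z = mat r r (\<lambda>(i, k). map_poly root (a i $ k))"
  have Z: "Z \<in> carrier_mat r r"
    by (simp add: Z_def)
  have Z_PK: "Z $$ (i, k) \<in> polys_over Kb" if "i < r" "k < r" for i k
    using a(1)[OF that(2), of i] that by (auto simp: Z_def polys_over_def coeff_map_poly twist_m1_K_bar)
  have "(Z * \<Phi>') $$ (i, j) = (if i = j then [:- \<theta>, 1:] ^ l else 0)" if i: "i < r" and j: "j < r" for i j
  proof (rule Kt_coords_unique[where j = j and a = "\<lambda>j. (Z * \<Phi>') $$ (i, j)" and b = "\<lambda>j. if i = j then [:- \<theta>, 1:] ^ l else 0"])
    have eq: "(Z * \<Phi>') $$ (i, j) = (\<Sum>k<r. Z $$ (i, k) * \<Phi>' $$ (k, j))" if "j < r" for j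
      using index_mat_mult[OF Z \<Phi>'(1) i that] .
    have "(\<Sum>j<r. act ((Z * \<Phi>') $$ (i, j)) (m j)) = (\<Sum>j<r. \<Sum>k<r. act (Z $$ (i, k) * \<Phi>' $$ (k, j)) (m j))"
      using i Z_PK \<Phi>'_PK by (intro sum.cong refl) (auto simp: eq intro!: act_sum_left PK_closed(4))
    also have "\<dots> = (\<Sum>k<r. \<Sum>j<r. act (Z $$ (i, k) * \<Phi>' $$ (k, j)) (m j))"
      by (rule sum.swap)
    also have "\<dots> = (\<Sum>k<r. act (Z $$ (i, k)) (\<Sum>j<r. act (\<Phi>' $$ (k, j)) (m j)))"
      using i Z_PK \<Phi>'_PK by (intro sum.cong refl) (auto simp: act_sum_right scale_mult)
    also have "\<dots> = (\<Sum>k<r. \<sigma> (act (a i $ k) (m k)))"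
      using i a(1) by (intro sum.cong refl) (auto simp: sigma_scale Z_def \<sigma>m)
    also have "\<dots> = act ([:- \<theta>, 1:] ^ l) (m i)"
      by (simp add: a(2) sigma_sum)
    also have "\<dots> = (\<Sum>j<r. if j = i then act ([:- \<theta>, 1:] ^ l) (m j) else 0)"
      using i by (simp add: sum.delta)
    also have "\<dots> = (\<Sum>j<r. act (if i = j then [:- \<theta>, 1:] ^ l else 0) (m j))"
      by (intro sum.cong refl) auto
    finally show "(\<Sum>j<r. act ((Z * \<Phi>') $$ (i, j)) (m j)) = (\<Sum>j<r. act (if i = j then [:- \<theta>, 1:] ^ l else 0) (m j))" .
    show "(Z * \<Phi>') $$ (i, j) \<in> polys_over Kb" if "j < r" for j
      unfolding eq[OF that] using i that Z_PK \<Phi>'_PK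
      by (intro polys_over_sum[OF is_subfield_K_bar] PK_closed(4)) auto
    show "(if i = j then [:- \<theta>, 1:] ^ l else 0) \<in> polys_over Kb" for j
      using polys_over_power[OF is_subfield_K_bar theta_PK] PK_closed(1) by simp
  qed (rule j)
  then have "Z * \<Phi>' = ([:- \<theta>, 1:] ^ l) \<cdot>\<^sub>m 1\<^sub>m r"
    using Z \<Phi>' by (intro eq_matI) auto
  then show ?thesis
    using Z by blast
qed

text \<open>Multiplying g - f, the twisted row times \<Phi>', from the right by Z and by (t -
  \<theta>)^-l isolates the twisted row. All factors on the other side are bounded series, as
  \<open>solution_decay\<close> requires.\<close>

lemma row_decay:
  fixes g :: "nat \<Rightarrow> 'c fps" and f :: "nat \<Rightarrow> 'c poly"
  assumes \<Phi>': "\<Phi>' \<in> carrier_mat r r" "elements_mat \<Phi>' \<subseteq> polys_over Kb"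
    and \<sigma>m: "\<And>i. i < r \<Longrightarrow> \<sigma> (m i) = (\<Sum>j<r. act (\<Phi>' $$ (i, j)) (m j))"
    and eq: "\<And>j. j < r \<Longrightarrow> g j = (\<Sum>k<r. fps_root (g k) * fps_of_poly (\<Phi>' $$ (k, j))) + fps_of_poly (f j)"
    and g: "\<And>j. j < r \<Longrightarrow> g j \<in> Tate 1"
  shows "\<exists>C\<ge>0. \<forall>n. \<forall>j<r. vabs (root (fps_nth (g j) n)) * real q ^ n \<le> C"
proof -
  obtain l Z where Z: "Z \<in> carrier_mat r r" "Z * \<Phi>' = ([:- \<theta>, 1:] ^ l) \<cdot>\<^sub>m 1\<^sub>m r"
    using effective_matrix[OF \<Phi>' \<sigma>m] by blast
  have \<Phi>Z: "\<Phi>' * Z = ([:- \<theta>, 1:] ^ l) \<cdot>\<^sub>m 1\<^sub>m r"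
    by (rule mat_mult_scalar_commute[OF Z(1) \<Phi>'(1) Z(2)]) simp
  obtain V where V: "fps_bounded V" "fps_of_poly [:- \<theta>, 1:] * V = 1"
    using linear_inverse_bounded by blast
  let ?p = "fps_of_poly [:- \<theta>, 1:]" and ?Z = "\<lambda>j i. fps_of_poly (Z $$ (j, i))"
  have "fps_root (g i) = (\<Sum>j<r. g j * (?Z j i * V ^ l)) + (\<Sum>j<r. - fps_of_poly (f j) * (?Z j i * V ^ l))"
    if i: "i < r" for i
  proof -
    have sum_eq: "(\<Sum>j<r. fps_of_poly (\<Phi>' $$ (k, j)) * ?Z j i) = (if k = i then ?p ^ l else 0)" if "k < r" for k
    proof -
      have "(\<Sum>j<r. \<Phi>' $$ (k, j) * Z $$ (j, i)) = (if k = i then [:- \<theta>, 1:] ^ l else 0)"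
        using index_mat_mult[OF \<Phi>'(1) Z(1) that i] that i by (cases "k = i") (simp_all add: \<Phi>Z)
      then have "fps_of_poly (\<Sum>j<r. \<Phi>' $$ (k, j) * Z $$ (j, i)) = fps_of_poly (if k = i then [:- \<theta>, 1:] ^ l else 0)"
        by (rule arg_cong)
      then show ?thesis
        by (simp add: fps_of_poly_sum fps_of_poly_mult fps_of_poly_power split: if_splits)
    qed
    have "(\<Sum>j<r. (g j - fps_of_poly (f j)) * ?Z j i) = (\<Sum>j<r. \<Sum>k<r. fps_root (g k) * (fps_of_poly (\<Phi>' $$ (k, j)) * ?Z j i))"
    proof (rule sum.cong[OF refl])
      fix j
      assume "j \<in> {..<r}"
      then have "g j - fps_of_poly (f j) = (\<Sum>k<r. fps_root (g k) * fps_of_poly (\<Phi>' $$ (k, j)))"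
        using eq[of j] by (simp add: diff_eq_eq)
      then show "(g j - fps_of_poly (f j)) * ?Z j i = (\<Sum>k<r. fps_root (g k) * (fps_of_poly (\<Phi>' $$ (k, j)) * ?Z j i))"
        by (simp add: sum_distrib_right mult.assoc)
    qed
    also have "\<dots> = (\<Sum>k<r. \<Sum>j<r. fps_root (g k) * (fps_of_poly (\<Phi>' $$ (k, j)) * ?Z j i))"
      by (rule sum.swap)
    also have "\<dots> = (\<Sum>k<r. if k = i then fps_root (g k) * ?p ^ l else 0)"
      by (intro sum.cong refl) (auto simp: sum_distrib_left[symmetric] sum_eq)
    also have "\<dots> = fps_root (g i) * ?p ^ l"
      using i by (simp add: sum.delta)
    finally have "(\<Sum>j<r. (g j - fps_of_poly (f j)) * ?Z j i) * V ^ l = fps_root (g i) * (?p * V) ^ l"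
      by (simp add: power_mult_distrib mult.assoc)
    then have "fps_root (g i) = (\<Sum>j<r. (g j - fps_of_poly (f j)) * ?Z j i) * V ^ l"
      by (simp add: V(2))
    then show ?thesis
      by (simp add: left_diff_distrib sum_subtractf sum_distrib_right sum_negf mult.assoc)
  qed
  moreover have "fps_bounded (?Z j i * V ^ l)" for i j
    by (intro fps_bounded_mult fps_bounded_power fps_bounded_poly V)
  moreover have "fps_bounded (\<Sum>j<r. - fps_of_poly (f j) * (?Z j i * V ^ l))" for i
  proof -
    have "- fps_of_poly (f j) = fps_of_poly (- f j)" for j
      by (simp add: fps_of_poly_uminus)
    then show ?thesis
      by (simp only:) (intro fps_bounded_sum fps_bounded_mult fps_bounded_power fps_bounded_poly V)
  qed
  ultimately show ?thesis
    using g by (intro solution_decay) auto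
qed

end

section \<open>The extension of \<open>\<delta>\<^sub>0\<close>\<close>

context C_infinity
begin

lemma Tate_add: "x \<in> Tate \<rho> \<Longrightarrow> y \<in> Tate \<rho> \<Longrightarrow> x + y \<in> Tate \<rho>" for x y :: "'c fps"
proof -
  assume "x \<in> Tate \<rho>" "y \<in> Tate \<rho>"
  then have lim: "(\<lambda>i. \<bar>vabs (fps_nth x i) * \<rho> ^ i\<bar> + \<bar>vabs (fps_nth y i) * \<rho> ^ i\<bar>) \<longlonglongrightarrow> \<bar>0\<bar> + \<bar>0\<bar>"
    unfolding Tate_def by (intro tendsto_add tendsto_rabs) auto
  have "norm (vabs (fps_nth (x + y) i) * \<rho> ^ i) \<le> \<bar>vabs (fps_nth x i) * \<rho> ^ i\<bar> + \<bar>vabs (fps_nth y i) * \<rho> ^ i\<bar>" for i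
  proof -
    have "vabs (fps_nth (x + y) i) \<le> vabs (fps_nth x i) + vabs (fps_nth y i)"
      by (simp add: vabs_add_leI)
    then show ?thesis
      using mult_right_mono[of "vabs (fps_nth (x + y) i)" "vabs (fps_nth x i) + vabs (fps_nth y i)" "\<bar>\<rho> ^ i\<bar>"]
      by (simp add: abs_mult ring_distribs)
  qed
  then have "(\<lambda>i. \<bar>vabs (fps_nth (x + y) i) * \<rho> ^ i\<bar>) \<longlonglongrightarrow> 0"
    using tendsto_sandwich[OF _ _ tendsto_const[of 0] lim[simplified], of "\<lambda>i. \<bar>vabs (fps_nth (x + y) i) * \<rho> ^ i\<bar>"]
    by simp
  then show ?thesis
    unfolding Tate_def mem_Collect_eq by (rule tendsto_rabs_zero_cancel)
qed

lemma Tate_const_mult: "x \<in> Tate \<rho> \<Longrightarrow> fps_const c * x \<in> Tate \<rho>" for x :: "'c fps"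
  using tendsto_mult_left[of "\<lambda>i. vabs (fps_nth x i) * \<rho> ^ i" 0 sequentially "vabs c"]
  by (simp add: Tate_def vabs_mult mult.assoc)

lemma Tate_X_mult: "x \<in> Tate \<rho> \<Longrightarrow> fps_X * x \<in> Tate \<rho>" for x :: "'c fps"
proof -
  assume "x \<in> Tate \<rho>"
  then have "(\<lambda>i. \<rho> * (vabs (fps_nth x i) * \<rho> ^ i)) \<longlonglongrightarrow> \<rho> * 0"
    unfolding Tate_def by (intro tendsto_mult_left) auto
  then have "(\<lambda>i. vabs (fps_nth (fps_X * x) (Suc i)) * \<rho> ^ Suc i) \<longlonglongrightarrow> 0"
    by (simp add: mult.left_commute)
  then show ?thesis
    unfolding Tate_def by (simp only: mem_Collect_eq) (rule LIMSEQ_imp_Suc)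
qed

lemma fps_of_poly_pCons_mult:
  "fps_of_poly (pCons a p) * x = fps_const a * x + fps_X * (fps_of_poly p * x)" for x :: "'c fps"
  by (simp add: fps_of_poly_pCons ring_distribs mult.assoc mult.left_commute)

lemma Tate_0 [simp]: "(0 :: 'c fps) \<in> Tate \<rho>"
  by (simp add: Tate_def)

lemma Tate_poly_mult: "x \<in> Tate \<rho> \<Longrightarrow> fps_of_poly p * x \<in> Tate \<rho>" for x :: "'c fps"
  by (induction p) (simp_all add: fps_of_poly_pCons_mult Tate_add Tate_const_mult Tate_X_mult)

lemma Tate_poly: "fps_of_poly p \<in> Tate \<rho>" for p :: "'c poly"
proof -
  have "(1 :: 'c fps) \<in> Tate \<rho>"
    unfolding Tate_def by (intro CollectI tendsto_eventually eventually_sequentiallyI[of 1]) simp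
  from Tate_poly_mult[OF this, of p] show ?thesis
    by simp
qed

lemma Tate_minus: "x \<in> Tate \<rho> \<Longrightarrow> - x \<in> Tate \<rho>" for x :: "'c fps"
  by (simp add: Tate_def)

text \<open>Synthetic division started at infinity: the tails \<open>T i\<close>, the sums of
  u_(i+k) \<theta>^k over k, satisfy T_i = u_i + \<theta> T_(i+1). So T_0 = u(\<theta>) is the
  remainder, and T_1, T_2, ... are the coefficients of the quotient. The tails exist because u
  converges on |t| \<le> q.\<close>

lemma Tate_divide_linear:
  assumes u: "u \<in> Tate (real q)"
  shows "\<exists>c v. v \<in> Tate (real q) \<and> u = fps_const c + fps_of_poly [:- \<theta>, 1:] * v"
proof -
  define T where "T i = (\<Sum>k. fps_nth u (i + k) * \<theta> ^ k)" for i
  have lim: "(\<lambda>i. vabs (fps_nth u i) * real q ^ i) \<longlonglongrightarrow> 0"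
    using u by (simp add: Tate_def)
  have trm: "vabs (fps_nth u (i + k) * \<theta> ^ k) = vabs (fps_nth u (i + k)) * real q ^ (i + k) / real q ^ i" for i k
    using q_ge_2 by (simp add: vabs_mult vabs_power vabs_theta power_add)
  have sums: "(\<lambda>k. fps_nth u (i + k) * \<theta> ^ k) sums T i" for i
  proof -
    have "(\<lambda>k. vabs (fps_nth u (i + k) * \<theta> ^ k)) \<longlonglongrightarrow> 0 / real q ^ i"
      unfolding trm using LIMSEQ_ignore_initial_segment[OF lim, of i]
      by (intro tendsto_divide) (simp_all add: add.commute)
    then show ?thesis
      unfolding T_def by (intro summable_sums summable_vabs_tendsto_0) simp
  qed
  have rec: "T i = fps_nth u i + \<theta> * T (Suc i)" for i
  proof -
    have "(\<lambda>k. \<theta> * (fps_nth u (Suc i + k) * \<theta> ^ k)) sums (\<theta> * T (Suc i))"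
      by (intro sums_vabs_mult_left sums)
    then have "(\<lambda>k. fps_nth u (i + Suc k) * \<theta> ^ Suc k) sums (\<theta> * T (Suc i))"
      by (simp add: mult.left_commute)
    from sums_Suc[OF this] show ?thesis
      using sums[of i] sums_unique2 by (fastforce simp: add.commute)
  qed
  define v where "v = Abs_fps (\<lambda>i. T (Suc i))"
  have "v \<in> Tate (real q)"
    unfolding Tate_def
  proof (intro CollectI LIMSEQ_I)
    fix e :: real
    assume e: "0 < e"
    obtain N where N: "\<And>n. n \<ge> N \<Longrightarrow> vabs (fps_nth u n) * real q ^ n < e / 2"
      using order_tendstoD(2)[OF lim, of "e / 2"] e by (auto simp: eventually_sequentially)
    have "vabs (fps_nth v i) * real q ^ i < e" if "i \<ge> N" for i
    proof -
      have "vabs (T (Suc i)) \<le> (e / 2) / real q ^ i"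
      proof (rule vabs_sums_le[OF sums])
        fix k
        have "vabs (fps_nth u (Suc i + k) * \<theta> ^ k) \<le> (e / 2) / real q ^ Suc i"
          unfolding trm using N[of "Suc i + k"] that by (intro divide_right_mono) auto
        also have "\<dots> \<le> (e / 2) / real q ^ i"
          using e q_ge_2 by (intro divide_left_mono power_increasing) auto
        finally show "vabs (fps_nth u (Suc i + k) * \<theta> ^ k) \<le> (e / 2) / real q ^ i" .
      qed
      then have "vabs (fps_nth v i) * real q ^ i \<le> e / 2"
        by (simp add: v_def pos_le_divide_eq)
      then show ?thesis
        using e by linarith
    qed
    then show "\<exists>N. \<forall>i\<ge>N. norm (vabs (fps_nth v i) * real q ^ i - 0) < e"
      using e by (intro exI[of _ N]) (auto simp: abs_mult)
  qed
  moreover have "u = fps_const (T 0) + fps_of_poly [:- \<theta>, 1:] * v"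
  proof (rule fps_ext)
    fix n
    have "fps_of_poly [:- \<theta>, 1:] * v = fps_X * v + fps_const (- \<theta>) * v"
      by (simp add: fps_of_poly_linear ring_distribs)
    then show "fps_nth u n = fps_nth (fps_const (T 0) + fps_of_poly [:- \<theta>, 1:] * v) n"
      using rec[of n] by (cases n) (simp_all add: v_def fps_mult_left_const_nth)
  qed
  ultimately show ?thesis
    by blast
qed

lemma Tate_division:
  assumes u: "u \<in> Tate (real q)"
  shows "\<exists>h v. v \<in> Tate (real q) \<and> u = fps_of_poly h + fps_of_poly ([:- \<theta>, 1:] ^ N) * v"
proof (induction N)
  case 0
  show ?case
    using u by (intro exI[of _ 0] exI[of _ u]) simp
next
  case (Suc N)
  then obtain h v where v: "v \<in> Tate (real q)" "u = fps_of_poly h + fps_of_poly ([:- \<theta>, 1:] ^ N) * v"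
    by blast
  obtain c v' where v': "v' \<in> Tate (real q)" "v = fps_const c + fps_of_poly [:- \<theta>, 1:] * v'"
    using Tate_divide_linear[OF v(1)] by blast
  have "u = fps_of_poly (h + [:- \<theta>, 1:] ^ N * [:c:]) + fps_of_poly ([:- \<theta>, 1:] ^ Suc N) * v'"
    unfolding v(2) v'(2) fps_of_poly_add fps_of_poly_mult fps_of_poly_const power_Suc
    by (simp add: ring_distribs mult_ac)
  then show ?case
    using v'(1) by blast
qed

lemma vabs_sum_le_sum: "vabs (\<Sum>i\<in>I. f i) \<le> (\<Sum>i\<in>I. vabs (f i))" for f :: "'b \<Rightarrow> 'c"
proof (cases "finite I")
  case True
  then show ?thesis
    by (intro vabs_sum_le member_le_sum sum_nonneg) auto
qed simp

end

section \<open>The extension of \<delta>_0 as a convergent series\<close>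

locale t_motive_exponential =
  t_module_of_motive q F \<theta> act \<sigma> r d m w A + ex: t_module_exponential q F \<theta> d K s A Q
  for q :: nat and F :: "'c::{nonarch_valued_field, complete_space} set" and \<theta> :: 'c
    and act :: "'c poly \<Rightarrow> 'm::ab_group_add \<Rightarrow> 'm" and \<sigma> :: "'m \<Rightarrow> 'm"
    and r d :: nat and m w :: "nat \<Rightarrow> 'm" and A :: "nat \<Rightarrow> 'c mat" and K s :: nat and Q :: "nat \<Rightarrow> 'c mat" +
  assumes delta0_s: "\<And>x. \<delta>\<^sub>0 (act ([:- \<theta>, 1:] ^ s) x) = 0\<^sub>v d"
begin

lemma tt_pow_PK [simp]: "tt ^ i \<in> polys_over Kb"
  by (intro polys_over_power is_subfield_K_bar tt_PK)

lemma act_tt_pow_Suc: "act (tt ^ Suc i) x = act tt (act (tt ^ i) x)"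
  using scale_mult[of tt "tt ^ i" x] by simp

lemma act_tt_pow_tt: "act (tt ^ i) (act tt x) = act tt (act (tt ^ i) x)"
  by (intro act_commute) simp_all

lemma nrm_delta0_tt:
  "ex.nrm (\<delta>\<^sub>0 (act (tt ^ i) x)) \<le> real q ^ i * ex.nrm (\<delta>\<^sub>0 x)"
proof (induction i)
  case 0
  then show ?case
    by (simp add: scale_one)
next
  case (Suc i)
  have "ex.nrm (\<delta>\<^sub>0 (act (tt ^ Suc i) x)) \<le> q * ex.nrm (\<delta>\<^sub>0 (act (tt ^ i) x))"
    unfolding act_tt_pow_Suc delta0_act_tt by (rule ex.nrm_A0_le) simp
  also have "\<dots> \<le> q * (real q ^ i * ex.nrm (\<delta>\<^sub>0 x))"
    using Suc by (intro mult_left_mono) auto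
  finally show ?case
    by (simp add: mult.assoc)
qed

text \<open>In the adapted norm each factor t costs exactly q, so the growth q^i fits the
  convergence condition of \<open>Tate (real q)\<close>.\<close>

lemma cf_tt_bound:
  "\<exists>C. \<forall>i. \<forall>l<d. vabs (cf (act (tt ^ i) x) l 0) \<le> C * real q ^ i"
proof -
  have "vabs (cf (act (tt ^ i) x) l 0) \<le> ex.nrm (\<delta>\<^sub>0 x) * real q ^ i" if "l < d" for i l
    using ex.vabs_le_nrm[OF that, of "\<delta>\<^sub>0 (act (tt ^ i) x)"] nrm_delta0_tt[of i x]
    by (simp add: delta0_index[OF that] mult.commute)
  then show ?thesis
    by blast
qed

definition pair_term :: "(nat \<Rightarrow> 'c fps) \<Rightarrow> (nat \<Rightarrow> 'm) \<Rightarrow> nat \<Rightarrow> nat \<Rightarrow> 'c" where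
  "pair_term u x l i = (\<Sum>k<r. fps_nth (u k) i * cf (act (tt ^ i) (x k)) l 0)"

text \<open>The \<open>l\<close>-th component of the extension of \<open>\<delta>\<^sub>0\<close> at \<open>\<Sum>\<^sub>k u\<^sub>k x\<^sub>k\<close>, as a convergent series.\<close>
definition delta0T :: "(nat \<Rightarrow> 'c fps) \<Rightarrow> (nat \<Rightarrow> 'm) \<Rightarrow> nat \<Rightarrow> 'c" where
  "delta0T u x l = (\<Sum>i. pair_term u x l i)"

lemma pair_sums:
  assumes u: "\<And>k. k < r \<Longrightarrow> u k \<in> Tate (real q)" and l: "l < d"
  shows "pair_term u x l sums delta0T u x l"
proof -
  have "\<forall>k. \<exists>C. \<forall>i. vabs (cf (act (tt ^ i) (x k)) l 0) \<le> C * real q ^ i"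
    using cf_tt_bound l by blast
  from choice[OF this] obtain C where C: "\<And>k i. vabs (cf (act (tt ^ i) (x k)) l 0) \<le> C k * real q ^ i"
    by blast
  have "(\<lambda>i. \<Sum>k<r. C k * (vabs (fps_nth (u k) i) * real q ^ i)) \<longlonglongrightarrow> (\<Sum>k<r. C k * 0)"
    using u by (intro tendsto_sum tendsto_mult_left) (auto simp: Tate_def)
  then have lim: "(\<lambda>i. \<Sum>k<r. C k * (vabs (fps_nth (u k) i) * real q ^ i)) \<longlonglongrightarrow> 0"
    by simp
  have "vabs (pair_term u x l i) \<le> (\<Sum>k<r. C k * (vabs (fps_nth (u k) i) * real q ^ i))" for i
  proof -
    have "vabs (pair_term u x l i) \<le> (\<Sum>k<r. vabs (fps_nth (u k) i * cf (act (tt ^ i) (x k)) l 0))"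
      unfolding pair_term_def by (rule vabs_sum_le_sum)
    also have "\<dots> \<le> (\<Sum>k<r. C k * (vabs (fps_nth (u k) i) * real q ^ i))"
    proof (rule sum_mono)
      fix k
      show "vabs (fps_nth (u k) i * cf (act (tt ^ i) (x k)) l 0) \<le> C k * (vabs (fps_nth (u k) i) * real q ^ i)"
        using mult_left_mono[OF C[of i k], of "vabs (fps_nth (u k) i)"] by (simp add: vabs_mult mult_ac)
    qed
    finally show ?thesis .
  qed
  then have "(\<lambda>i. vabs (pair_term u x l i)) \<longlonglongrightarrow> 0"
    by (intro tendsto_sandwich[OF _ _ tendsto_const lim]) auto
  then show ?thesis
    unfolding delta0T_def by (intro summable_sums summable_vabs_tendsto_0)
qed

lemma delta0T_eqI: "pair_term u x l sums c \<Longrightarrow> delta0T u x l = c"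
  unfolding delta0T_def by (rule sums_unique[symmetric])

lemma delta0T_cong: "(\<And>k. k < r \<Longrightarrow> u k = v k) \<Longrightarrow> delta0T u x l = delta0T v x l"
  by (simp add: delta0T_def pair_term_def)

lemma delta0T_add:
  assumes "\<And>k. k < r \<Longrightarrow> u k \<in> Tate (real q)" "\<And>k. k < r \<Longrightarrow> v k \<in> Tate (real q)" "l < d"
  shows "delta0T (\<lambda>k. u k + v k) x l = delta0T u x l + delta0T v x l"
proof (rule delta0T_eqI)
  have "pair_term (\<lambda>k. u k + v k) x l = (\<lambda>i. pair_term u x l i + pair_term v x l i)"
    by (auto simp: pair_term_def distrib_right sum.distrib)
  then show "pair_term (\<lambda>k. u k + v k) x l sums (delta0T u x l + delta0T v x l)"
    using assms by (simp add: sums_add pair_sums)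
qed

lemma delta0T_add_right:
  assumes "\<And>k. k < r \<Longrightarrow> u k \<in> Tate (real q)" "l < d"
  shows "delta0T u (\<lambda>k. x k + y k) l = delta0T u x l + delta0T u y l"
proof (rule delta0T_eqI)
  have "pair_term u (\<lambda>k. x k + y k) l = (\<lambda>i. pair_term u x l i + pair_term u y l i)"
    using assms(2) by (auto simp: pair_term_def scale_add_right cf_add distrib_left sum.distrib)
  then show "pair_term u (\<lambda>k. x k + y k) l sums (delta0T u x l + delta0T u y l)"
    using assms by (simp add: sums_add pair_sums)
qed

lemma delta0T_const:
  assumes "a \<in> Kb" "l < d"
  shows "delta0T (\<lambda>k. fps_const a * u k) x l = delta0T u (\<lambda>k. act [:a:] (x k)) l"
proof -
  have "cf (act (tt ^ i) (act [:a:] y)) l 0 = a * cf (act (tt ^ i) y) l 0" for i y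
    using assms act_commute[of "tt ^ i" "[:a:]"] by (simp add: PK_closed(6) cf_const)
  then have "pair_term (\<lambda>k. fps_const a * u k) x l = pair_term u (\<lambda>k. act [:a:] (x k)) l"
    by (auto simp: pair_term_def fps_mult_left_const_nth mult_ac)
  then show ?thesis
    by (simp add: delta0T_def)
qed

text \<open>Here u_k = u_k(0) + t v_k, and the factor t is moved to the element of the
  motive.\<close>

lemma delta0T_shift:
  assumes "\<And>k. k < r \<Longrightarrow> v k \<in> Tate (real q)" "l < d" "\<And>k i. k < r \<Longrightarrow> fps_nth (u k) (Suc i) = fps_nth (v k) i"
  shows "delta0T u x l = delta0T v (\<lambda>k. act tt (x k)) l + (\<Sum>k<r. fps_nth (u k) 0 * cf (x k) l 0)"
proof (rule delta0T_eqI)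
  have "pair_term u x l (Suc i) = pair_term v (\<lambda>k. act tt (x k)) l i" for i
    unfolding pair_term_def by (intro sum.cong refl) (simp add: assms(3) act_tt_pow_tt act_tt_pow_Suc del: power_Suc)
  then have "(\<lambda>i. pair_term u x l (Suc i)) sums delta0T v (\<lambda>k. act tt (x k)) l"
    using pair_sums[OF assms(1,2)] by simp
  moreover have "pair_term u x l 0 = (\<Sum>k<r. fps_nth (u k) 0 * cf (x k) l 0)"
    by (simp add: pair_term_def scale_one)
  ultimately show "pair_term u x l sums (delta0T v (\<lambda>k. act tt (x k)) l + (\<Sum>k<r. fps_nth (u k) 0 * cf (x k) l 0))"
    using sums_Suc by metis
qed

text \<open>Moves a factor such as (t - \<theta>)^N from the series to the motive, where \<delta>_0
  kills it.\<close>

lemma delta0T_poly_mult: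
  assumes "P \<in> polys_over Kb" "\<And>k. k < r \<Longrightarrow> u k \<in> Tate (real q)" "l < d"
  shows "delta0T (\<lambda>k. fps_of_poly P * u k) x l = delta0T u (\<lambda>k. act P (x k)) l"
  using assms(1)
proof (induction P arbitrary: x)
  case 0
  have "pair_term (\<lambda>k. 0) x l = (\<lambda>i. 0)" "pair_term u (\<lambda>k. 0) l = (\<lambda>i. 0)"
    using assms(3) by (auto simp: pair_term_def)
  then show ?case
    by (simp add: delta0T_def)
next
  case (pCons a P)
  have coeffs: "coeff (pCons a P) i \<in> Kb" for i
    using pCons.prems by (simp add: polys_over_def)
  have a: "a \<in> Kb" and P: "P \<in> polys_over Kb"
    using coeffs[of 0] coeffs[of "Suc _"] by (simp_all add: polys_over_def)
  have "act (pCons a P) y = act [:a:] y + act P (act tt y)" for y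
  proof -
    have "pCons a P = [:a:] + P * tt"
      by simp
    then have "act (pCons a P) y = act ([:a:] + P * tt) y"
      by (rule arg_cong)
    also have "\<dots> = act [:a:] y + act P (act tt y)"
      using a P by (simp only: scale_add_left scale_mult PK_closed(4,6) tt_PK)
    finally show ?thesis .
  qed
  then have "delta0T u (\<lambda>k. act (pCons a P) (x k)) l =
      delta0T u (\<lambda>k. act [:a:] (x k)) l + delta0T u (\<lambda>k. act P (act tt (x k))) l"
    using delta0T_add_right[where u = u and l = l and x = "\<lambda>k. act [:a:] (x k)" and y = "\<lambda>k. act P (act tt (x k))"] assms(2,3)
    by simp
  also have "\<dots> = delta0T (\<lambda>k. fps_const a * u k) x l + delta0T (\<lambda>k. fps_of_poly P * u k) (\<lambda>k. act tt (x k)) l"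
    using a P assms(3) by (simp add: delta0T_const pCons.IH)
  also have "delta0T (\<lambda>k. fps_of_poly P * u k) (\<lambda>k. act tt (x k)) l = delta0T (\<lambda>k. fps_X * (fps_of_poly P * u k)) x l"
    using assms by (subst delta0T_shift[where v = "\<lambda>k. fps_of_poly P * u k" and x = x]) (auto simp: Tate_poly_mult)
  also have "delta0T (\<lambda>k. fps_const a * u k) x l + \<dots> = delta0T (\<lambda>k. fps_of_poly (pCons a P) * u k) x l"
    unfolding fps_of_poly_pCons_mult using assms
    by (intro delta0T_add[symmetric]) (auto intro!: Tate_const_mult Tate_X_mult Tate_poly_mult)
  finally show ?case
    by simp
qed

lemma delta0T_poly:
  assumes D: "\<And>k. k < r \<Longrightarrow> degree (h k) < D" and l: "l < d"
  shows "delta0T (\<lambda>k. fps_of_poly (h k)) x l = (\<Sum>i<D. \<Sum>k<r. coeff (h k) i * cf (act (tt ^ i) (x k)) l 0)"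
proof (rule delta0T_eqI)
  have "pair_term (\<lambda>k. fps_of_poly (h k)) x l i = 0" if "i \<notin> {..<D}" for i
    unfolding pair_term_def
  proof (intro sum.neutral ballI)
    fix k
    assume "k \<in> {..<r}"
    then have "degree (h k) < i"
      using D[of k] that by simp
    then show "fps_nth (fps_of_poly (h k)) i * cf (act (tt ^ i) (x k)) l 0 = 0"
      by (simp add: coeff_eq_0)
  qed
  then have "pair_term (\<lambda>k. fps_of_poly (h k)) x l sums (\<Sum>i<D. pair_term (\<lambda>k. fps_of_poly (h k)) x l i)"
    by (intro sums_finite) auto
  then show "pair_term (\<lambda>k. fps_of_poly (h k)) x l sums (\<Sum>i<D. \<Sum>k<r. coeff (h k) i * cf (act (tt ^ i) (x k)) l 0)"
    by (simp add: pair_term_def)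
qed

lemma delta0_poly_index:
  assumes l: "l < d"
  shows "delta0_poly F \<theta> act \<sigma> r m d w h $ l = delta0T (\<lambda>k. fps_of_poly (h $ k)) m l"
proof -
  define D where "D = Suc (\<Sum>k<r. degree (h $ k))"
  have D: "degree (h $ k) < D" if "k < r" for k
    using that member_le_sum[of k "{..<r}" "\<lambda>k. degree (h $ k)"] by (simp add: D_def)
  have "delta0T (\<lambda>k. fps_of_poly (h $ k)) m l = (\<Sum>k<r. \<Sum>i<D. coeff (h $ k) i * cf (act (tt ^ i) (m k)) l 0)"
    by (subst delta0T_poly[OF D l]) (auto intro: sum.swap)
  also have "\<dots> = (\<Sum>k<r. \<Sum>i\<le>degree (h $ k). coeff (h $ k) i * cf (act (tt ^ i) (m k)) l 0)"
    using D by (intro sum.cong refl sum_poly_coeff_eq[symmetric, where g = "\<lambda>i c. c * cf (act (tt ^ i) (m _)) l 0"])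
      (auto intro: coeff_eq_0 less_le_trans)
  also have "\<dots> = delta0_poly F \<theta> act \<sigma> r m d w h $ l"
    using l by (simp add: delta0_poly_def delta0_index monom_altdef)
  finally show ?thesis
    by simp
qed

text \<open>The series is additive and vanishes on (t - \<theta>)^N u, so it agrees with
  \<open>delta0_poly\<close> on every admissible h; this is the uniqueness behind the
  \<open>THE\<close>. Existence is division with remainder for N = s.\<close>

lemma delta0_ext_eq:
  assumes g: "\<And>k. k < r \<Longrightarrow> g $ k \<in> Tate (real q)"
  shows "delta0_ext F \<theta> act \<sigma> r m d w g = vec d (delta0T (\<lambda>k. g $ k) m)"
proof -
  have key: "delta0_poly F \<theta> act \<sigma> r m d w h = vec d (delta0T (\<lambda>k. g $ k) m)"
    if N: "\<And>x. \<delta>\<^sub>0 (act ([:- \<theta>, 1:] ^ N) x) = 0\<^sub>v d"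
      and u: "\<And>j. j < r \<Longrightarrow> u $ j \<in> Tate (real q) \<and>
           g $ j = fps_of_poly (h $ j) + fps_of_poly ([:- \<theta>, 1:] ^ N) * u $ j" for N h u
  proof (rule eq_vecI)
    fix l
    assume "l < dim_vec (vec d (delta0T (\<lambda>k. g $ k) m))"
    then have l: "l < d"
      by simp
    let ?P = "[:- \<theta>, 1:] ^ N"
    have P: "?P \<in> polys_over Kb"
      by (intro polys_over_power is_subfield_K_bar theta_PK)
    have "delta0T (\<lambda>k. fps_of_poly ?P * u $ k) m l = delta0T (\<lambda>k. u $ k) (\<lambda>k. act ?P (m k)) l"
      using u l by (intro delta0T_poly_mult P) auto
    also have "\<dots> = 0"
    proof -
      have "cf (act (tt ^ i) (act ?P (m k))) l 0 = 0" for i k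
        using delta0_index[OF l, of "act ?P (act (tt ^ i) (m k))"] l
        by (simp add: N act_commute[OF tt_pow_PK P])
      then have "pair_term (\<lambda>k. u $ k) (\<lambda>k. act ?P (m k)) l = (\<lambda>i. 0)"
        by (auto simp: pair_term_def)
      then show ?thesis
        by (simp add: delta0T_def)
    qed
    finally have "delta0T (\<lambda>k. fps_of_poly (h $ k) + fps_of_poly ?P * u $ k) m l = delta0T (\<lambda>k. fps_of_poly (h $ k)) m l"
      using u l by (subst delta0T_add) (auto intro!: Tate_poly Tate_poly_mult)
    then have "delta0T (\<lambda>k. g $ k) m l = delta0T (\<lambda>k. fps_of_poly (h $ k)) m l"
      using u by (subst delta0T_cong[where v = "\<lambda>k. fps_of_poly (h $ k) + fps_of_poly ?P * u $ k"]) auto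
    then show "delta0_poly F \<theta> act \<sigma> r m d w h $ l = vec d (delta0T (\<lambda>k. g $ k) m) $ l"
      using l by (simp add: delta0_poly_index)
  qed (simp add: delta0_poly_def)
  have "\<forall>j. \<exists>hv. j < r \<longrightarrow> snd hv \<in> Tate (real q) \<and> g $ j = fps_of_poly (fst hv) + fps_of_poly ([:- \<theta>, 1:] ^ s) * snd hv"
    using Tate_division[OF g] by fastforce
  from choice[OF this] obtain hu where "\<And>j. j < r \<Longrightarrow> snd (hu j) \<in> Tate (real q) \<and>
      g $ j = fps_of_poly (fst (hu j)) + fps_of_poly ([:- \<theta>, 1:] ^ s) * snd (hu j)"
    by blast
  then obtain h u where hu: "\<And>j. j < r \<Longrightarrow> u j \<in> Tate (real q) \<and> g $ j = fps_of_poly (h j) + fps_of_poly ([:- \<theta>, 1:] ^ s) * u j"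
    by (rule that)
  show ?thesis
    unfolding delta0_ext_def vabs_theta
  proof (rule the_equality)
    show "\<exists>N h u. (\<forall>x. \<delta>\<^sub>0 (act ([:- \<theta>, 1:] ^ N) x) = 0\<^sub>v d) \<and>
        h \<in> carrier_vec r \<and> u \<in> carrier_vec r \<and>
        (\<forall>j<r. u $ j \<in> Tate (real q) \<and> g $ j = fps_of_poly (h $ j) + fps_of_poly ([:- \<theta>, 1:] ^ N) * u $ j) \<and>
        vec d (delta0T (\<lambda>k. g $ k) m) = delta0_poly F \<theta> act \<sigma> r m d w h"
      using hu delta0_s key[of s "vec r u" "vec r h"]
      by (intro exI[of _ s] exI[of _ "vec r h"] exI[of _ "vec r u"]) auto
  qed (use key in blast)
qed

lemma A0_delta0T:
  assumes u: "\<And>k. k < r \<Longrightarrow> u k \<in> Tate (real q)" and l: "l < d"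
  shows "(\<Sum>l'<d. A 0 $$ (l, l') * delta0T u x l') = delta0T u (\<lambda>k. act tt (x k)) l"
proof (rule delta0T_eqI[symmetric])
  have eq: "pair_term u (\<lambda>k. act tt (x k)) l i = (\<Sum>l'<d. A 0 $$ (l, l') * pair_term u x l' i)" for i
  proof -
    have "pair_term u (\<lambda>k. act tt (x k)) l i = (\<Sum>k<r. \<Sum>l'<d. A 0 $$ (l, l') * (fps_nth (u k) i * cf (act (tt ^ i) (x k)) l' 0))"
      using l by (simp add: pair_term_def act_tt_pow_tt cf0_act_tt sum_distrib_left mult.left_commute)
    then show ?thesis
      by (simp add: pair_term_def sum_distrib_left sum.swap[of _ "{..<r}"])
  qed
  have "(\<lambda>i. \<Sum>l'<d. A 0 $$ (l, l') * pair_term u x l' i) sums (\<Sum>l'<d. A 0 $$ (l, l') * delta0T u x l')"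
    by (intro sums_sum sums_vabs_mult_left pair_sums u) auto
  then show "pair_term u (\<lambda>k. act tt (x k)) l sums (\<Sum>l'<d. A 0 $$ (l, l') * delta0T u x l')"
    by (simp only: eq[abs_def, symmetric])
qed

section \<open>Additivity, and expansion in powers of t\<close>

lemma tau_poly_apply_sum:
  assumes l: "l < d"
  shows "tau_poly_apply q d A (vec d (\<lambda>l. \<Sum>x\<in>I. u x l)) $ l = (\<Sum>x\<in>I. tau_poly_apply q d A (vec d (u x)) $ l)"
proof -
  obtain M where M: "\<And>k. k \<ge> M \<Longrightarrow> A k = 0\<^sub>m d d"
    using A_bounded by blast
  have "tau_poly_apply q d A (vec d (\<lambda>l. \<Sum>x\<in>I. u x l)) $ l = (\<Sum>k<M. \<Sum>j<d. \<Sum>x\<in>I. A k $$ (l, j) * u x j ^ (q ^ k))"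
    using l M by (subst tau_poly_apply_index[where M = M]) (auto simp: frob_sum sum_distrib_left)
  also have "\<dots> = (\<Sum>k<M. \<Sum>x\<in>I. \<Sum>j<d. A k $$ (l, j) * u x j ^ (q ^ k))"
    by (intro sum.cong refl sum.swap)
  also have "\<dots> = (\<Sum>x\<in>I. \<Sum>k<M. \<Sum>j<d. A k $$ (l, j) * u x j ^ (q ^ k))"
    by (rule sum.swap)
  also have "\<dots> = (\<Sum>x\<in>I. tau_poly_apply q d A (vec d (u x)) $ l)"
    using l M by (intro sum.cong refl) (subst tau_poly_apply_index[where M = M], auto)
  finally show ?thesis .
qed

lemma act_poly_expand:
  assumes "a \<in> polys_over Kb" "degree a \<le> D"
  shows "act a x = (\<Sum>i\<le>D. act [:coeff a i:] (act (tt ^ i) x))"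
proof -
  have c: "coeff a i \<in> Kb" for i
    using assms(1) by (simp add: polys_over_def)
  have "a = (\<Sum>i\<le>D. monom (coeff a i) i)"
    using poly_as_sum_of_monoms'[OF assms(2)] by simp
  also have "\<dots> = (\<Sum>i\<le>D. [:coeff a i:] * tt ^ i)"
    by (simp add: monom_altdef)
  finally have "act a x = act (\<Sum>i\<le>D. [:coeff a i:] * tt ^ i) x"
    by (rule arg_cong)
  also have "\<dots> = (\<Sum>i\<le>D. act ([:coeff a i:] * tt ^ i) x)"
    by (intro act_sum_left PK_closed(4,6) c tt_pow_PK)
  also have "\<dots> = (\<Sum>i\<le>D. act [:coeff a i:] (act (tt ^ i) x))"
    by (intro sum.cong refl scale_mult PK_closed(6) c tt_pow_PK)
  finally show ?thesis .
qed

lemma delta1c_poly: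
  assumes "a \<in> polys_over Kb" "degree a \<le> D" "l < d"
  shows "delta1c c (act a x) l = (\<Sum>i\<le>D. delta1c (c * coeff a i) (act (tt ^ i) x) l)"
proof -
  have "coeff a i \<in> Kb" for i
    using assms(1) by (simp add: polys_over_def)
  then show ?thesis
    using assms by (subst act_poly_expand[OF assms(1,2)]) (simp add: delta1c_sum_right delta1c_const)
qed

lemma cf0_poly:
  assumes "a \<in> polys_over Kb" "degree a \<le> D" "l < d"
  shows "cf (act a x) l 0 = (\<Sum>i\<le>D. coeff a i * cf (act (tt ^ i) x) l 0)"
proof -
  have "coeff a i \<in> Kb" for i
    using assms(1) by (simp add: polys_over_def)
  then show ?thesis
    using assms by (subst act_poly_expand[OF assms(1,2)]) (simp add: cf_sum cf_const)
qed

text \<open>The difference consists of the terms with i \<ge> 1, which have degree q^i \<ge> 2 in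
  c.\<close>

lemma delta1c_close:
  assumes l: "l < d"
  shows "\<exists>C. \<forall>c. vabs c \<le> 1 \<longrightarrow> vabs (delta1c c x l - c * cf x l 0) \<le> C * vabs c ^ 2"
proof -
  define C where "C = (\<Sum>i<cf_bound x. vabs (cf x l i) ^ (q ^ i))"
  have "vabs (delta1c c x l - c * cf x l 0) \<le> C * vabs c ^ 2" if c: "vabs c \<le> 1" for c
  proof -
    obtain n where n: "cf_bound x = Suc n"
      by (simp add: cf_bound_def)
    have "delta1c c x l - c * cf x l 0 = (\<Sum>i<n. (c * cf x l (Suc i)) ^ (q ^ Suc i))"
      by (simp add: delta1c_def n sum.lessThan_Suc_shift del: sum.lessThan_Suc)
    moreover have "vabs (\<Sum>i<n. (c * cf x l (Suc i)) ^ (q ^ Suc i)) \<le> C * vabs c ^ 2"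
    proof (rule vabs_sum_le)
      fix i
      assume "i \<in> {..<n}"
      then have "vabs (cf x l (Suc i)) ^ (q ^ Suc i) \<le> C"
        unfolding C_def n by (intro member_le_sum[of "Suc i" _ "\<lambda>i. vabs (cf x l i) ^ (q ^ i)"]) auto
      moreover have "vabs c ^ (q ^ Suc i) \<le> vabs c ^ 2"
      proof (rule power_decreasing)
        show "2 \<le> q ^ Suc i"
          using power_increasing[of 1 "Suc i" q] q_ge_2 by (simp only: power_one_right) linarith
      qed (use c in auto)
      ultimately have "vabs c ^ (q ^ Suc i) * vabs (cf x l (Suc i)) ^ (q ^ Suc i) \<le> vabs c ^ 2 * C"
        by (intro mult_mono) auto
      then show "vabs ((c * cf x l (Suc i)) ^ (q ^ Suc i)) \<le> C * vabs c ^ 2"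
        by (simp add: vabs_power vabs_mult power_mult_distrib mult.commute[of C])
    qed (simp add: C_def sum_nonneg)
    ultimately show ?thesis
      by simp
  qed
  then show ?thesis
    by blast
qed

end

section \<open>Division by powers of \<open>t\<close>\<close>

locale row_solution = t_motive_exponential q F \<theta> act \<sigma> r d m w A K s Q
  for q :: nat and F :: "'c::{nonarch_valued_field, complete_space} set" and \<theta> :: 'c
    and act :: "'c poly \<Rightarrow> 'm::ab_group_add \<Rightarrow> 'm" and \<sigma> :: "'m \<Rightarrow> 'm"
    and r d :: nat and m w :: "nat \<Rightarrow> 'm" and A :: "nat \<Rightarrow> 'c mat" and K s :: nat and Q :: "nat \<Rightarrow> 'c mat" +
  fixes \<Phi>' :: "'c poly mat" and fp :: "nat \<Rightarrow> 'c poly" and g :: "nat \<Rightarrow> 'c fps"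
  assumes \<Phi>': "\<Phi>' \<in> carrier_mat r r" "elements_mat \<Phi>' \<subseteq> polys_over Kb"
    and \<sigma>m: "\<And>i. i < r \<Longrightarrow> \<sigma> (m i) = (\<Sum>j<r. act (\<Phi>' $$ (i, j)) (m j))"
    and fp: "\<And>j. j < r \<Longrightarrow> fp j \<in> polys_over Kb"
    and g_eq: "\<And>j. j < r \<Longrightarrow> g j = (\<Sum>k<r. fps_root (g k) * fps_of_poly (\<Phi>' $$ (k, j))) + fps_of_poly (fp j)"
    and g_Tate1: "\<And>j. j < r \<Longrightarrow> g j \<in> Tate 1"
begin

lemma \<Phi>'_PK: "i < r \<Longrightarrow> j < r \<Longrightarrow> \<Phi>' $$ (i, j) \<in> polys_over Kb"
  using \<Phi>' elements_matI[of \<Phi>' r r i j] by auto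

text \<open>
  With \<open>G = - g\<close> and \<open>G\<^sub>n\<close> the series with coefficients \<open>b n, b (n + 1), \<dots>\<close>, the coefficients of the
  polynomial \<open>h\<^sub>n = \<sigma> G\<^sub>n - G\<^sub>n\<close> are \<open>h n i\<close>; hence \<open>h\<^sub>0 = f\<close> and \<open>h\<^sub>n = t h\<^sub>n\<^sub>+\<^sub>1 + \<sigma> b\<^sub>n - b\<^sub>n\<close>.
\<close>
definition b :: "nat \<Rightarrow> nat \<Rightarrow> 'c" where
  "b n k = - fps_nth (g k) n"

definition h :: "nat \<Rightarrow> nat \<Rightarrow> nat \<Rightarrow> 'c" where
  "h n i k = (\<Sum>a\<le>i. \<Sum>j<r. root (b (n + a) j) * coeff (\<Phi>' $$ (j, k)) (i - a)) - b (n + i) k"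

lemma h_0:
  assumes k: "k < r"
  shows "h 0 i k = coeff (fp k) i"
proof -
  have "fps_nth (g k) i = (\<Sum>j<r. \<Sum>a\<le>i. root (fps_nth (g j) a) * coeff (\<Phi>' $$ (j, k)) (i - a)) + coeff (fp k) i"
    using arg_cong[OF g_eq[OF k], of "\<lambda>x. fps_nth x i"]
    by (simp add: fps_sum_nth fps_mult_nth atMost_atLeast0)
  also have "(\<Sum>j<r. \<Sum>a\<le>i. root (fps_nth (g j) a) * coeff (\<Phi>' $$ (j, k)) (i - a)) =
      (\<Sum>a\<le>i. \<Sum>j<r. root (fps_nth (g j) a) * coeff (\<Phi>' $$ (j, k)) (i - a))"
    by (rule sum.swap)
  finally show ?thesis
    by (simp add: h_def b_def twist_m1_minus sum_negf)
qed

lemma h_n_0: "h n 0 k = (\<Sum>j<r. root (b n j) * coeff (\<Phi>' $$ (j, k)) 0) - b n k"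
  by (simp add: h_def)

lemma h_Suc: "h (Suc n) i k = h n (Suc i) k - (\<Sum>j<r. root (b n j) * coeff (\<Phi>' $$ (j, k)) (Suc i))"
  unfolding h_def sum.atMost_Suc_shift by simp

definition D :: nat where
  "D = (\<Sum>k<r. degree (fp k)) + (\<Sum>(j, k)\<in>{..<r} \<times> {..<r}. degree (\<Phi>' $$ (j, k)))"

lemma degree_fp: "k < r \<Longrightarrow> degree (fp k) \<le> D"
  unfolding D_def using member_le_sum[of k "{..<r}" "\<lambda>k. degree (fp k)"] by simp

lemma degree_\<Phi>': "j < r \<Longrightarrow> k < r \<Longrightarrow> degree (\<Phi>' $$ (j, k)) \<le> D"
  unfolding D_def
  using member_le_sum[of "(j, k)" "{..<r} \<times> {..<r}" "\<lambda>(j, k). degree (\<Phi>' $$ (j, k))"] by simp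

lemma coeff_\<Phi>'_0: "j < r \<Longrightarrow> k < r \<Longrightarrow> i > D \<Longrightarrow> coeff (\<Phi>' $$ (j, k)) i = 0"
  using degree_\<Phi>'[of j k] by (intro coeff_eq_0) simp

text \<open>By definition the h_n are power series only. For n = 0 the series is the polynomial f,
  and each step subtracts coefficients of \<Phi>', so one degree bound serves for all n.\<close>

lemma h_vanish: "k < r \<Longrightarrow> i > D \<Longrightarrow> h n i k = 0"
proof (induction n arbitrary: i)
  case 0
  then show ?case
    using degree_fp[of k] by (simp add: h_0 coeff_eq_0)
next
  case (Suc n)
  then show ?case
    by (simp add: h_Suc coeff_\<Phi>'_0)
qed

text \<open>The image of t h_(n+1) = h_n - \<sigma> b_n + b_n under an additive map, where
  \<open>B c i k\<close> stands for the value at c t^i m_k and \<open>R j k\<close> for the part of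
  \<sigma> b_n in question. It is used once for \<delta>_1 and once for \<delta>_0.\<close>

lemma h_shuffle:
  fixes B :: "'c \<Rightarrow> nat \<Rightarrow> nat \<Rightarrow> 'c"
  assumes B: "\<And>x y i k. B (x - y) i k = B x i k - B y i k"
    and R: "\<And>j k. j < r \<Longrightarrow> k < r \<Longrightarrow> (\<Sum>i\<le>D. B (root (b n j) * coeff (\<Phi>' $$ (j, k)) i) i k) = R j k"
  shows "(\<Sum>i\<le>D. \<Sum>k<r. B (h (Suc n) i k) (Suc i) k) =
    (\<Sum>i\<le>D. \<Sum>k<r. B (h n i k) i k) - (\<Sum>j<r. \<Sum>k<r. R j k) + (\<Sum>k<r. B (b n k) 0 k)"
proof -
  have B0: "B 0 i k = 0" for i k
    using B[of 0 0] by simp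
  then have Bm: "B (- x) i k = - B x i k" for x i k
    using B[of 0 x] by simp
  then have Badd: "B (x + y) i k = B x i k + B y i k" for x y i k
    using B[of x "- y"] by simp
  have Bsum: "B (\<Sum>j\<in>I. f j) i k = (\<Sum>j\<in>I. B (f j) i k)" for I :: "nat set" and f i k
    by (induction I rule: infinite_finite_induct) (auto simp: B0 Badd)
  \<comment> \<open>\<open>G (Suc i)\<close> is the contribution of the coefficient of t^i in
    h_(n+1). Extended to index 0 the formula gives -b_n, the constant term that is lost in the
    division by t.\<close>
  define G where "G i = (\<Sum>k<r. B (h n i k) i k - (\<Sum>j<r. B (root (b n j) * coeff (\<Phi>' $$ (j, k)) i) i k))" for i
  have "(\<Sum>i\<le>D. \<Sum>k<r. B (h (Suc n) i k) (Suc i) k) = (\<Sum>i\<le>D. G (Suc i))"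
    by (simp add: G_def h_Suc B Bsum)
  also have "\<dots> = (\<Sum>i\<le>Suc D. G i) - G 0"
    by (simp only: sum.atMost_Suc_shift) simp
  also have "G (Suc D) = 0"
    unfolding G_def by (intro sum.neutral) (simp add: h_vanish coeff_\<Phi>'_0 B0)
  then have "(\<Sum>i\<le>Suc D. G i) = (\<Sum>i\<le>D. G i)"
    by simp
  also have "G 0 = - (\<Sum>k<r. B (b n k) 0 k)"
    by (simp add: G_def h_n_0 B Bsum sum_negf)
  finally have "(\<Sum>i\<le>D. \<Sum>k<r. B (h (Suc n) i k) (Suc i) k) = (\<Sum>i\<le>D. \<Sum>k<r. B (h n i k) i k)
      - (\<Sum>i\<le>D. \<Sum>k<r. \<Sum>j<r. B (root (b n j) * coeff (\<Phi>' $$ (j, k)) i) i k) + (\<Sum>k<r. B (b n k) 0 k)"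
    by (simp add: G_def sum_subtractf)
  also have "(\<Sum>i\<le>D. \<Sum>k<r. \<Sum>j<r. B (root (b n j) * coeff (\<Phi>' $$ (j, k)) i) i k) =
      (\<Sum>k<r. \<Sum>i\<le>D. \<Sum>j<r. B (root (b n j) * coeff (\<Phi>' $$ (j, k)) i) i k)"
    by (rule sum.swap)
  also have "\<dots> = (\<Sum>k<r. \<Sum>j<r. \<Sum>i\<le>D. B (root (b n j) * coeff (\<Phi>' $$ (j, k)) i) i k)"
    by (intro sum.cong refl sum.swap)
  also have "\<dots> = (\<Sum>k<r. \<Sum>j<r. R j k)"
    by (intro sum.cong refl R) auto
  also have "\<dots> = (\<Sum>j<r. \<Sum>k<r. R j k)"
    by (rule sum.swap)
  finally show ?thesis .
qed

text \<open>The vector y_n = \<delta>_1(h_n). For n > 0 the coefficients of h_n need not lie in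
  K_bar, hence \<open>delta1c\<close>.\<close>

definition yv :: "nat \<Rightarrow> 'c vec" where
  "yv n = vec d (\<lambda>l. \<Sum>i\<le>D. \<Sum>k<r. delta1c (h n i k) (act (tt ^ i) (m k)) l)"

lemma E_yv: "ex.E (yv (Suc n)) = yv n"
proof (rule eq_vecI)
  fix l
  assume "l < dim_vec (yv n)"
  then have l: "l < d"
    by (simp add: yv_def)
  have "ex.E (yv (Suc n)) $ l = (\<Sum>i\<le>D. \<Sum>k<r. delta1c (h (Suc n) i k) (act (tt ^ Suc i) (m k)) l)"
    using l by (simp add: yv_def tau_poly_apply_sum E_delta1c act_tt_pow_Suc del: power_Suc)
  also have "\<dots> = (\<Sum>i\<le>D. \<Sum>k<r. delta1c (h n i k) (act (tt ^ i) (m k)) l)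
      - (\<Sum>j<r. \<Sum>k<r. delta1c (root (b n j)) (act (\<Phi>' $$ (j, k)) (m k)) l)
      + (\<Sum>k<r. delta1c (b n k) (act (tt ^ 0) (m k)) l)"
    using l by (intro h_shuffle[of "\<lambda>c i k. delta1c c (act (tt ^ i) (m k)) l"] delta1c_diff_left delta1c_poly[symmetric])
      (auto simp: \<Phi>'_PK degree_\<Phi>')
  \<comment> \<open>Under \<delta>_1 the root of b_n times \<sigma> m_j has the same image as b_n
    times m_j, so the subtracted and the added sum cancel.\<close>
  also have "(\<Sum>j<r. \<Sum>k<r. delta1c (root (b n j)) (act (\<Phi>' $$ (j, k)) (m k)) l) = (\<Sum>j<r. delta1c (root (b n j)) (\<sigma> (m j)) l)"
    using l by (intro sum.cong refl) (simp add: \<sigma>m delta1c_sum_right)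
  also have "\<dots> = (\<Sum>j<r. delta1c (b n j) (m j) l)"
    using l by (simp add: delta1c_sigma)
  finally show "ex.E (yv (Suc n)) $ l = yv n $ l"
    using l by (simp add: yv_def scale_one)
qed (simp add: yv_def)

lemma yv_0: "yv 0 = \<delta>\<^sub>1 (\<Sum>k<r. act (fp k) (m k))"
proof (rule eq_vecI)
  fix l
  assume "l < dim_vec (\<delta>\<^sub>1 (\<Sum>k<r. act (fp k) (m k)))"
  then have l: "l < d"
    using carrier_vecD[OF delta1_carrier] by metis
  have "yv 0 $ l = (\<Sum>k<r. \<Sum>i\<le>D. delta1c (h 0 i k) (act (tt ^ i) (m k)) l)"
    using l by (simp add: yv_def sum.swap[of _ "{..D}"])
  also have "\<dots> = (\<Sum>k<r. delta1c 1 (act (fp k) (m k)) l)"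
    using l by (intro sum.cong refl) (simp add: h_0 delta1c_poly[OF fp degree_fp])
  finally show "yv 0 $ l = \<delta>\<^sub>1 (\<Sum>k<r. act (fp k) (m k)) $ l"
    using l by (simp add: delta1_index delta1c_sum_right)
qed (simp add: yv_def carrier_vecD[OF delta1_carrier])

text \<open>The q-th power of the rate for the roots is q^(-qn), weakened here to q^(-2n).\<close>

lemma b_decay:
  "\<exists>C\<ge>0. \<forall>n. \<forall>k<r. vabs (root (b n k)) \<le> C * (1 / q) ^ n \<and> vabs (b n k) \<le> C * (1 / q) ^ (2 * n)"
proof -
  obtain C where C: "C \<ge> 0" "\<And>n j. j < r \<Longrightarrow> vabs (root (fps_nth (g j) n)) * real q ^ n \<le> C"
    using row_decay[OF \<Phi>' \<sigma>m g_eq g_Tate1] by blast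
  have *: "vabs (root (b n k)) \<le> C * (1 / q) ^ n" if "k < r" for n k
    using C(2)[OF that, of n] by (simp add: b_def twist_m1_minus power_one_over field_simps)
  have "vabs (b n k) \<le> C ^ q * (1 / q) ^ (2 * n)" if "k < r" for n k
  proof -
    have "vabs (b n k) = vabs (root (b n k)) ^ q"
      by (simp add: vabs_twist_m1)
    also have "\<dots> \<le> (C * (1 / q) ^ n) ^ q"
      using *[OF that] by (intro power_mono) auto
    also have "\<dots> = C ^ q * (1 / q) ^ (q * n)"
      by (simp add: power_mult_distrib mult.commute flip: power_mult)
    also have "\<dots> \<le> C ^ q * (1 / q) ^ (2 * n)"
      using q_ge_2 C(1) by (intro mult_left_mono power_decreasing) auto
    finally show ?thesis .
  qed
  moreover have "C ^ q * (1 / q) ^ (2 * n) \<le> max C (C ^ q) * (1 / q) ^ (2 * n)" "C * (1 / q) ^ n \<le> max C (C ^ q) * (1 / q) ^ n" for n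
    by (intro mult_right_mono; simp)+
  ultimately show ?thesis
    using * C(1) by (intro exI[of _ "max C (C ^ q)"]) (fastforce intro: order_trans)
qed

section \<open>Truncated series and \<delta>_0\<close>

lemma inv_q [simp]: "0 \<le> 1 / real q" "1 / real q \<le> 1"
  using q_ge_2 by auto

lemma q_inv_power: "(1 / real q) ^ i * real q ^ i = 1"
  using q_ge_2 by (simp flip: power_mult_distrib)

definition bs :: "nat \<Rightarrow> nat \<Rightarrow> 'c fps" where
  "bs n k = Abs_fps (\<lambda>i. b (n + i) k)"

lemma bs_Tate: "k < r \<Longrightarrow> bs n k \<in> Tate (real q)"
proof -
  assume k: "k < r"
  obtain C where C: "C \<ge> 0" "\<And>n. vabs (b n k) \<le> C * (1 / q) ^ (2 * n)"
    using b_decay k by blast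
  have "(\<lambda>i. C * (1 / real q) ^ i) \<longlonglongrightarrow> C * 0"
    using q_ge_2 by (intro tendsto_mult_left LIMSEQ_realpow_zero) auto
  then have lim: "(\<lambda>i. C * (1 / real q) ^ i) \<longlonglongrightarrow> 0"
    by simp
  have "vabs (fps_nth (bs n k) i) * real q ^ i \<le> C * (1 / real q) ^ i" for i
  proof -
    have "vabs (b (n + i) k) * real q ^ i \<le> C * (1 / q) ^ (2 * i) * real q ^ i"
    proof (rule mult_right_mono)
      have "vabs (b (n + i) k) \<le> C * (1 / q) ^ (2 * (n + i))"
        by (rule C(2))
      also have "\<dots> \<le> C * (1 / q) ^ (2 * i)"
        by (intro mult_left_mono power_decreasing C(1) inv_q) simp_all
      finally show "vabs (b (n + i) k) \<le> C * (1 / q) ^ (2 * i)" .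
    qed simp
    also have "\<dots> = C * (1 / q) ^ i * ((1 / q) ^ i * real q ^ i)"
      by (simp add: mult_2 power_add)
    finally show ?thesis
      by (simp add: bs_def q_inv_power)
  qed
  then show ?thesis
    unfolding Tate_def by (intro CollectI tendsto_sandwich[OF _ _ tendsto_const lim]) auto
qed

lemma g_Tate: "k < r \<Longrightarrow> g k \<in> Tate (real q)"
proof -
  assume "k < r"
  moreover have "bs 0 k = - g k"
    by (intro fps_ext) (simp add: bs_def b_def)
  ultimately show ?thesis
    using bs_Tate[of k 0] Tate_minus[of "bs 0 k"] by simp
qed

text \<open>The vector z_n, split into the polynomial h_n and the convergent series G_n. Although
  h_n + G_n = \<sigma> G_n, the rule that \<delta>_0 kills \<sigma> cannot be applied termwise: the
  twist of G_n is only known to have coefficients O(q^-i), which does not ensure convergence at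
  \<theta>.\<close>

definition zv :: "nat \<Rightarrow> 'c vec" where
  "zv n = vec d (\<lambda>l. (\<Sum>i\<le>D. \<Sum>k<r. h n i k * cf (act (tt ^ i) (m k)) l 0) + delta0T (bs n) m l)"

lemma A0_zv: "A 0 *\<^sub>v zv (Suc n) = zv n"
proof (rule eq_vecI)
  fix l
  assume "l < dim_vec (zv n)"
  then have l: "l < d"
    by (simp add: zv_def)
  have "(A 0 *\<^sub>v zv (Suc n)) $ l =
      (\<Sum>l'<d. A 0 $$ (l, l') * (\<Sum>i\<le>D. \<Sum>k<r. h (Suc n) i k * cf (act (tt ^ i) (m k)) l' 0))
      + (\<Sum>l'<d. A 0 $$ (l, l') * delta0T (bs (Suc n)) m l')"
    using l by (subst index_mat_vec[of _ d]) (auto simp: zv_def A_carrier distrib_left sum.distrib)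
  also have "(\<Sum>l'<d. A 0 $$ (l, l') * delta0T (bs (Suc n)) m l') = delta0T (bs (Suc n)) (\<lambda>k. act tt (m k)) l"
    using l by (intro A0_delta0T bs_Tate)
  also have "(\<Sum>l'<d. A 0 $$ (l, l') * (\<Sum>i\<le>D. \<Sum>k<r. h (Suc n) i k * cf (act (tt ^ i) (m k)) l' 0)) =
      (\<Sum>l'<d. \<Sum>i\<le>D. \<Sum>k<r. A 0 $$ (l, l') * (h (Suc n) i k * cf (act (tt ^ i) (m k)) l' 0))"
    by (simp add: sum_distrib_left)
  also have "\<dots> = (\<Sum>i\<le>D. \<Sum>l'<d. \<Sum>k<r. A 0 $$ (l, l') * (h (Suc n) i k * cf (act (tt ^ i) (m k)) l' 0))"
    by (rule sum.swap)
  also have "\<dots> = (\<Sum>i\<le>D. \<Sum>k<r. \<Sum>l'<d. A 0 $$ (l, l') * (h (Suc n) i k * cf (act (tt ^ i) (m k)) l' 0))"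
    by (intro sum.cong refl sum.swap)
  also have "\<dots> = (\<Sum>i\<le>D. \<Sum>k<r. h (Suc n) i k * cf (act (tt ^ Suc i) (m k)) l 0)"
    using l by (intro sum.cong refl) (simp add: act_tt_pow_Suc cf0_act_tt sum_distrib_left mult.left_commute del: power_Suc)
  also have "\<dots> = (\<Sum>i\<le>D. \<Sum>k<r. h n i k * cf (act (tt ^ i) (m k)) l 0)
      - (\<Sum>j<r. \<Sum>k<r. root (b n j) * cf (act (\<Phi>' $$ (j, k)) (m k)) l 0)
      + (\<Sum>k<r. b n k * cf (act (tt ^ 0) (m k)) l 0)"
  proof (rule h_shuffle[of "\<lambda>c i k. c * cf (act (tt ^ i) (m k)) l 0"])
    show "(\<Sum>i\<le>D. root (b n j) * coeff (\<Phi>' $$ (j, k)) i * cf (act (tt ^ i) (m k)) l 0) =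
        root (b n j) * cf (act (\<Phi>' $$ (j, k)) (m k)) l 0" if "j < r" "k < r" for j k
      using l that by (simp add: cf0_poly[OF \<Phi>'_PK degree_\<Phi>'] sum_distrib_left mult.assoc)
  qed (rule left_diff_distrib)
  \<comment> \<open>Unlike \<delta>_1, the map \<delta>_0 kills \<sigma> m_j. The remaining sum over
    b_n is cancelled by the constant term that \<open>delta0T_shift\<close> splits off from
    G_n.\<close>
  also have "(\<Sum>j<r. \<Sum>k<r. root (b n j) * cf (act (\<Phi>' $$ (j, k)) (m k)) l 0) = (\<Sum>j<r. root (b n j) * cf (\<sigma> (m j)) l 0)"
    using l by (intro sum.cong refl) (simp add: \<sigma>m cf_sum sum_distrib_left)
  also have "\<dots> = 0"
    using l by (simp add: cf_sigma)
  also have "delta0T (bs (Suc n)) (\<lambda>k. act tt (m k)) l = delta0T (bs n) m l - (\<Sum>k<r. b n k * cf (m k) l 0)"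
    using l by (subst delta0T_shift[where u = "bs n" and v = "bs (Suc n)"]) (auto simp: bs_Tate, auto simp: bs_def)
  finally show "(A 0 *\<^sub>v zv (Suc n)) $ l = zv n $ l"
    using l by (simp add: zv_def scale_one)
qed (use A_carrier[of 0] in \<open>simp add: zv_def\<close>)

lemma zv_0: "zv 0 = vec d (delta0T (\<lambda>k. fps_of_poly (fp k) - g k) m)"
proof (rule eq_vecI)
  fix l
  assume "l < dim_vec (vec d (delta0T (\<lambda>k. fps_of_poly (fp k) - g k) m))"
  then have l: "l < d"
    by simp
  have "bs 0 k = - g k" for k
    by (intro fps_ext) (simp add: bs_def b_def)
  then have "delta0T (\<lambda>k. fps_of_poly (fp k) - g k) m l = delta0T (\<lambda>k. fps_of_poly (fp k) + bs 0 k) m l"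
    by simp
  also have "\<dots> = delta0T (\<lambda>k. fps_of_poly (fp k)) m l + delta0T (bs 0) m l"
    using l by (intro delta0T_add Tate_poly bs_Tate)
  also have "delta0T (\<lambda>k. fps_of_poly (fp k)) m l = (\<Sum>i<Suc D. \<Sum>k<r. coeff (fp k) i * cf (act (tt ^ i) (m k)) l 0)"
    using degree_fp l by (intro delta0T_poly) (auto simp: less_Suc_eq_le)
  also have "\<dots> = (\<Sum>i\<le>D. \<Sum>k<r. h 0 i k * cf (act (tt ^ i) (m k)) l 0)"
    by (simp only: lessThan_Suc_atMost) (simp add: h_0)
  finally show "zv 0 $ l = vec d (delta0T (\<lambda>k. fps_of_poly (fp k) - g k) m) $ l"
    using l by (simp add: zv_def)
qed (simp add: zv_def)

text \<open>Every summand of \<open>h n i k\<close> contains a coefficient of index at least n, or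
  its root. The ultrametric inequality ignores the number of summands, so the bound is uniform in
  i.\<close>

lemma h_decay: "\<exists>C\<ge>0. \<forall>n i. \<forall>k<r. vabs (h n i k) \<le> C * (1 / q) ^ n"
proof -
  obtain C where C: "C \<ge> 0" "\<And>n k. k < r \<Longrightarrow> vabs (root (b n k)) \<le> C * (1 / q) ^ n"
    "\<And>n k. k < r \<Longrightarrow> vabs (b n k) \<le> C * (1 / q) ^ (2 * n)"
    using b_decay by blast
  have "\<exists>B\<ge>0. \<forall>x\<in>{..<r} \<times> {..<r}. \<forall>i. vabs (coeff (\<Phi>' $$ x) i) \<le> B"
  proof (rule uniform_bound)
    fix x
    have "vabs (coeff (\<Phi>' $$ x) i) \<le> (\<Sum>i\<le>degree (\<Phi>' $$ x). vabs (coeff (\<Phi>' $$ x) i))" for i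
      by (cases "i \<le> degree (\<Phi>' $$ x)") (auto intro!: member_le_sum sum_nonneg simp: coeff_eq_0)
    then show "\<exists>C. \<forall>i. vabs (coeff (\<Phi>' $$ x) i) \<le> C"
      by blast
  qed (auto intro: order_trans)
  then obtain B where B: "B \<ge> 0" "\<And>j k i. j < r \<Longrightarrow> k < r \<Longrightarrow> vabs (coeff (\<Phi>' $$ (j, k)) i) \<le> B"
    by blast
  have "vabs (h n i k) \<le> (C * B + C) * (1 / q) ^ n" if k: "k < r" for n i k
  proof -
    have nn: "0 \<le> C * (1 / q) ^ n" "0 \<le> C * B * (1 / q) ^ n"
      using C(1) B(1) by simp_all
    have "vabs (b (n + i) k) \<le> C * (1 / q) ^ (2 * (n + i))"
      by (rule C(3)[OF k])
    also have "\<dots> \<le> C * (1 / q) ^ n"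
      by (intro mult_left_mono power_decreasing C(1) inv_q) simp
    finally have 1: "vabs (b (n + i) k) \<le> (C * B + C) * (1 / q) ^ n"
      using nn by (simp add: distrib_right)
    have "vabs (root (b (n + a) j) * coeff (\<Phi>' $$ (j, k)) (i - a)) \<le> (C * B + C) * (1 / q) ^ n" if "j < r" for a j
    proof -
      have "vabs (root (b (n + a) j)) \<le> C * (1 / q) ^ (n + a)"
        by (rule C(2)[OF that])
      also have "\<dots> \<le> C * (1 / q) ^ n"
        by (intro mult_left_mono power_decreasing C(1) inv_q) simp
      finally have "vabs (root (b (n + a) j)) * vabs (coeff (\<Phi>' $$ (j, k)) (i - a)) \<le> C * (1 / q) ^ n * B"
        using B(2)[OF that k] nn by (intro mult_mono) auto
      then show ?thesis
        using nn by (simp add: vabs_mult distrib_right mult_ac)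
    qed
    then have "vabs (\<Sum>a\<le>i. \<Sum>j<r. root (b (n + a) j) * coeff (\<Phi>' $$ (j, k)) (i - a)) \<le> (C * B + C) * (1 / q) ^ n"
      using nn by (intro vabs_sum_le) (auto simp: distrib_right)
    then show ?thesis
      unfolding h_def using 1 by (intro vabs_diff_leI)
  qed
  moreover have "C * B + C \<ge> 0"
    using C(1) B(1) by simp
  ultimately show ?thesis
    by blast
qed

lemma cf_tt_uniform_bound:
  "\<exists>C\<ge>0. \<forall>i. \<forall>k<r. \<forall>l<d. vabs (cf (act (tt ^ i) (m k)) l 0) \<le> C * real q ^ i"
proof -
  have "\<exists>C\<ge>0. \<forall>k\<in>{..<r}. \<forall>i. \<forall>l<d. vabs (cf (act (tt ^ i) (m k)) l 0) \<le> C * real q ^ i"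
  proof (rule uniform_bound)
    show "\<exists>C. \<forall>i. \<forall>l<d. vabs (cf (act (tt ^ i) (m k)) l 0) \<le> C * real q ^ i" for k
      by (rule cf_tt_bound)
  next
    fix k C C'
    assume *: "\<forall>i. \<forall>l<d. vabs (cf (act (tt ^ i) (m k)) l 0) \<le> C * real q ^ i" "C \<le> (C'::real)"
    have "C * real q ^ i \<le> C' * real q ^ i" for i
      using *(2) by (intro mult_right_mono) auto
    then show "\<forall>i. \<forall>l<d. vabs (cf (act (tt ^ i) (m k)) l 0) \<le> C' * real q ^ i"
      using *(1) order_trans by blast
  qed simp
  then show ?thesis
    by blast
qed

text \<open>The growth q^i of \<delta>_0(t^i m_k) is outweighed by the factor q^(-2i) in the bound
  for b_(n+i).\<close>

lemma tail_decay: "\<exists>C\<ge>0. \<forall>n. \<forall>l<d. vabs (delta0T (bs n) m l) \<le> C * (1 / q) ^ (2 * n)"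
proof -
  obtain C where C: "C \<ge> 0" "\<And>n k. k < r \<Longrightarrow> vabs (b n k) \<le> C * (1 / q) ^ (2 * n)"
    using b_decay by blast
  obtain B where B: "B \<ge> 0" "\<And>i k l. k < r \<Longrightarrow> l < d \<Longrightarrow> vabs (cf (act (tt ^ i) (m k)) l 0) \<le> B * real q ^ i"
    using cf_tt_uniform_bound by blast
  have "vabs (delta0T (bs n) m l) \<le> C * B * (1 / q) ^ (2 * n)" if l: "l < d" for n l
  proof (rule vabs_sums_le[OF pair_sums[OF bs_Tate l]])
    fix i
    have nn: "0 \<le> C * B * (1 / q) ^ (2 * n)"
      using C(1) B(1) by simp
    have "vabs (b (n + i) k * cf (act (tt ^ i) (m k)) l 0) \<le> C * B * (1 / q) ^ (2 * n)" if k: "k < r" for k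
    proof -
      have "vabs (b (n + i) k * cf (act (tt ^ i) (m k)) l 0) \<le> (C * (1 / q) ^ (2 * (n + i))) * (B * real q ^ i)"
        unfolding vabs_mult using C(1) B(1) by (intro mult_mono C(2)[OF k] B(2)[OF k l]) auto
      also have "\<dots> = C * B * (1 / q) ^ (2 * n) * ((1 / q) ^ i * ((1 / q) ^ i * real q ^ i))"
        by (simp add: distrib_left mult_2 power_add)
      also have "\<dots> = C * B * (1 / q) ^ (2 * n) * (1 / q) ^ i"
        by (simp add: q_inv_power)
      also have "\<dots> \<le> C * B * (1 / q) ^ (2 * n) * 1"
        using nn by (intro mult_left_mono power_le_one inv_q)
      finally show ?thesis
        by simp
    qed
    then show "vabs (pair_term (bs n) m l i) \<le> C * B * (1 / q) ^ (2 * n)"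
      unfolding pair_term_def using nn by (intro vabs_sum_le) (auto simp: bs_def)
  qed
  moreover have "C * B \<ge> 0"
    using C(1) B(1) by simp
  ultimately show ?thesis
    by blast
qed

lemma delta1c_uniform_close:
  "\<exists>C\<ge>0. \<forall>i\<le>D. \<forall>k<r. \<forall>l<d. \<forall>c. vabs c \<le> 1 \<longrightarrow>
     vabs (delta1c c (act (tt ^ i) (m k)) l - c * cf (act (tt ^ i) (m k)) l 0) \<le> C * vabs c ^ 2"
proof -
  let ?P = "\<lambda>(i, k, l) C. \<forall>c. vabs c \<le> 1 \<longrightarrow>
     vabs (delta1c c (act (tt ^ i) (m k)) l - c * cf (act (tt ^ i) (m k)) l 0) \<le> C * vabs c ^ 2"
  have "\<exists>C\<ge>0. \<forall>x\<in>{..D} \<times> {..<r} \<times> {..<d}. ?P x C"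
  proof (rule uniform_bound)
    show "\<exists>C. ?P x C" if "x \<in> {..D} \<times> {..<r} \<times> {..<d}" for x
      using that delta1c_close by (cases x) auto
  next
    fix x and C C' :: real
    assume *: "?P x C" "C \<le> C'"
    obtain i k l where x: "x = (i, k, l)"
      by (metis prod_cases3)
    have "C * vabs c ^ 2 \<le> C' * vabs c ^ 2" for c :: 'c
      using *(2) by (intro mult_right_mono) auto
    then show "?P x C'"
      using *(1) unfolding x by (auto intro: order_trans)
  qed simp
  then show ?thesis
    by fastforce
qed

text \<open>In z_n the part \<delta>_0(h_n) dominates, with rate q^-n. In y_n - z_n it is replaced
  by the quadratic defect of \<delta>_1 against \<delta>_0 at h_n, and what else remains is the
  tail.\<close>

lemma Exp_zv: "ex.Exp (zv 0) = yv 0"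
proof -
  obtain Ch where Ch: "Ch \<ge> 0" "\<And>n i k. k < r \<Longrightarrow> vabs (h n i k) \<le> Ch * (1 / q) ^ n"
    using h_decay by blast
  obtain B where B: "B \<ge> 0" "\<And>i k l. k < r \<Longrightarrow> l < d \<Longrightarrow> vabs (cf (act (tt ^ i) (m k)) l 0) \<le> B * real q ^ i"
    using cf_tt_uniform_bound by blast
  obtain Ct where Ct: "Ct \<ge> 0" "\<And>n l. l < d \<Longrightarrow> vabs (delta0T (bs n) m l) \<le> Ct * (1 / q) ^ (2 * n)"
    using tail_decay by blast
  obtain Cd where Cd: "Cd \<ge> 0" "\<And>i k l c. i \<le> D \<Longrightarrow> k < r \<Longrightarrow> l < d \<Longrightarrow> vabs c \<le> 1 \<Longrightarrow>
     vabs (delta1c c (act (tt ^ i) (m k)) l - c * cf (act (tt ^ i) (m k)) l 0) \<le> Cd * vabs c ^ 2"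
    using delta1c_uniform_close by blast
  obtain Cs where Cs: "Cs \<ge> 1"
    "\<And>v B. v \<in> carrier_vec d \<Longrightarrow> B \<ge> 0 \<Longrightarrow> \<forall>i<d. vabs (v $ i) \<le> B \<Longrightarrow> ex.nrm v \<le> Cs * B"
    using ex.nrm_le_sup by blast
  \<comment> \<open>The summands control \<delta>_0(h_n), the tail and the quadratic defect, in this
    order; q^D bounds the growth of \<delta>_0(t^i m_k) for i \<le> D.\<close>
  define C where "C = Ch * B * real q ^ D + Ct + Cd * Ch ^ 2"
  let ?g = "1 / real q"
  have nn: "0 \<le> Ch * B * real q ^ D" "0 \<le> Cd * Ch ^ 2" "C \<ge> 0"
    using Ch(1) B(1) Ct(1) Cd(1) by (simp_all add: C_def)
  have C_ge: "Ch * B * real q ^ D * x \<le> C * x" "Ct * x \<le> C * x" "Cd * Ch ^ 2 * x \<le> C * x" if "0 \<le> x" for x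
    using nn Ct(1) that by (auto simp: C_def intro!: mult_right_mono)
  have "(\<lambda>n. Ch * ?g ^ n) \<longlonglongrightarrow> Ch * 0"
    using q_ge_2 by (intro tendsto_mult_left LIMSEQ_realpow_zero) auto
  \<comment> \<open>From \<open>n0\<close> on the coefficients of h_n have absolute value at most 1,
    the range in which the quadratic estimate holds.\<close>
  then obtain n0 where n0: "\<And>n. n \<ge> n0 \<Longrightarrow> Ch * ?g ^ n < 1"
    using order_tendstoD(2)[of "\<lambda>n. Ch * ?g ^ n" 0 sequentially 1] by (auto simp: eventually_sequentially)
  show ?thesis
  proof (rule ex.Exp_eqI[where ?n0.0 = n0 and C = "Cs * C"])
    show "yv n \<in> carrier_vec d" "zv n \<in> carrier_vec d" for n
      by (simp_all add: yv_def zv_def)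
    show "ex.nrm (zv n) \<le> Cs * C * ?g ^ n" for n
    proof -
      have "vabs (zv n $ l) \<le> C * ?g ^ n" if l: "l < d" for l
      proof -
        have "vabs (h n i k * cf (act (tt ^ i) (m k)) l 0) \<le> C * ?g ^ n" if "i \<le> D" "k < r" for i k
        proof -
          have "B * real q ^ i \<le> B * real q ^ D"
            using B(1) q_ge_2 that by (intro mult_left_mono power_increasing) auto
          then have "vabs (cf (act (tt ^ i) (m k)) l 0) \<le> B * real q ^ D"
            using B(2)[OF that(2) l, of i] by linarith
          then have "vabs (h n i k * cf (act (tt ^ i) (m k)) l 0) \<le> (Ch * ?g ^ n) * (B * real q ^ D)"
            unfolding vabs_mult using Ch that by (intro mult_mono) auto
          also have "\<dots> = Ch * B * real q ^ D * ?g ^ n"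
            by simp
          also have "\<dots> \<le> C * ?g ^ n"
            by (rule C_ge(1)) simp
          finally show ?thesis .
        qed
        then have "vabs (\<Sum>i\<le>D. \<Sum>k<r. h n i k * cf (act (tt ^ i) (m k)) l 0) \<le> C * ?g ^ n"
          using nn(3) by (intro vabs_sum_le) auto
        moreover have "vabs (delta0T (bs n) m l) \<le> C * ?g ^ n"
        proof -
          have "Ct * ?g ^ (2 * n) \<le> Ct * ?g ^ n"
            by (intro mult_left_mono power_decreasing Ct(1) inv_q) simp
          moreover have "Ct * ?g ^ n \<le> C * ?g ^ n"
            by (rule C_ge(2)) simp
          ultimately show ?thesis
            using Ct(2)[OF l, of n] by linarith
        qed
        ultimately show ?thesis
          using l by (simp add: zv_def vabs_add_leI)
      qed
      then show ?thesis
        using Cs(2)[of "zv n" "C * ?g ^ n"] nn(3) by (simp add: zv_def mult.assoc)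
    qed
    show "ex.nrm (yv n - zv n) \<le> Cs * C * ?g ^ (2 * n)" if n: "n \<ge> n0" for n
    proof -
      have "vabs ((yv n - zv n) $ l) \<le> C * ?g ^ (2 * n)" if l: "l < d" for l
      proof -
        let ?t = "\<lambda>i k. delta1c (h n i k) (act (tt ^ i) (m k)) l - h n i k * cf (act (tt ^ i) (m k)) l 0"
        have "vabs (?t i k) \<le> C * ?g ^ (2 * n)" if ik: "i \<le> D" "k < r" for i k
        proof -
          have h1: "vabs (h n i k) \<le> Ch * ?g ^ n"
            by (rule Ch(2)[OF ik(2)])
          then have "vabs (?t i k) \<le> Cd * vabs (h n i k) ^ 2"
            using n0[OF n] by (intro Cd(2) ik l) simp
          also have "\<dots> \<le> Cd * (Ch * ?g ^ n) ^ 2"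
            using h1 Cd(1) by (intro mult_left_mono power_mono) auto
          also have "\<dots> = Cd * Ch ^ 2 * ?g ^ (2 * n)"
            by (simp add: power_mult_distrib mult.commute[of 2] flip: power_mult)
          also have "\<dots> \<le> C * ?g ^ (2 * n)"
            by (rule C_ge(3)) simp
          finally show ?thesis .
        qed
        then have "vabs (\<Sum>i\<le>D. \<Sum>k<r. ?t i k) \<le> C * ?g ^ (2 * n)"
          using nn(3) by (intro vabs_sum_le) auto
        moreover have "vabs (delta0T (bs n) m l) \<le> C * ?g ^ (2 * n)"
          by (rule order_trans[OF Ct(2)[OF l] C_ge(2)]) simp
        moreover have "(yv n - zv n) $ l = (\<Sum>i\<le>D. \<Sum>k<r. ?t i k) - delta0T (bs n) m l"
          using l by (simp add: yv_def zv_def sum_subtractf)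
        ultimately show ?thesis
          by (simp add: vabs_diff_leI)
      qed
      moreover have "yv n - zv n \<in> carrier_vec d"
        by (simp add: yv_def zv_def)
      ultimately show ?thesis
        using Cs(2)[of "yv n - zv n" "C * ?g ^ (2 * n)"] nn(3) by (simp add: mult.assoc)
    qed
    show "Cs * C \<ge> 0"
      using Cs(1) nn(3) by simp
  qed (rule E_yv A0_zv)+
qed

end

theorem theorem3p8:
  fixes q r d :: nat
    and F :: "'c::{nonarch_valued_field, complete_space} set" and \<theta> :: 'c
    and act :: "'c poly \<Rightarrow> 'm::ab_group_add \<Rightarrow> 'm" and \<sigma> :: "'m \<Rightarrow> 'm"
    and m w :: "nat \<Rightarrow> 'm"
    and \<Phi>' \<Phi> f :: "'c poly mat"
    and E :: "'c \<Rightarrow> nat \<Rightarrow> 'c mat" and Q :: "nat \<Rightarrow> 'c mat"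
    and \<Psi> \<Upsilon> :: "'c fls mat" and \<Upsilon>' \<Upsilon>\<^sub>r :: "'c fps mat"
  assumes "effective_dual_t_motive q F \<theta> act \<sigma>"
    and "Kt_basis F \<theta> act r m"
    and "Ksigma_basis F \<theta> act \<sigma> d w"
    and "\<Phi>' \<in> carrier_mat r r" "elements_mat \<Phi>' \<subseteq> polys_over (K_bar F \<theta>)"
    and "\<And>i. i < r \<Longrightarrow> \<sigma> (m i) = (\<Sum>j<r. act (\<Phi>' $$ (i, j)) (m j))"
    and "associated_t_module q F \<theta> act \<sigma> d w E"
    and "exponential_series q F \<theta> d E Q"
    and "f \<in> carrier_mat 1 r" "elements_mat f \<subseteq> polys_over (K_bar F \<theta>)"
    and "\<Phi> = four_block_mat \<Phi>' (0\<^sub>m r 1) f (1\<^sub>m 1)"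
    and "\<Psi> \<in> carrier_mat (r + 1) (r + 1)" "elements_mat \<Psi> \<subseteq> Tate_fractions"
    and "map_mat (twist_fls q (- 1)) \<Psi> = map_mat poly_to_fls \<Phi> * \<Psi>"
    and "\<Upsilon> \<in> carrier_mat (r + 1) (r + 1)" "inverts_mat \<Psi> \<Upsilon>" "inverts_mat \<Upsilon> \<Psi>"
    and "\<Upsilon>' \<in> carrier_mat r r" "elements_mat \<Upsilon>' \<subseteq> Tate 1"
    and "\<Upsilon>\<^sub>r \<in> carrier_mat 1 r" "elements_mat \<Upsilon>\<^sub>r \<subseteq> Tate 1"
    and "\<Upsilon> = four_block_mat (map_mat fps_to_fls \<Upsilon>') (0\<^sub>m r 1) (map_mat fps_to_fls \<Upsilon>\<^sub>r) (1\<^sub>m 1)"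
  shows "elements_mat \<Upsilon>\<^sub>r \<subseteq> Tate (vabs \<theta>) \<and>
    (let z = delta0_ext F \<theta> act \<sigma> r m d w
               (col (transpose_mat (map_mat fps_of_poly f) - transpose_mat \<Upsilon>\<^sub>r) 0);
         v = delta1 q F \<theta> act \<sigma> d w (\<Sum>j<r. act (f $$ (0, j)) (m j))
     in is_unit_point q F \<theta> d Q z \<and> Exp_value q d Q z = v)"
proof -
  interpret motive: motive_with_bases q F \<theta> act \<sigma> r d m w
    using assms(1-3) by (simp add: motive_with_bases_def motive_with_bases_axioms_def)
  \<comment> \<open>The hypotheses on \<open>E\<close> are indexed by a(t); the polynomial t turns
    them into statements on E'_\<theta>.\<close>
  define A where "A = E \<theta>"
  have tt: "[:0, 1:] \<in> polys_over F"
    using is_subfieldD(1,2)[OF motive.subfield] by (auto simp: polys_over_def coeff_pCons split: nat.split)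
  have A: "A k \<in> carrier_mat d d" "finite {k. A k \<noteq> 0\<^sub>m d d}"
    "tau_poly_apply q d A (delta1 q F \<theta> act \<sigma> d w x) = delta1 q F \<theta> act \<sigma> d w (act [:0, 1:] x)" for k x
    using bspec[OF assms(7)[unfolded associated_t_module_def] tt] by (simp_all add: A_def)
  interpret t_module: t_module_of_motive q F \<theta> act \<sigma> r d m w A
    by unfold_locales (fact A)+
  obtain M where M: "\<forall>k\<ge>M. A k = 0\<^sub>m d d"
    using t_module.A_bounded by blast
  obtain s where s: "s > 0" "\<And>v. v \<in> carrier_vec d \<Longrightarrow> ((\<lambda>v. A 0 *\<^sub>v v - \<theta> \<cdot>\<^sub>v v) ^^ s) v = 0\<^sub>v d"
    "\<And>x. delta0 F \<theta> act \<sigma> d w (act ([:- \<theta>, 1:] ^ s) x) = 0\<^sub>v d"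
    using t_module.nilpotent_ex by blast
  have Q: "Q n \<in> carrier_mat d d" "Q 0 = 1\<^sub>m d" for n
    using assms(8) by (simp_all add: exponential_series_def)
  have Q_rec: "(Q n * map_mat (twist q (int n)) (A 0)) $$ (i, j) =
      (\<Sum>k\<le>n. (A k * map_mat (twist q (int k)) (Q (n - k))) $$ (i, j))" if "i < d" "j < d" for n i j
    using assms(8) tt that unfolding exponential_series_def A_def by (auto dest!: bspec[of _ _ "[:0, 1:]"])
  interpret ex: t_motive_exponential q F \<theta> act \<sigma> r d m w A M s Q
    by unfold_locales (use A(1) M Q Q_rec s in auto)
  have row: "\<Upsilon>\<^sub>r $$ (0, j) = (\<Sum>k<r. motive.fps_root (\<Upsilon>\<^sub>r $$ (0, k)) * fps_of_poly (\<Phi>' $$ (k, j))) + fps_of_poly (f $$ (0, j))"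
    if "j < r" for j
    by (rule motive.row_equation[OF assms(4,9,11,12,14-18,20,22) that])
  interpret sol: row_solution q F \<theta> act \<sigma> r d m w A M s Q \<Phi>' "\<lambda>j. f $$ (0, j)" "\<lambda>j. \<Upsilon>\<^sub>r $$ (0, j)"
  proof unfold_locales
    show "f $$ (0, j) \<in> polys_over (K_bar F \<theta>)" if "j < r" for j
      using elements_matI[OF assms(9), of 0 j] assms(10) that by auto
    show "\<Upsilon>\<^sub>r $$ (0, j) \<in> Tate 1" if "j < r" for j
      using elements_matI[OF assms(20), of 0 j] assms(21) that by auto
  qed (fact assms(4-6) row)+
  define z where "z = col (transpose_mat (map_mat fps_of_poly f) - transpose_mat \<Upsilon>\<^sub>r) 0"
  have z: "z $ k = fps_of_poly (f $$ (0, k)) - \<Upsilon>\<^sub>r $$ (0, k)" if "k < r" for k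
    using that assms(9,20) by (auto simp: z_def)
  have "z $ k \<in> Tate (real q)" if "k < r" for k
    using motive.Tate_add[OF motive.Tate_poly motive.Tate_minus[OF sol.g_Tate[OF that]]] z[OF that] by simp
  then have "delta0_ext F \<theta> act \<sigma> r m d w z = vec d (ex.delta0T (\<lambda>k. z $ k) m)"
    by (rule ex.delta0_ext_eq)
  also have "\<dots> = sol.zv 0"
    unfolding sol.zv_0 using z by (intro eq_vecI) (auto intro!: ex.delta0T_cong)
  finally have ext: "delta0_ext F \<theta> act \<sigma> r m d w z = sol.zv 0" .
  have Exp: "Exp_value q d Q (sol.zv 0) = delta1 q F \<theta> act \<sigma> d w (\<Sum>j<r. act (f $$ (0, j)) (m j))"
    using sol.Exp_zv sol.yv_0 by simp
  \<comment> \<open>On the motive itself the entries of \<delta>_1 are sums of powers of elements of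
    K_bar, which gives the unit property.\<close>
  have "delta1 q F \<theta> act \<sigma> d w x $ i \<in> K_bar F \<theta>" if "i < d" for x i
    using that unfolding motive.delta1_index[OF that] motive.delta1c_def
    by (intro is_subfield_sum[OF motive.is_subfield_K_bar] is_subfield_power[OF motive.is_subfield_K_bar]) auto
  then have "is_unit_point q F \<theta> d Q (sol.zv 0)"
    unfolding is_unit_point_def Exp by (simp add: sol.zv_def)
  moreover have "elements_mat \<Upsilon>\<^sub>r \<subseteq> Tate (vabs \<theta>)"
    using sol.g_Tate assms(20) by (auto simp: motive.vabs_theta dest!: elements_matD)
  ultimately show ?thesis
    by (simp add: ext Exp Let_def flip: z_def)
qed

end
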